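(* Let $k\ge1$, let $(M,Z,x)$ be a compact $b^{2k}$-manifold of dimension $2n$ with a $b^{2k}$-symplectic form $\omega$, and let $\omega_\epsilon$ be the $f_\epsilon$-desingularization of $\omega$ (defined in the context). Then $\omega_\epsilon$ is symplectic. The family $\omega_\epsilon$ coincides with the $b^{2k}$-symplectic form $\omega$ outside an $\epsilon$-neighborhood of $Z$. The family of bivector fields $\omega_\epsilon^{-1}$ converges to the Poisson structure $\omega^{-1}$ in the $C^{2k-1}$-topology as $\epsilon\to0$.
   Context: A $b^m$-manifold is a triple $(M,Z,x)$, where $M$ is a compact oriented smooth manifold without boundary, $x\in C^\infty(M)$ has $0$ as a regular value, and $Z=x^{-1}(0)$. The $b^m$-tangent bundle ${}^{b^m}TM$ is the vector bundle whose smooth sections are the vector fields $v$ on $M$ with $v(x)\in x^m C^\infty(M)$; near $Z$ it is locally framed by $x^m\partial_x$ and $\partial_{z_j}$, where $(x,z_j)$ are local coordinates on $M$. Its dual ${}^{b^m}T^*M$ is locally framed near $Z$ by $dx/x^m$ and $dz_j$. A $b^m$-form of degree $p$ is a smooth section of $\Lambda^p({}^{b^m}T^*M)$; equivalently, a smooth form on $M\setminus Z$ which near $Z$ can be written $\frac{dx}{x^m}\wedge\alpha+\beta$ with $\alpha,\beta$ smooth. It is closed if it is closed on $M\setminus Z$. A $b^m$-symplectic form is a closed $b^m$-form of degree 2 which has maximal rank at every point as a section of $\Lambda^2({}^{b^m}T^*M)$. For a nondegenerate 2-form $\omega$, $\omega^{-1}$ denotes the dual bivector field; for a $b^m$-symplectic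 form, $\omega^{-1}$ (defined on $M\setminus Z$) extends smoothly across $Z$ to a Poisson bivector field on $M$. Laurent decomposition: on a tubular neighborhood $U$ of $Z$, with projection $\pi:U\to Z$ (such that $(\pi,x)$ identifies $U$ with a product of $Z$ with an open interval around $0$), the $b^{2k}$-symplectic form can be written $$\omega=\frac{dx}{x^{2k}}\wedge\Big(\sum_{i=0}^{2k-1}x^i\alpha_i\Big)+\beta,\qquad \alpha_i=\pi^*\hat\alpha_i,$$ where the $\hat\alpha_i$ are closed smooth 1-forms on $Z$ and $\beta$ is a smooth (closed) 2-form on $U$. Fix such a decomposition. Fix an odd function $f\in C^\infty(\mathbb R)$ with $f'(x)>0$ for all $x\in[-1,1]$ and $$f(x)=\frac{-1}{(2k-1)x^{2k-1}}-2\ \text{ for } x<-1,\qquad f(x)=\frac{-1}{(2k-1)x^{2k-1}}+2\ \text{ for } x>1.$$ Put $f_\epsilon(x)=\epsilon^{-(2k-1)}f(x/\epsilon)$, so that $df_\epsilon=dx/x^{2k}$ for $|x|>\epsilon$. For $\epsilon>0$ with $\{|x|\le\epsilon\}\subset U$ (so that the construction makes sense), the $f_\epsilon$-desingularization of $\omega$ is the smooth 2-form $\omega_\epsilon$ on $M$ given on $U$ by $$\omega_\epsilon=df_\epsilon\wedge\Big(\sum_{i=0}^{2k-1}x^i\alpha_i\Big)+\beta$$ (where $f_\epsilon$ is evaluated on the function $x$) and equal to $\omega$ outside the $\epsilon$-neighborhood $\{|x|\le\epsilon\}$ of $Z$.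
   Formalization: "ω_ε is symplectic" is proved for all sufficiently small ε > 0, not for every ε with {|x|≤ε} ⊂ U; for moderate ε it can fail, since f' may be small at a point of (-1,1) where β is negative relative to dx∧α_0. *)

theory Defs
  imports "HOL-Analysis.Analysis"
begin

section \<open>Smooth functions on open subsets of Euclidean space\<close>

primrec iter_deriv :: "'e::euclidean_space list \<Rightarrow> ('e \<Rightarrow> 'b::real_normed_vector) \<Rightarrow> 'e \<Rightarrow> 'b" where
  "iter_deriv [] g = g"
| "iter_deriv (v # vs) g = (\<lambda>y. frechet_derivative (iter_deriv vs g) (at y) v)"

text \<open>On an open set, all iterated directional derivatives being differentiable is
  equivalent to being of class \<open>C\<^sup>\<infinity>\<close>. The predicate is only used on open sets.\<close>

definition smooth_on :: "'e::euclidean_space set \<Rightarrow> ('e \<Rightarrow> 'b::real_normed_vector) \<Rightarrow> bool" where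
  "smooth_on S g \<longleftrightarrow> (\<forall>vs. \<forall>y\<in>S. iter_deriv vs g differentiable (at y))"


section \<open>Smooth manifolds and smooth maps\<close>

text \<open>A chart is a pair of its domain and its coordinate map; the values of the coordinate map
  outside the domain are irrelevant.\<close>

type_synonym ('a, 'e) chart = "'a set \<times> ('a \<Rightarrow> 'e)"

definition local_expr :: "('a \<Rightarrow> 'b) \<Rightarrow> ('a, 'e) chart \<Rightarrow> 'e \<Rightarrow> 'b" where
  "local_expr F c = F \<circ> inv_into (fst c) (snd c)"

definition smooth_in ::
  "('a, 'e::euclidean_space) chart \<Rightarrow> 'a set \<Rightarrow> ('a \<Rightarrow> 'b::real_normed_vector) \<Rightarrow> bool" where
  "smooth_in c W F \<longleftrightarrow> smooth_on (snd c ` (fst c \<inter> W)) (local_expr F c)"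

text \<open>The differential of \<open>F\<close> at \<open>p\<close>, read in the chart \<open>c\<close>. For another chart \<open>d\<close> around \<open>p\<close>,
  \<open>chart_deriv (snd d) c p\<close> is the derivative of the transition map from \<open>c\<close> to \<open>d\<close>;
  for real-valued \<open>F\<close>, \<open>chart_deriv F\<close> is the 1-form \<open>dF\<close>.\<close>

definition chart_deriv ::
  "('a \<Rightarrow> 'b::real_normed_vector) \<Rightarrow> ('a, 'e::euclidean_space) chart \<Rightarrow> 'a \<Rightarrow> 'e \<Rightarrow> 'b" where
  "chart_deriv F c p = frechet_derivative (local_expr F c) (at (snd c p))"

definition is_chart :: "'a topology \<Rightarrow> ('a, 'e::euclidean_space) chart \<Rightarrow> bool" where
  "is_chart X c \<longleftrightarrow> openin X (fst c) \<and> open (snd c ` fst c) \<and>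
     homeomorphic_map (subtopology X (fst c)) (top_of_set (snd c ` fst c)) (snd c)"

definition compatible ::
  "('a, 'e::euclidean_space) chart \<Rightarrow> ('a, 'e) chart \<Rightarrow> bool" where
  "compatible c d \<longleftrightarrow> smooth_in c (fst d) (snd d) \<and> smooth_in d (fst c) (snd c)"

text \<open>A smooth structure is a maximal smooth atlas.\<close>

definition smooth_manifold ::
  "'a topology \<Rightarrow> ('a, 'e::euclidean_space) chart set \<Rightarrow> bool" where
  "smooth_manifold X A \<longleftrightarrow>
     Hausdorff_space X \<and>
     (\<exists>B. countable B \<and> openin X = arbitrary union_of (\<lambda>S. S \<in> B)) \<and>
     (\<forall>c\<in>A. is_chart X c) \<and>
     (\<Union>c\<in>A. fst c) = topspace X \<and>
     (\<forall>c\<in>A. \<forall>d\<in>A. compatible c d) \<and>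
     (\<forall>c. is_chart X c \<and> (\<forall>d\<in>A. compatible c d) \<longrightarrow> c \<in> A)"

text \<open>An orientation is given by a covering subatlas with orientation preserving transitions.\<close>

definition orientation_of ::
  "'a topology \<Rightarrow> ('a, real ^ 'n) chart set \<Rightarrow> ('a, real ^ 'n) chart set \<Rightarrow> bool" where
  "orientation_of X A Ori \<longleftrightarrow>
     Ori \<subseteq> A \<and> (\<Union>c\<in>Ori. fst c) = topspace X \<and>
     (\<forall>c\<in>Ori. \<forall>d\<in>Ori. \<forall>p\<in>fst c \<inter> fst d. det (matrix (chart_deriv (snd d) c p)) > 0)"

text \<open>Smoothness can be tested on any atlas, so the atlases need not be maximal here.\<close>

definition smooth_map ::
  "'a topology \<Rightarrow> ('a, 'e::euclidean_space) chart set \<Rightarrow>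
   'b topology \<Rightarrow> ('b, 'f::euclidean_space) chart set \<Rightarrow> ('a \<Rightarrow> 'b) \<Rightarrow> bool" where
  "smooth_map X A Y B F \<longleftrightarrow> continuous_map X Y F \<and>
     (\<forall>c\<in>A. \<forall>d\<in>B. smooth_in c (F -` fst d) (snd d \<circ> F))"

definition diffeomorphism ::
  "'a topology \<Rightarrow> ('a, 'e::euclidean_space) chart set \<Rightarrow>
   'b topology \<Rightarrow> ('b, 'f::euclidean_space) chart set \<Rightarrow> ('a \<Rightarrow> 'b) \<Rightarrow> bool" where
  "diffeomorphism X A Y B F \<longleftrightarrow>
     (\<exists>G. smooth_map X A Y B F \<and> smooth_map Y B X A G \<and>
          (\<forall>p\<in>topspace X. G (F p) = p) \<and> (\<forall>q\<in>topspace Y. F (G q) = q))"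

definition open_atlas :: "'a set \<Rightarrow> ('a, 'e) chart set \<Rightarrow> ('a, 'e) chart set" where
  "open_atlas W A = {c \<in> A. fst c \<subseteq> W}"

definition prod_atlas ::
  "('a, 'e) chart set \<Rightarrow> ('b, 'f) chart set \<Rightarrow> ('a \<times> 'b, 'e \<times> 'f) chart set" where
  "prod_atlas A B = {(fst c \<times> fst d, map_prod (snd c) (snd d)) | c d. c \<in> A \<and> d \<in> B}"

text \<open>\<open>B\<close> is the smooth structure making the subset \<open>Z\<close> an embedded submanifold:
  the subspace topology, with the inclusion a smooth immersion.\<close>

definition embedded_submanifold ::
  "'a topology \<Rightarrow> ('a, 'e::euclidean_space) chart set \<Rightarrow>
   'a set \<Rightarrow> ('a, 'f::euclidean_space) chart set \<Rightarrow> bool" where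
  "embedded_submanifold X A Z B \<longleftrightarrow>
     Z \<subseteq> topspace X \<and> smooth_manifold (subtopology X Z) B \<and>
     smooth_map (subtopology X Z) B X A (\<lambda>p. p) \<and>
     (\<forall>d\<in>B. \<forall>c\<in>A. \<forall>p\<in>fst d \<inter> fst c. inj (chart_deriv (snd c) d p))"


section \<open>Differential forms and bivector fields\<close>

text \<open>Tensor fields are given by their components in the charts of the atlas, subject to the
  transformation law. The chart \<open>c\<close> identifies the tangent space at \<open>p\<close> with \<open>'e\<close>, and the
  cotangent space with \<open>'e\<close> through the inner product: \<open>a\<close> stands for the covector
  \<open>u \<mapsto> a \<bullet> u\<close>. Only the values at \<open>p \<in> fst c\<close> for charts \<open>c\<close> of the atlas matter.\<close>

type_synonym ('a, 'e) one_field = "('a, 'e) chart \<Rightarrow> 'a \<Rightarrow> 'e \<Rightarrow> real"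
type_synonym ('a, 'e) two_field = "('a, 'e) chart \<Rightarrow> 'a \<Rightarrow> 'e \<Rightarrow> 'e \<Rightarrow> real"

definition one_form ::
  "('a, 'e::euclidean_space) chart set \<Rightarrow> 'a set \<Rightarrow> ('a, 'e) one_field \<Rightarrow> bool" where
  "one_form A W \<alpha> \<longleftrightarrow>
     (\<forall>c\<in>A. \<forall>p\<in>fst c \<inter> W. linear (\<alpha> c p)) \<and>
     (\<forall>c\<in>A. \<forall>d\<in>A. \<forall>p\<in>fst c \<inter> fst d \<inter> W. \<forall>u. \<alpha> c p u = \<alpha> d p (chart_deriv (snd d) c p u)) \<and>
     (\<forall>c\<in>A. \<forall>u. smooth_in c W (\<lambda>p. \<alpha> c p u))"

definition two_form ::
  "('a, 'e::euclidean_space) chart set \<Rightarrow> 'a set \<Rightarrow> ('a, 'e) two_field \<Rightarrow> bool" where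
  "two_form A W \<omega> \<longleftrightarrow>
     (\<forall>c\<in>A. \<forall>p\<in>fst c \<inter> W. bilinear (\<omega> c p) \<and> (\<forall>u. \<omega> c p u u = 0)) \<and>
     (\<forall>c\<in>A. \<forall>d\<in>A. \<forall>p\<in>fst c \<inter> fst d \<inter> W. \<forall>u v.
        \<omega> c p u v = \<omega> d p (chart_deriv (snd d) c p u) (chart_deriv (snd d) c p v)) \<and>
     (\<forall>c\<in>A. \<forall>u v. smooth_in c W (\<lambda>p. \<omega> c p u v))"

definition bivector_field ::
  "('a, 'e::euclidean_space) chart set \<Rightarrow> 'a set \<Rightarrow> ('a, 'e) two_field \<Rightarrow> bool" where
  "bivector_field A W P \<longleftrightarrow>
     (\<forall>c\<in>A. \<forall>p\<in>fst c \<inter> W. bilinear (P c p) \<and> (\<forall>a. P c p a a = 0)) \<and>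
     (\<forall>c\<in>A. \<forall>d\<in>A. \<forall>p\<in>fst c \<inter> fst d \<inter> W. \<forall>a b.
        P d p a b = P c p (adjoint (chart_deriv (snd d) c p) a) (adjoint (chart_deriv (snd d) c p) b)) \<and>
     (\<forall>c\<in>A. \<forall>a b. smooth_in c W (\<lambda>p. P c p a b))"

definition closed_one_form ::
  "('a, 'e::euclidean_space) chart set \<Rightarrow> 'a set \<Rightarrow> ('a, 'e) one_field \<Rightarrow> bool" where
  "closed_one_form A W \<alpha> \<longleftrightarrow> one_form A W \<alpha> \<and>
     (\<forall>c\<in>A. \<forall>p\<in>fst c \<inter> W. \<forall>u v.
        chart_deriv (\<lambda>q. \<alpha> c q v) c p u - chart_deriv (\<lambda>q. \<alpha> c q u) c p v = 0)"

definition closed_two_form ::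
  "('a, 'e::euclidean_space) chart set \<Rightarrow> 'a set \<Rightarrow> ('a, 'e) two_field \<Rightarrow> bool" where
  "closed_two_form A W \<omega> \<longleftrightarrow> two_form A W \<omega> \<and>
     (\<forall>c\<in>A. \<forall>p\<in>fst c \<inter> W. \<forall>u v w.
        chart_deriv (\<lambda>q. \<omega> c q v w) c p u + chart_deriv (\<lambda>q. \<omega> c q w u) c p v
          + chart_deriv (\<lambda>q. \<omega> c q u v) c p w = 0)"

definition nondegenerate :: "('e::euclidean_space \<Rightarrow> 'e \<Rightarrow> real) \<Rightarrow> bool" where
  "nondegenerate w \<longleftrightarrow> (\<forall>u. (\<forall>v. w u v = 0) \<longrightarrow> u = 0)"

definition symplectic ::
  "('a, 'e::euclidean_space) chart set \<Rightarrow> 'a set \<Rightarrow> ('a, 'e) two_field \<Rightarrow> bool" where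
  "symplectic A W \<omega> \<longleftrightarrow> closed_two_form A W \<omega> \<and> (\<forall>c\<in>A. \<forall>p\<in>fst c \<inter> W. nondegenerate (\<omega> c p))"

definition wedge :: "('a, 'e) one_field \<Rightarrow> ('a, 'e) one_field \<Rightarrow> ('a, 'e) two_field" where
  "wedge \<alpha> \<beta> = (\<lambda>c p u v. \<alpha> c p u * \<beta> c p v - \<alpha> c p v * \<beta> c p u)"

text \<open>The pullback of a 1-form along \<open>F\<close>; for a 1-form \<open>\<alpha>\<close> on the target, the choice of the chart
  \<open>d\<close> of the target atlas \<open>B\<close> is immaterial.\<close>

definition pullback ::
  "('b, 'f::euclidean_space) chart set \<Rightarrow> ('a \<Rightarrow> 'b) \<Rightarrow> ('b, 'f) one_field \<Rightarrow>
   ('a, 'e::euclidean_space) one_field" where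
  "pullback B F \<alpha> = (\<lambda>c p u.
     let d = (SOME d. d \<in> B \<and> F p \<in> fst d) in \<alpha> d (F p) (chart_deriv (snd d \<circ> F) c p u))"

text \<open>The vector \<open>sharp w a\<close> is the preimage of the covector \<open>a\<close> under \<open>u \<mapsto> w u _\<close>, so that
  \<open>inverse_bivector \<omega>\<close> is the bivector field with \<open>P(\<omega>(u,_), \<omega>(v,_)) = \<omega>(u,v)\<close>.
  It is meaningful where \<open>\<omega>\<close> is nondegenerate.\<close>

definition sharp :: "('e::euclidean_space \<Rightarrow> 'e \<Rightarrow> real) \<Rightarrow> 'e \<Rightarrow> 'e" where
  "sharp w a = (THE u. \<forall>v. w u v = a \<bullet> v)"

definition inverse_bivector :: "('a, 'e::euclidean_space) two_field \<Rightarrow> ('a, 'e) two_field" where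
  "inverse_bivector \<omega> = (\<lambda>c p a b. \<omega> c p (sharp (\<omega> c p) a) (sharp (\<omega> c p) b))"

text \<open>The vanishing of the Schouten bracket \<open>[P,P]\<close> in coordinates, that is
  \<open>\<Sum>\<^sub>l (P\<^sup>i\<^sup>l \<partial>\<^sub>l P\<^sup>j\<^sup>k + P\<^sup>j\<^sup>l \<partial>\<^sub>l P\<^sup>k\<^sup>i + P\<^sup>k\<^sup>l \<partial>\<^sub>l P\<^sup>i\<^sup>j) = 0\<close>: \<open>hamvec P c p a\<close> is the vector
  obtained by contracting \<open>P\<close> with the covector \<open>a\<close> in the first slot.\<close>

definition hamvec :: "('a, 'e::euclidean_space) two_field \<Rightarrow> ('a, 'e) chart \<Rightarrow> 'a \<Rightarrow> 'e \<Rightarrow> 'e" where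
  "hamvec P c p a = (\<Sum>i\<in>Basis. P c p a i *\<^sub>R i)"

definition poisson ::
  "('a, 'e::euclidean_space) chart set \<Rightarrow> 'a set \<Rightarrow> ('a, 'e) two_field \<Rightarrow> bool" where
  "poisson A W P \<longleftrightarrow> bivector_field A W P \<and>
     (\<forall>c\<in>A. \<forall>p\<in>fst c \<inter> W. \<forall>a b d.
        chart_deriv (\<lambda>q. P c q b d) c p (hamvec P c p a)
        + chart_deriv (\<lambda>q. P c q d a) c p (hamvec P c p b)
        + chart_deriv (\<lambda>q. P c q a b) c p (hamvec P c p d) = 0)"

text \<open>Convergence in the (weak) \<open>C\<^sup>r\<close>-topology: in every chart, uniform convergence on compact
  sets of all derivatives of order at most \<open>r\<close> of the components. On a compact manifold this
  is the \<open>C\<^sup>r\<close>-topology.\<close>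

definition converges_C ::
  "nat \<Rightarrow> ('a, 'e::euclidean_space) chart set \<Rightarrow>
   ('t \<Rightarrow> ('a, 'e) two_field) \<Rightarrow> ('a, 'e) two_field \<Rightarrow> 't filter \<Rightarrow> bool" where
  "converges_C r A P Q F \<longleftrightarrow>
     (\<forall>c\<in>A. \<forall>K. compact K \<and> K \<subseteq> snd c ` fst c \<longrightarrow>
        (\<forall>vs. length vs \<le> r \<longrightarrow> (\<forall>a b.
           uniform_limit K (\<lambda>t. iter_deriv vs (local_expr (\<lambda>p. P t c p a b) c))
             (iter_deriv vs (local_expr (\<lambda>p. Q c p a b) c)) F)))"


section \<open>\<open>b\<^sup>m\<close>-manifolds and \<open>b\<^sup>m\<close>-symplectic forms\<close>

definition zero_set :: "'a topology \<Rightarrow> ('a \<Rightarrow> real) \<Rightarrow> 'a set" where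
  "zero_set X x = {p \<in> topspace X. x p = 0}"

definition bm_manifold ::
  "'a topology \<Rightarrow> ('a, real ^ 'n) chart set \<Rightarrow> ('a, real ^ 'n) chart set \<Rightarrow> ('a \<Rightarrow> real) \<Rightarrow> bool" where
  "bm_manifold X A Ori x \<longleftrightarrow>
     smooth_manifold X A \<and> compact_space X \<and> orientation_of X A Ori \<and>
     (\<forall>c\<in>A. smooth_in c (topspace X) x) \<and>
     (\<forall>c\<in>A. \<forall>p\<in>fst c \<inter> zero_set X x. \<exists>u. chart_deriv x c p u \<noteq> 0)"

text \<open>If \<open>x\<close> is the coordinate in the direction of the basis vector \<open>e\<close> of the chart \<open>c\<close>, then
  the \<open>b\<^sup>m\<close>-tangent bundle is framed over the chart by \<open>x\<^sup>m \<partial>\<^sub>x\<close> and the other coordinate fields.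
  \<open>bm_frame\<close> is the linear map taking the coordinate frame to this frame. \<open>bm_components\<close> says
  that the components of \<open>\<omega>\<close> (a form off \<open>Z\<close>) in this frame extend smoothly across \<open>Z\<close>, to \<open>b\<close>;
  then \<open>b c q\<close> represents \<open>\<omega>\<close> at \<open>q\<close> as an element of the second exterior power of the fibre of
  the \<open>b\<^sup>m\<close>-cotangent bundle, also for \<open>q \<in> Z\<close>.\<close>

definition bm_frame :: "nat \<Rightarrow> ('a \<Rightarrow> real) \<Rightarrow> 'e::euclidean_space \<Rightarrow> 'a \<Rightarrow> 'e \<Rightarrow> 'e" where
  "bm_frame m x e q u = u - (u \<bullet> e) *\<^sub>R e + (u \<bullet> e) *\<^sub>R (x q ^ m *\<^sub>R e)"

definition bm_components ::
  "nat \<Rightarrow> 'a topology \<Rightarrow> ('a, 'e::euclidean_space) chart set \<Rightarrow> ('a \<Rightarrow> real) \<Rightarrow>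
   ('a, 'e) two_field \<Rightarrow> ('a, 'e) chart \<Rightarrow> 'e \<Rightarrow> ('a \<Rightarrow> 'e \<Rightarrow> 'e \<Rightarrow> real) \<Rightarrow> bool" where
  "bm_components m X A x \<omega> c e b \<longleftrightarrow>
     c \<in> A \<and> e \<in> Basis \<and> (\<forall>q\<in>fst c. x q = snd c q \<bullet> e) \<and>
     (\<forall>u v. smooth_in c (topspace X) (\<lambda>q. b q u v)) \<and>
     (\<forall>q\<in>fst c - zero_set X x. \<forall>u v. b q u v = \<omega> c q (bm_frame m x e q u) (bm_frame m x e q v))"

definition bm_two_form ::
  "nat \<Rightarrow> 'a topology \<Rightarrow> ('a, 'e::euclidean_space) chart set \<Rightarrow> ('a \<Rightarrow> real) \<Rightarrow>
   ('a, 'e) two_field \<Rightarrow> bool" where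
  "bm_two_form m X A x \<omega> \<longleftrightarrow>
     two_form A (topspace X - zero_set X x) \<omega> \<and>
     (\<forall>p\<in>zero_set X x. \<exists>c e b. p \<in> fst c \<and> bm_components m X A x \<omega> c e b)"

definition bm_symplectic ::
  "nat \<Rightarrow> 'a topology \<Rightarrow> ('a, 'e::euclidean_space) chart set \<Rightarrow> ('a \<Rightarrow> real) \<Rightarrow>
   ('a, 'e) two_field \<Rightarrow> bool" where
  "bm_symplectic m X A x \<omega> \<longleftrightarrow>
     bm_two_form m X A x \<omega> \<and>
     closed_two_form A (topspace X - zero_set X x) \<omega> \<and>
     (\<forall>c\<in>A. \<forall>p\<in>fst c - zero_set X x. nondegenerate (\<omega> c p)) \<and>
     (\<forall>p\<in>zero_set X x. \<forall>c e b. p \<in> fst c \<and> bm_components m X A x \<omega> c e b \<longrightarrow> nondegenerate (b p))"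


section \<open>Laurent decomposition and desingularization\<close>

definition tubular_neighborhood ::
  "'a topology \<Rightarrow> ('a, 'e::euclidean_space) chart set \<Rightarrow> ('a \<Rightarrow> real) \<Rightarrow>
   ('a, 'f::euclidean_space) chart set \<Rightarrow> 'a set \<Rightarrow> ('a \<Rightarrow> 'a) \<Rightarrow> bool" where
  "tubular_neighborhood X A x B U \<pi> \<longleftrightarrow>
     openin X U \<and> zero_set X x \<subseteq> U \<and> (\<forall>p\<in>zero_set X x. \<pi> p = p) \<and>
     (\<exists>l r. l < 0 \<and> 0 < r \<and>
        diffeomorphism (subtopology X U) (open_atlas U A)
          (prod_topology (subtopology X (zero_set X x)) (top_of_set {l<..<r}))
          (prod_atlas B {({l<..<r}, \<lambda>t. t)})
          (\<lambda>p. (\<pi> p, x p)))"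

definition laurent_sum ::
  "nat \<Rightarrow> ('a \<Rightarrow> real) \<Rightarrow> ('b, 'f::euclidean_space) chart set \<Rightarrow> ('a \<Rightarrow> 'b) \<Rightarrow>
   (nat \<Rightarrow> ('b, 'f) one_field) \<Rightarrow> ('a, 'e::euclidean_space) one_field" where
  "laurent_sum m x B \<pi> \<alpha> = (\<lambda>c p u. \<Sum>i<m. x p ^ i * pullback B \<pi> (\<alpha> i) c p u)"

definition laurent_decomposition ::
  "nat \<Rightarrow> 'a topology \<Rightarrow> ('a, 'e::euclidean_space) chart set \<Rightarrow> ('a \<Rightarrow> real) \<Rightarrow>
   ('a, 'f::euclidean_space) chart set \<Rightarrow> 'a set \<Rightarrow> ('a \<Rightarrow> 'a) \<Rightarrow>
   (nat \<Rightarrow> ('a, 'f) one_field) \<Rightarrow> ('a, 'e) two_field \<Rightarrow> ('a, 'e) two_field \<Rightarrow> bool" where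
  "laurent_decomposition m X A x B U \<pi> \<alpha> \<beta> \<omega> \<longleftrightarrow>
     tubular_neighborhood X A x B U \<pi> \<and>
     (\<forall>i<m. closed_one_form B (zero_set X x) (\<alpha> i)) \<and>
     closed_two_form A U \<beta> \<and>
     (\<forall>c\<in>A. \<forall>p\<in>fst c \<inter> (U - zero_set X x). \<forall>u v.
        \<omega> c p u v =
          wedge (\<lambda>c p u. chart_deriv x c p u / x p ^ m) (laurent_sum m x B \<pi> \<alpha>) c p u v + \<beta> c p u v)"

definition desing_function :: "nat \<Rightarrow> (real \<Rightarrow> real) \<Rightarrow> bool" where
  "desing_function k f \<longleftrightarrow>
     smooth_on UNIV f \<and> (\<forall>s. f (- s) = - f s) \<and> (\<forall>s\<in>{-1..1}. deriv f s > 0) \<and>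
     (\<forall>s. s < -1 \<longrightarrow> f s = -1 / (real (2*k - 1) * s ^ (2*k - 1)) - 2) \<and>
     (\<forall>s. s > 1 \<longrightarrow> f s = -1 / (real (2*k - 1) * s ^ (2*k - 1)) + 2)"

definition f_eps :: "nat \<Rightarrow> (real \<Rightarrow> real) \<Rightarrow> real \<Rightarrow> real \<Rightarrow> real" where
  "f_eps k f \<epsilon> s = f (s / \<epsilon>) / \<epsilon> ^ (2*k - 1)"

definition desingularization ::
  "nat \<Rightarrow> (real \<Rightarrow> real) \<Rightarrow> ('a \<Rightarrow> real) \<Rightarrow> ('a, 'f::euclidean_space) chart set \<Rightarrow>
   'a set \<Rightarrow> ('a \<Rightarrow> 'a) \<Rightarrow> (nat \<Rightarrow> ('a, 'f) one_field) \<Rightarrow> ('a, 'e::euclidean_space) two_field \<Rightarrow>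
   ('a, 'e) two_field \<Rightarrow> real \<Rightarrow> ('a, 'e) two_field" where
  "desingularization k f x B U \<pi> \<alpha> \<beta> \<omega> \<epsilon> = (\<lambda>c p u v.
     if p \<in> U
     then wedge (chart_deriv (\<lambda>q. f_eps k f \<epsilon> (x q))) (laurent_sum (2*k) x B \<pi> \<alpha>) c p u v + \<beta> c p u v
     else \<omega> c p u v)"

end

theory Submission
  imports Defs
begin

text \<open>
  Let \<open>\<Lambda> = \<Sum> x\<^sup>i \<alpha>\<^sub>i\<close> and \<open>\<eta> = dx \<and> \<Lambda>\<close>. Near \<open>Z\<close> both forms have the shape
  \<open>g\<^sup>-\<^sup>1 \<eta> + \<beta>\<close>: for \<open>\<omega>\<close> the factor is \<open>g = x\<^sup>2\<^sup>k\<close>, and for \<open>\<omega>\<^sub>\<epsilon>\<close> it is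
  \<open>g = \<gamma>\<^sub>\<epsilon>(x)\<close> with \<open>\<gamma>\<^sub>\<epsilon> = 1/f\<^sub>\<epsilon>'\<close>, a positive smooth function. In a chart in which \<open>x\<close> is a
  coordinate, the frame \<open>g \<partial>\<^sub>x, \<partial>\<^sub>z\<close> absorbs the pole: the matrix of \<open>g\<^sup>-\<^sup>1 \<eta> + \<beta>\<close> in it
  (\<open>frame_form\<close>) is a polynomial in \<open>g\<close> with smooth coefficients. For \<open>g = 0\<close> on \<open>Z\<close> it is the matrix
  of \<open>\<omega>\<close> as a form on the \<open>b\<^sup>2\<^sup>k\<close>-tangent bundle, so that it is invertible
  (\<open>obtain_adapted_chart\<close>). By Cramer's rule the inverse bivector is therefore one and the same
  rational function of \<open>g\<close> and of smooth functions, regular near \<open>Z \<times> {0}\<close>, evaluated at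
  \<open>\<gamma>\<^sub>\<epsilon>(x)\<close> or at \<open>x\<^sup>2\<^sup>k\<close> (\<open>frame_inverse_field_lim\<close>).

  Everything thus reduces to the convergence of \<open>\<gamma>\<^sub>\<epsilon>\<close> to \<open>x\<^sup>2\<^sup>k\<close> in \<open>C\<^sup>2\<^sup>k\<^sup>-\<^sup>1\<close>. The two
  functions agree for \<open>\<bar>x\<bar> > \<epsilon>\<close>, and their difference is \<open>\<epsilon>\<^sup>2\<^sup>k h(x/\<epsilon>)\<close> with a fixed smooth
  \<open>h\<close> supported in \<open>[-1, 1]\<close>. Its derivative of order \<open>j\<close> is bounded by a multiple of
  \<open>\<epsilon>\<^sup>2\<^sup>k\<^sup>-\<^sup>j\<close>, which tends to zero for \<open>j < 2k\<close> (\<open>jet_lim_scaled_bump\<close>, \<open>\<gamma>_jet_lim\<close>). In particular \<open>\<gamma>\<^sub>\<epsilon>(x)\<close> is small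
  near \<open>Z\<close>, so that \<open>\<omega>\<^sub>\<epsilon>\<close> is nondegenerate there for small \<open>\<epsilon>\<close>; by compactness this covers the strip
  \<open>\<bar>x\<bar> \<le> \<epsilon>\<close>, outside of which \<open>\<omega>\<^sub>\<epsilon> = \<omega>\<close>.

  For closedness, off \<open>Z\<close> the form \<open>\<eta> = x\<^sup>2\<^sup>k (\<omega> - \<beta>)\<close> is closed because \<open>\<omega>\<close> and \<open>\<beta>\<close> are and
  \<open>dx \<and> \<eta> = 0\<close>; by density \<open>\<eta>\<close> is closed, hence so is \<open>f\<^sub>\<epsilon>'(x) \<eta> + \<beta>\<close>
  (\<open>\<eta>_closed\<close>, \<open>\<omega>\<epsilon>_closed\<close>). The Poisson structure is obtained as the limit of the
  \<open>\<omega>\<^sub>\<epsilon>\<^sup>-\<^sup>1\<close>. These satisfy the Jacobi identity (\<open>inverse_bivector_jacobi\<close>), and so does their limit, the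
  convergence being at least \<open>C\<^sup>1\<close>.

  Smoothness and \<open>C\<^sup>r\<close>-convergence are treated at once by the notion of convergence of jets,
  \<open>jet_lim\<close>.
\<close>

section \<open>Jet-wise convergence of families of functions\<close>

abbreviation dir_deriv :: "'e::euclidean_space \<Rightarrow> ('e \<Rightarrow> 'b::real_normed_vector) \<Rightarrow> 'e \<Rightarrow> 'b" where
  "dir_deriv v g \<equiv> (\<lambda>y. frechet_derivative g (at y) v)"

lemma differentiable_cong_eventually:
  assumes "\<forall>\<^sub>F w in nhds z. f w = g w"
  shows "f differentiable (at z) \<longleftrightarrow> g differentiable (at z)"
    and "frechet_derivative f (at z) = frechet_derivative g (at z)"
proof -
  have z: "f z = g z" using assms by (rule eventually_nhds_x_imp_x)
  have at: "\<forall>\<^sub>F w in at z. f w = g w" using assms eventually_nhds_conv_at by blast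
  have at': "\<forall>\<^sub>F w in at z. g w = f w" using at by eventually_elim simp
  have *: "(f has_derivative D) (at z) \<longleftrightarrow> (g has_derivative D) (at z)" for D
    using has_derivative_transform_eventually[OF _ at z] has_derivative_transform_eventually[OF _ at' z[symmetric]]
    by auto
  show "f differentiable (at z) \<longleftrightarrow> g differentiable (at z)"
    by (simp add: differentiable_def *)
  show "frechet_derivative f (at z) = frechet_derivative g (at z)"
    by (simp add: frechet_derivative_def *)
qed

text \<open>Derivatives depend on germs. An identity between families that holds eventually in the parameter
  and the point holds there on germs, and may thus be differentiated.\<close>

lemma eventually_prod_nhds_nhds:
  assumes "\<forall>\<^sub>F p in F \<times>\<^sub>F nhds y. P (fst p) (snd p)"
  shows "\<forall>\<^sub>F p in F \<times>\<^sub>F nhds y. \<forall>\<^sub>F w in nhds (snd p). P (fst p) w"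
proof -
  obtain Pf Pg where *: "eventually Pf F" "eventually Pg (nhds y)"
    "\<And>t z. Pf t \<Longrightarrow> Pg z \<Longrightarrow> P t z"
    using assms unfolding eventually_prod_filter by auto
  have "\<forall>\<^sub>F z in nhds y. \<forall>\<^sub>F w in nhds z. Pg w"
    using *(2) by (simp add: eventually_eventually)
  then show ?thesis
    unfolding eventually_prod_filter
    using *(1,3) by (auto intro!: exI[of _ Pf] elim!: eventually_mono)
qed

lemma eventually_snd_prod: "eventually P G \<Longrightarrow> \<forall>\<^sub>F p in F \<times>\<^sub>F G. P (snd p)"
  using filterlim_snd[of G F] by (auto simp: filterlim_iff)

lemma eventually_fst_prod: "eventually P F \<Longrightarrow> \<forall>\<^sub>F p in F \<times>\<^sub>F G. P (fst p)"
  using filterlim_fst[of F G] by (auto simp: filterlim_iff)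

text \<open>Convergence of \<open>r\<close>-jets at \<open>y\<close> is imposed along the product of the parameter filter with
  the neighbourhoods of \<open>y\<close>. This continuous convergence is equivalent to locally uniform
  convergence of the derivatives when the limit is smooth, but, unlike uniform convergence, it is
  a plain limit, so that the calculus of limits applies to it. A constant family satisfies it to every
  order at all points of an open set exactly when the function is smooth there. Each closure property
  below is thus at the same time one of smooth functions and one of the \<open>C\<^sup>r\<close>-topology.\<close>

primrec jet_lim ::
  "'t filter \<Rightarrow> nat \<Rightarrow> ('t \<Rightarrow> 'e::euclidean_space \<Rightarrow> real) \<Rightarrow> ('e \<Rightarrow> real) \<Rightarrow> 'e \<Rightarrow> bool" where
  "jet_lim F 0 G g y \<longleftrightarrow> ((\<lambda>p. G (fst p) (snd p)) \<longlongrightarrow> g y) (F \<times>\<^sub>F nhds y)"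
| "jet_lim F (Suc r) G g y \<longleftrightarrow>
     ((\<lambda>p. G (fst p) (snd p)) \<longlongrightarrow> g y) (F \<times>\<^sub>F nhds y) \<and>
     (\<forall>\<^sub>F p in F \<times>\<^sub>F nhds y. G (fst p) differentiable (at (snd p))) \<and>
     (\<forall>\<^sub>F z in nhds y. g differentiable (at z)) \<and>
     (\<forall>v. jet_lim F r (\<lambda>t. dir_deriv v (G t)) (dir_deriv v g) y)"

lemma jet_lim_tendsto: "jet_lim F r G g y \<Longrightarrow> ((\<lambda>p. G (fst p) (snd p)) \<longlongrightarrow> g y) (F \<times>\<^sub>F nhds y)"
  by (cases r) auto

lemma jet_lim_Suc_mono: "jet_lim F (Suc r) G g y \<Longrightarrow> jet_lim F r G g y"
  by (induction r arbitrary: G g) auto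

lemma jet_lim_mono: "jet_lim F s G g y \<Longrightarrow> r \<le> s \<Longrightarrow> jet_lim F r G g y"
  by (induction s) (auto simp: le_Suc_eq dest: jet_lim_Suc_mono simp del: jet_lim.simps)

lemma jet_lim_cong:
  assumes "jet_lim F r G g y"
    and "\<forall>\<^sub>F p in F \<times>\<^sub>F nhds y. G (fst p) (snd p) = H (fst p) (snd p)"
    and "\<forall>\<^sub>F z in nhds y. g z = h z"
  shows "jet_lim F r H h y"
  using assms
proof (induction r arbitrary: G g H h)
  case 0
  have "h y = g y" using eventually_nhds_x_imp_x[OF 0(3)] by simp
  then show ?case using 0 by (auto elim: Lim_transform_eventually)
next
  case (Suc r)
  have hy: "h y = g y" using eventually_nhds_x_imp_x[OF Suc.prems(3)] by simp
  have E: "\<forall>\<^sub>F p in F \<times>\<^sub>F nhds y. \<forall>\<^sub>F w in nhds (snd p). G (fst p) w = H (fst p) w"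
    using eventually_prod_nhds_nhds[of "\<lambda>t z. G t z = H t z"] Suc.prems(2) by simp
  have e: "\<forall>\<^sub>F z in nhds y. \<forall>\<^sub>F w in nhds z. g w = h w"
    using Suc.prems(3) by (simp add: eventually_eventually)
  have "jet_lim F r (\<lambda>t. dir_deriv v (H t)) (dir_deriv v h) y" for v
  proof (rule Suc.IH)
    show "jet_lim F r (\<lambda>t. dir_deriv v (G t)) (dir_deriv v g) y" using Suc.prems(1) by simp
    show "\<forall>\<^sub>F p in F \<times>\<^sub>F nhds y. dir_deriv v (G (fst p)) (snd p) = dir_deriv v (H (fst p)) (snd p)"
      using E by eventually_elim (simp add: differentiable_cong_eventually(2))
    show "\<forall>\<^sub>F z in nhds y. dir_deriv v g z = dir_deriv v h z"
      using e by eventually_elim (simp add: differentiable_cong_eventually(2))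
  qed
  moreover have "\<forall>\<^sub>F p in F \<times>\<^sub>F nhds y. H (fst p) differentiable (at (snd p))"
  proof -
    have "\<forall>\<^sub>F p in F \<times>\<^sub>F nhds y. G (fst p) differentiable (at (snd p))"
      using Suc.prems(1) by simp
    then show ?thesis using E
      by eventually_elim (use differentiable_cong_eventually(1) in blast)
  qed
  moreover have "\<forall>\<^sub>F z in nhds y. h differentiable (at z)"
  proof -
    have "\<forall>\<^sub>F z in nhds y. g differentiable (at z)" using Suc.prems(1) by simp
    then show ?thesis using e
      by eventually_elim (use differentiable_cong_eventually(1) in blast)
  qed
  moreover have "((\<lambda>p. H (fst p) (snd p)) \<longlongrightarrow> h y) (F \<times>\<^sub>F nhds y)"
    unfolding hy using Suc.prems(1,2) by (auto elim: Lim_transform_eventually)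
  ultimately show ?case by simp
qed

lemma jet_lim_const: "jet_lim F r (\<lambda>t z. a) (\<lambda>z. a) y"
  by (induction r arbitrary: a) auto

lemma jet_lim_add:
  assumes "jet_lim F r G g y" "jet_lim F r H h y"
  shows "jet_lim F r (\<lambda>t z. G t z + H t z) (\<lambda>z. g z + h z) y"
  using assms
proof (induction r arbitrary: G g H h)
  case 0
  then show ?case by (auto intro!: tendsto_add)
next
  case (Suc r)
  have D: "\<forall>\<^sub>F p in F \<times>\<^sub>F nhds y. G (fst p) differentiable (at (snd p)) \<and> H (fst p) differentiable (at (snd p))"
    and d: "\<forall>\<^sub>F z in nhds y. g differentiable (at z) \<and> h differentiable (at z)"
    using Suc.prems by (auto intro: eventually_conj)
  have eq: "dir_deriv v (\<lambda>z. f z + k z) z = dir_deriv v f z + dir_deriv v k z"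
    if "f differentiable (at z)" "k differentiable (at z)" for f k :: "'b \<Rightarrow> real" and v z
    by (simp add: frechet_derivative_at[OF has_derivative_add[OF that[unfolded frechet_derivative_works]], symmetric])
  have "jet_lim F r (\<lambda>t. dir_deriv v (\<lambda>z. G t z + H t z)) (dir_deriv v (\<lambda>z. g z + h z)) y" for v
  proof (rule jet_lim_cong)
    show "jet_lim F r (\<lambda>t z. dir_deriv v (G t) z + dir_deriv v (H t) z)
        (\<lambda>z. dir_deriv v g z + dir_deriv v h z) y"
      using Suc.prems by (intro Suc.IH) auto
  qed ((use D in \<open>eventually_elim, simp add: eq\<close>), (use d in \<open>eventually_elim, simp add: eq\<close>))
  moreover have "((\<lambda>p. G (fst p) (snd p) + H (fst p) (snd p)) \<longlongrightarrow> g y + h y) (F \<times>\<^sub>F nhds y)"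
    using Suc.prems by (auto intro!: tendsto_add)
  ultimately show ?case
    using D d by (auto elim!: eventually_mono intro!: differentiable_add)
qed

lemma jet_lim_mult:
  assumes "jet_lim F r G g y" "jet_lim F r H h y"
  shows "jet_lim F r (\<lambda>t z. G t z * H t z) (\<lambda>z. g z * h z) y"
  using assms
proof (induction r arbitrary: G g H h)
  case 0
  then show ?case by (auto intro!: tendsto_mult)
next
  case (Suc r)
  have D: "\<forall>\<^sub>F p in F \<times>\<^sub>F nhds y. G (fst p) differentiable (at (snd p)) \<and> H (fst p) differentiable (at (snd p))"
    and d: "\<forall>\<^sub>F z in nhds y. g differentiable (at z) \<and> h differentiable (at z)"
    using Suc.prems by (auto intro: eventually_conj)
  have eq: "dir_deriv v (\<lambda>z. f z * k z) z = f z * dir_deriv v k z + dir_deriv v f z * k z"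
    if "f differentiable (at z)" "k differentiable (at z)" for f k :: "'b \<Rightarrow> real" and v z
    by (simp add: frechet_derivative_at[OF has_derivative_mult[OF that[unfolded frechet_derivative_works]], symmetric])
  have "jet_lim F r (\<lambda>t. dir_deriv v (\<lambda>z. G t z * H t z)) (dir_deriv v (\<lambda>z. g z * h z)) y" for v
  proof (rule jet_lim_cong)
    show "jet_lim F r (\<lambda>t z. G t z * dir_deriv v (H t) z + dir_deriv v (G t) z * H t z)
        (\<lambda>z. g z * dir_deriv v h z + dir_deriv v g z * h z) y"
      using Suc.prems Suc.prems[THEN jet_lim_Suc_mono] by (intro jet_lim_add Suc.IH) auto
  qed ((use D in \<open>eventually_elim, simp add: eq\<close>), (use d in \<open>eventually_elim, simp add: eq\<close>))
  moreover have "((\<lambda>p. G (fst p) (snd p) * H (fst p) (snd p)) \<longlongrightarrow> g y * h y) (F \<times>\<^sub>F nhds y)"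
    using Suc.prems by (auto intro!: tendsto_mult)
  ultimately show ?case
    using D d by (auto elim!: eventually_mono intro!: differentiable_mult)
qed

lemma jet_lim_minus:
  assumes "jet_lim F r G g y"
  shows "jet_lim F r (\<lambda>t z. - G t z) (\<lambda>z. - g z) y"
  using jet_lim_mult[OF jet_lim_const[of F r "-1"] assms] by simp

lemma jet_lim_diff:
  assumes "jet_lim F r G g y" "jet_lim F r H h y"
  shows "jet_lim F r (\<lambda>t z. G t z - H t z) (\<lambda>z. g z - h z) y"
  using jet_lim_add[OF assms(1) jet_lim_minus[OF assms(2)]] by simp

lemma jet_lim_sum:
  assumes "\<And>i. i \<in> I \<Longrightarrow> jet_lim F r (G i) (g i) y"
  shows "jet_lim F r (\<lambda>t z. \<Sum>i\<in>I. G i t z) (\<lambda>z. \<Sum>i\<in>I. g i z) y"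
  using assms by (induction I rule: infinite_finite_induct) (auto intro: jet_lim_const jet_lim_add)

lemma jet_lim_power:
  assumes "jet_lim F r G g y"
  shows "jet_lim F r (\<lambda>t z. G t z ^ m) (\<lambda>z. g z ^ m) y"
  by (induction m) (auto intro: jet_lim_const jet_lim_mult assms)

lemma jet_lim_eventually_nonzero:
  assumes "jet_lim F r G g y" "g y \<noteq> 0"
  shows "\<forall>\<^sub>F p in F \<times>\<^sub>F nhds y. G (fst p) (snd p) \<noteq> 0"
  using tendsto_imp_eventually_ne[OF jet_lim_tendsto[OF assms(1)] assms(2)] .

text \<open>The derivative of \<open>1/G\<close> is \<open>- (1/G) \<cdot> G' \<cdot> (1/G)\<close>, so that control of \<open>1/G\<close> to some
  order gives control to the next one.\<close>

lemma jet_lim_inverse: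
  assumes "jet_lim F r G g y" "g y \<noteq> 0"
  shows "jet_lim F r (\<lambda>t z. inverse (G t z)) (\<lambda>z. inverse (g z)) y"
  using assms
proof (induction r)
  case 0
  then show ?case by (auto intro!: tendsto_inverse)
next
  case (Suc r)
  have ne: "\<forall>\<^sub>F p in F \<times>\<^sub>F nhds y. G (fst p) (snd p) \<noteq> 0"
    using Suc.prems by (rule jet_lim_eventually_nonzero)
  have "g differentiable (at y)" using Suc.prems eventually_nhds_x_imp_x by fastforce
  then have "(g \<longlongrightarrow> g y) (nhds y)"
    using differentiable_imp_continuous_within tendsto_at_iff_tendsto_nhds
    by (metis continuous_within)
  then have "\<forall>\<^sub>F z in nhds y. g z \<noteq> 0" using Suc.prems(2) tendsto_imp_eventually_ne by blast
  then have d: "\<forall>\<^sub>F z in nhds y. g differentiable (at z) \<and> g z \<noteq> 0"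
    using Suc.prems(1) by (auto intro: eventually_conj)
  have D: "\<forall>\<^sub>F p in F \<times>\<^sub>F nhds y. G (fst p) differentiable (at (snd p)) \<and> G (fst p) (snd p) \<noteq> 0"
    using Suc.prems ne by (auto intro: eventually_conj)
  have eq: "dir_deriv v (\<lambda>z. inverse (f z)) z = - (inverse (f z) * dir_deriv v f z * inverse (f z))"
    if "f differentiable (at z)" "f z \<noteq> 0" for f :: "'b \<Rightarrow> real" and v z
    by (simp add: frechet_derivative_at[OF Deriv.has_derivative_inverse[OF that(2) that(1)[unfolded frechet_derivative_works]], symmetric])
  have IH: "jet_lim F r (\<lambda>t z. inverse (G t z)) (\<lambda>z. inverse (g z)) y"
    using Suc jet_lim_Suc_mono by blast
  have "jet_lim F r (\<lambda>t. dir_deriv v (\<lambda>z. inverse (G t z))) (dir_deriv v (\<lambda>z. inverse (g z))) y" for v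
  proof (rule jet_lim_cong)
    show "jet_lim F r (\<lambda>t z. - (inverse (G t z) * dir_deriv v (G t) z * inverse (G t z)))
        (\<lambda>z. - (inverse (g z) * dir_deriv v g z * inverse (g z))) y"
      using Suc.prems by (intro jet_lim_minus jet_lim_mult IH) auto
  qed ((use D in \<open>eventually_elim, simp add: eq\<close>), (use d in \<open>eventually_elim, simp add: eq\<close>))
  moreover have "((\<lambda>p. inverse (G (fst p) (snd p))) \<longlongrightarrow> inverse (g y)) (F \<times>\<^sub>F nhds y)"
    using Suc.prems by (auto intro!: tendsto_inverse)
  ultimately show ?case
    using D d by (auto elim!: eventually_mono intro!: differentiable_inverse)
qed

lemma jet_lim_divide:
  assumes "jet_lim F r G g y" "jet_lim F r H h y" "h y \<noteq> 0"
  shows "jet_lim F r (\<lambda>t z. G t z / H t z) (\<lambda>z. g z / h z) y"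
  using jet_lim_mult[OF assms(1) jet_lim_inverse[OF assms(2,3)]] by (simp add: divide_inverse)

lemma iter_deriv_append: "iter_deriv (vs @ ws) g = iter_deriv vs (iter_deriv ws g)"
  by (induction vs) auto

lemma iter_deriv_cong:
  assumes "open S" "\<And>z. z \<in> S \<Longrightarrow> g z = h z" "y \<in> S"
  shows "iter_deriv vs g y = iter_deriv vs h y"
  using assms(3)
proof (induction vs arbitrary: y)
  case (Cons v vs)
  have "\<forall>\<^sub>F w in nhds y. iter_deriv vs g w = iter_deriv vs h w"
    unfolding eventually_nhds using Cons assms(1) by (intro exI[of _ S]) auto
  then show ?case by (simp add: differentiable_cong_eventually(2))
qed (use assms in auto)

lemma smooth_on_cong:
  assumes "open S" "\<And>z. z \<in> S \<Longrightarrow> g z = h z" "smooth_on S g"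
  shows "smooth_on S h"
  unfolding smooth_on_def
proof (intro allI ballI)
  fix vs y assume y: "y \<in> S"
  have "\<forall>\<^sub>F w in nhds y. iter_deriv vs g w = iter_deriv vs h w"
    unfolding eventually_nhds using y assms(1) iter_deriv_cong[OF assms(1,2)] by (intro exI[of _ S]) auto
  from differentiable_cong_eventually(1)[OF this] show "iter_deriv vs h differentiable at y"
    using assms(3) y by (simp add: smooth_on_def)
qed

lemma smooth_on_subset: "smooth_on S g \<Longrightarrow> T \<subseteq> S \<Longrightarrow> smooth_on T g"
  by (auto simp: smooth_on_def)

lemma smooth_on_differentiable: "smooth_on S g \<Longrightarrow> y \<in> S \<Longrightarrow> g differentiable (at y)"
  unfolding smooth_on_def by (metis iter_deriv.simps(1))

lemma smooth_on_dir_deriv: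
  assumes "smooth_on S g"
  shows "smooth_on S (dir_deriv v g)"
  unfolding smooth_on_def
proof (intro allI ballI)
  fix vs y assume "y \<in> S"
  then have "iter_deriv (vs @ [v]) g differentiable at y" using assms by (auto simp: smooth_on_def)
  then show "iter_deriv vs (dir_deriv v g) differentiable at y" by (simp add: iter_deriv_append)
qed

lemma jet_lim_smooth:
  assumes "open S" "smooth_on S g" "y \<in> S"
  shows "jet_lim F r (\<lambda>t. g) g y"
  using assms(2)
proof (induction r arbitrary: g)
  have T: "((\<lambda>p. g (snd p)) \<longlongrightarrow> g y) (F \<times>\<^sub>F nhds y)" if "smooth_on S g" for g :: "'a \<Rightarrow> real"
  proof -
    have "isCont g y"
      using smooth_on_differentiable[OF that assms(3)] differentiable_imp_continuous_within by blast
    then have "(g \<longlongrightarrow> g y) (nhds y)" using tendsto_at_iff_tendsto_nhds isContD by blast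
    then show ?thesis using filterlim_compose[OF _ filterlim_snd] by blast
  qed
  {
    case 0
    then show ?case using T by simp
  next
    case (Suc r)
    have d: "\<forall>\<^sub>F z in nhds y. g differentiable (at z)"
      unfolding eventually_nhds using smooth_on_differentiable[OF Suc.prems] assms(1,3) by (intro exI[of _ S]) auto
    then show ?case using T[OF Suc.prems] eventually_snd_prod[OF d] Suc.IH smooth_on_dir_deriv[OF Suc.prems]
      by auto
  }
qed

lemma jet_lim_iter_deriv:
  assumes "jet_lim F (r + length vs) G g y"
  shows "jet_lim F r (\<lambda>t. iter_deriv vs (G t)) (iter_deriv vs g) y"
  using assms
proof (induction vs arbitrary: G g rule: rev_induct)
  case (snoc v vs)
  then show ?case by (simp add: iter_deriv_append)
qed auto

text \<open>The filter is arbitrary, because a constant family does not depend on the parameter.\<close>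

lemma smooth_on_iff_jet_lim:
  assumes "open S"
  shows "smooth_on S g \<longleftrightarrow> (\<forall>y\<in>S. \<forall>r. jet_lim F r (\<lambda>t. g) g y)"
proof
  assume R: "\<forall>y\<in>S. \<forall>r. jet_lim F r (\<lambda>t. g) g y"
  show "smooth_on S g"
    unfolding smooth_on_def
  proof (intro allI ballI)
    fix vs y assume "y \<in> S"
    then have "jet_lim F (Suc 0) (\<lambda>t. iter_deriv vs g) (iter_deriv vs g) y"
      using R jet_lim_iter_deriv by blast
    then show "iter_deriv vs g differentiable at y" using eventually_nhds_x_imp_x by fastforce
  qed
qed (use jet_lim_smooth assms in blast)

lemma iter_deriv_bounded_linear:
  assumes "bounded_linear L" "open S" "smooth_on S T" "y \<in> S"
  shows "iter_deriv vs (\<lambda>z. L (T z)) y = L (iter_deriv vs T y)"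
  using assms(4)
proof (induction vs arbitrary: y)
  case (Cons v vs)
  have "\<forall>\<^sub>F w in nhds y. iter_deriv vs (\<lambda>z. L (T z)) w = L (iter_deriv vs T w)"
    unfolding eventually_nhds using Cons assms(2) by (intro exI[of _ S]) auto
  moreover have "iter_deriv vs T differentiable at y" using assms Cons by (auto simp: smooth_on_def)
  then have "((\<lambda>w. L (iter_deriv vs T w)) has_derivative (\<lambda>h. L (frechet_derivative (iter_deriv vs T) (at y) h))) (at y)"
    using bounded_linear.has_derivative[OF assms(1)] by (auto simp: frechet_derivative_works)
  ultimately show ?case
    by (simp add: differentiable_cong_eventually(2) frechet_derivative_at[symmetric])
qed auto

lemma smooth_on_bounded_linear:
  assumes "bounded_linear L" "open S" "smooth_on S T"
  shows "smooth_on S (\<lambda>z. L (T z))"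
  unfolding smooth_on_def
proof (intro allI ballI)
  fix vs y assume y: "y \<in> S"
  have "\<forall>\<^sub>F w in nhds y. iter_deriv vs (\<lambda>z. L (T z)) w = L (iter_deriv vs T w)"
    unfolding eventually_nhds using y assms(2) iter_deriv_bounded_linear[OF assms] by (intro exI[of _ S]) auto
  moreover have "iter_deriv vs T differentiable at y" using assms y by (auto simp: smooth_on_def)
  then have "(\<lambda>w. L (iter_deriv vs T w)) differentiable at y"
    using bounded_linear.has_derivative[OF assms(1)] unfolding differentiable_def by blast
  ultimately show "iter_deriv vs (\<lambda>z. L (T z)) differentiable at y"
    using differentiable_cong_eventually(1)[of "iter_deriv vs (\<lambda>z. L (T z))" "\<lambda>w. L (iter_deriv vs T w)" y]
    by simp
qed

lemma dir_deriv_inner: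
  assumes "T differentiable (at z)"
  shows "dir_deriv v (\<lambda>z. T z \<bullet> i) z = frechet_derivative T (at z) v \<bullet> i"
  by (simp add: frechet_derivative_at[OF has_derivative_inner_left[OF assms[unfolded frechet_derivative_works]], symmetric])

lemma dir_deriv_compose:
  fixes T :: "'e::euclidean_space \<Rightarrow> 'f::euclidean_space" and g :: "'f \<Rightarrow> real"
  assumes "T differentiable (at z)" "g differentiable (at (T z))"
  shows "dir_deriv v (\<lambda>z. g (T z)) z
    = (\<Sum>i\<in>Basis. dir_deriv i g (T z) * dir_deriv v (\<lambda>z. T z \<bullet> i) z)"
proof -
  have lin: "linear (frechet_derivative g (at (T z)))"
    using assms(2) linear_frechet_derivative by blast
  have "dir_deriv v (\<lambda>z. g (T z)) z = frechet_derivative g (at (T z)) (frechet_derivative T (at z) v)"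
    using frechet_derivative_compose[OF assms] by (simp add: o_def fun_eq_iff)
  also have "\<dots> = frechet_derivative g (at (T z)) (\<Sum>i\<in>Basis. (frechet_derivative T (at z) v \<bullet> i) *\<^sub>R i)"
    by (simp add: euclidean_representation)
  also have "\<dots> = (\<Sum>i\<in>Basis. (frechet_derivative T (at z) v \<bullet> i) * frechet_derivative g (at (T z)) i)"
    by (simp add: linear_sum[OF lin] linear_cmul[OF lin])
  finally show ?thesis by (simp add: dir_deriv_inner[OF assms(1)] mult.commute)
qed

text \<open>By the chain rule, the derivatives of \<open>G\<^sub>t \<circ> T\<close> are sums of products of the functions
  \<open>\<partial>\<^sub>i G\<^sub>t \<circ> T\<close>, to which the induction on the order applies, and of smooth functions.\<close>

lemma jet_lim_compose:
  fixes T :: "'e::euclidean_space \<Rightarrow> 'f::euclidean_space"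
  assumes "open S" "smooth_on S T" "y \<in> S" "jet_lim F r G g (T y)"
  shows "jet_lim F r (\<lambda>t z. G t (T z)) (\<lambda>z. g (T z)) y"
  using assms(4)
proof (induction r arbitrary: G g)
  have Td: "\<forall>\<^sub>F z in nhds y. T differentiable (at z)"
    unfolding eventually_nhds using smooth_on_differentiable[OF assms(2)] assms(1,3) by (intro exI[of _ S]) auto
  have "isCont T y"
    using smooth_on_differentiable[OF assms(2,3)] differentiable_imp_continuous_within by blast
  then have Tlim: "filterlim T (nhds (T y)) (nhds y)"
    using tendsto_at_iff_tendsto_nhds isContD by blast
  have lim: "filterlim (\<lambda>p. (fst p, T (snd p))) (F \<times>\<^sub>F nhds (T y)) (F \<times>\<^sub>F nhds y)"
    by (intro filterlim_Pair filterlim_fst filterlim_compose[OF Tlim filterlim_snd])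
  have T0: "((\<lambda>p. G (fst p) (T (snd p))) \<longlongrightarrow> g (T y)) (F \<times>\<^sub>F nhds y)"
    if "((\<lambda>p. G (fst p) (snd p)) \<longlongrightarrow> g (T y)) (F \<times>\<^sub>F nhds (T y))" for G g
    using filterlim_compose[OF that lim] by simp
  {
    case 0
    then show ?case using T0 by simp
  next
    case (Suc r)
    have "\<forall>\<^sub>F p in F \<times>\<^sub>F nhds (T y). G (fst p) differentiable (at (snd p))" using Suc.prems by simp
    from filterlim_iff[THEN iffD1, OF lim, rule_format, OF this] eventually_snd_prod[OF Td, of F]
    have D: "\<forall>\<^sub>F p in F \<times>\<^sub>F nhds y. G (fst p) differentiable (at (T (snd p))) \<and> T differentiable (at (snd p))"
      by eventually_elim auto
    have "\<forall>\<^sub>F z in nhds (T y). g differentiable (at z)" using Suc.prems by simp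
    from filterlim_iff[THEN iffD1, OF Tlim, rule_format, OF this] Td
    have d: "\<forall>\<^sub>F z in nhds y. g differentiable (at (T z)) \<and> T differentiable (at z)"
      by eventually_elim auto
    have Ti: "smooth_on S (dir_deriv v (\<lambda>z. T z \<bullet> i))" for v i
      by (intro smooth_on_dir_deriv smooth_on_bounded_linear[OF bounded_linear_inner_left] assms)
    have "jet_lim F r (\<lambda>t. dir_deriv v (\<lambda>z. G t (T z))) (dir_deriv v (\<lambda>z. g (T z))) y" for v
    proof (rule jet_lim_cong)
      show "jet_lim F r (\<lambda>t z. \<Sum>i\<in>Basis. dir_deriv i (G t) (T z) * dir_deriv v (\<lambda>z. T z \<bullet> i) z)
         (\<lambda>z. \<Sum>i\<in>Basis. dir_deriv i g (T z) * dir_deriv v (\<lambda>z. T z \<bullet> i) z) y"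
        using Suc.prems
        by (intro jet_lim_sum jet_lim_mult Suc.IH jet_lim_smooth[OF assms(1) Ti assms(3)]) auto
    qed ((use D in \<open>eventually_elim, simp add: dir_deriv_compose\<close>), (use d in \<open>eventually_elim, simp add: dir_deriv_compose\<close>))
    moreover have "(\<lambda>z. h (T z)) differentiable (at z)"
      if "h differentiable (at (T z))" "T differentiable (at z)" for h :: "'f \<Rightarrow> real" and z
      using differentiable_chain_at[OF that(2,1)] by (simp add: o_def)
    ultimately show ?case
      using D d T0[of G g] Suc.prems by (auto elim!: eventually_mono)
  }
qed

lemma jet_lim_pointwise:
  assumes "jet_lim F r G g y"
  shows "((\<lambda>t. G t y) \<longlongrightarrow> g y) F"
proof -
  have "filterlim (\<lambda>t. (t, y)) (F \<times>\<^sub>F nhds y) F"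
    by (intro filterlim_Pair filterlim_ident) simp
  from filterlim_compose[OF jet_lim_tendsto[OF assms] this] show ?thesis by simp
qed

text \<open>On a compact set, continuous convergence to a continuous function is uniform: the
  neighbourhoods on which the distance is small admit a finite subcover.\<close>

lemma jet_lim_uniform_limit:
  assumes "compact K" "length vs \<le> r"
    and G: "\<And>y. y \<in> K \<Longrightarrow> jet_lim F r G g y" and g: "\<And>y. y \<in> K \<Longrightarrow> jet_lim F r (\<lambda>t. g) g y"
  shows "uniform_limit K (\<lambda>t. iter_deriv vs (G t)) (iter_deriv vs g) F"
proof (rule uniform_limitI)
  fix e :: real assume e: "e > 0"
  let ?P = "\<lambda>t z. dist (iter_deriv vs (G t) z) (iter_deriv vs g z) < e"
  have "\<exists>Q S. eventually Q F \<and> open S \<and> y \<in> S \<and> (\<forall>t z. Q t \<longrightarrow> z \<in> S \<longrightarrow> ?P t z)" if "y \<in> K" for y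
  proof -
    have "jet_lim F 0 (\<lambda>t. iter_deriv vs (G t)) (iter_deriv vs g) y"
      "jet_lim F 0 (\<lambda>t. iter_deriv vs g) (iter_deriv vs g) y"
      using G[OF that] g[OF that] assms(2)
      by (auto intro!: jet_lim_iter_deriv simp del: jet_lim.simps elim: jet_lim_mono)
    from tendsto_diff[OF this[THEN jet_lim_tendsto]]
    have "((\<lambda>p. iter_deriv vs (G (fst p)) (snd p) - iter_deriv vs g (snd p)) \<longlongrightarrow> 0) (F \<times>\<^sub>F nhds y)"
      by simp
    from tendstoD[OF this e]
    have "\<forall>\<^sub>F p in F \<times>\<^sub>F nhds y. ?P (fst p) (snd p)" by (simp add: dist_norm)
    then show ?thesis unfolding eventually_prod_filter eventually_nhds by fastforce
  qed
  then obtain Q S where QS: "\<And>y. y \<in> K \<Longrightarrow> eventually (Q y) F \<and> open (S y) \<and> y \<in> S y \<and>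
      (\<forall>t z. Q y t \<longrightarrow> z \<in> S y \<longrightarrow> ?P t z)"
    by metis
  obtain C where C: "C \<subseteq> K" "finite C" "K \<subseteq> (\<Union>y\<in>C. S y)"
    using compactE_image[OF assms(1), of K S] QS by blast
  have "\<forall>\<^sub>F t in F. \<forall>y\<in>C. Q y t" using C QS by (intro eventually_ball_finite) blast+
  then show "\<forall>\<^sub>F t in F. \<forall>z\<in>K. ?P t z"
    by eventually_elim (use C QS in blast)
qed

text \<open>The profile \<open>h\<close> is shrunk to width \<open>\<epsilon>\<close> and multiplied by \<open>\<epsilon>\<^sup>m\<close>. Each derivative costs a
  factor \<open>1/\<epsilon>\<close>, so that the derivatives of order less than \<open>m\<close> tend to zero uniformly. This is
  where the order of the \<open>C\<^sup>r\<close>-convergence of the desingularization comes from.\<close>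

lemma jet_lim_scaled_bump:
  fixes h :: "real \<Rightarrow> real"
  assumes "smooth_on UNIV h" "\<And>s. \<bar>s\<bar> > 1 \<Longrightarrow> h s = 0" "r < m"
  shows "jet_lim (at_right 0) r (\<lambda>\<epsilon> s. \<epsilon> ^ m * h (s / \<epsilon>)) (\<lambda>s. 0) y"
  using assms
proof (induction r arbitrary: h m)
  have T: "((\<lambda>p. fst p ^ m * h (snd p / fst p)) \<longlongrightarrow> 0) (at_right (0::real) \<times>\<^sub>F nhds y)"
    if "smooth_on UNIV h" "\<And>s. \<bar>s\<bar> > 1 \<Longrightarrow> h s = 0" "0 < m" for h :: "real \<Rightarrow> real" and m
  proof -
    have "continuous_on {-1..1} h"
      using smooth_on_differentiable[OF that(1)]
      by (simp add: continuous_at_imp_continuous_on differentiable_imp_continuous_within)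
    then have "compact (h ` {-1..1})" by (rule compact_continuous_image) simp
    then obtain C where C: "\<forall>s\<in>{-1..1}. \<bar>h s\<bar> \<le> C"
      using compact_imp_bounded by (fastforce simp: bounded_iff)
    \<comment> \<open>The bound on the support is a bound everywhere.\<close>
    have hC: "\<bar>h s\<bar> \<le> C" for s
    proof (cases "\<bar>s\<bar> > 1")
      case True
      then show ?thesis using that(2) C by force
    next
      case False
      then have "s \<in> {-1..1}" by auto
      then show ?thesis using C by blast
    qed
    have "((\<lambda>p. fst p ^ m * C) \<longlongrightarrow> 0 ^ m * C) (at_right (0::real) \<times>\<^sub>F nhds y)"
      by (intro tendsto_mult tendsto_power tendsto_const filterlim_compose[OF _ filterlim_fst])
        (simp add: filterlim_at_split[symmetric] tendsto_ident_at)
    then have lim: "((\<lambda>p. fst p ^ m * C) \<longlongrightarrow> 0) (at_right (0::real) \<times>\<^sub>F nhds y)"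
      using that(3) by (simp add: zero_power)
    show ?thesis
    proof (rule Lim_null_comparison[OF _ lim])
      have "\<forall>\<^sub>F p in at_right (0::real) \<times>\<^sub>F nhds y. fst p > 0"
        by (rule eventually_fst_prod) (simp add: eventually_at_right_less)
      then show "\<forall>\<^sub>F p in at_right 0 \<times>\<^sub>F nhds y. norm (fst p ^ m * h (snd p / fst p)) \<le> fst p ^ m * C"
        by eventually_elim (simp add: abs_mult hC mult_left_mono)
    qed
  qed
  {
    case 0
    then show ?case using T[OF 0(1,2)] by simp
  next
    case (Suc r)
    \<comment> \<open>The derivative is again a scaled bump, with profile \<open>h'\<close> and exponent \<open>m - 1\<close>.\<close>
    have d: "(\<lambda>s. \<epsilon> ^ m * h (s / \<epsilon>)) differentiable (at s)"
      and eq: "dir_deriv v (\<lambda>s. \<epsilon> ^ m * h (s / \<epsilon>)) s = \<epsilon> ^ (m - 1) * dir_deriv v h (s / \<epsilon>)"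
      if "\<epsilon> > 0" for v s \<epsilon> :: real
    proof -
      have hd: "h differentiable (at (s / \<epsilon>))" using Suc.prems(1) smooth_on_differentiable by blast
      have "((\<lambda>s. s / \<epsilon>) has_derivative (\<lambda>v. v / \<epsilon>)) (at s)"
        by (rule bounded_linear.has_derivative[OF bounded_linear_divide has_derivative_ident])
      from has_derivative_compose[OF this hd[unfolded frechet_derivative_works]]
      have "((\<lambda>s. h (s / \<epsilon>)) has_derivative (\<lambda>v. frechet_derivative h (at (s / \<epsilon>)) (v / \<epsilon>))) (at s)" .
      then have D: "((\<lambda>s. \<epsilon> ^ m * h (s / \<epsilon>)) has_derivative (\<lambda>v. \<epsilon> ^ m * frechet_derivative h (at (s / \<epsilon>)) (v / \<epsilon>))) (at s)"
        by (rule has_derivative_mult_right)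
      have lin: "linear (frechet_derivative h (at (s / \<epsilon>)))" using hd linear_frechet_derivative by blast
      have "frechet_derivative h (at (s / \<epsilon>)) (v / \<epsilon>) = frechet_derivative h (at (s / \<epsilon>)) v / \<epsilon>"
        using linear_cmul[OF lin, of "1 / \<epsilon>" v] by simp
      moreover have "\<epsilon> ^ m = \<epsilon> ^ (m - 1) * \<epsilon>" using Suc.prems(3) by (cases m) auto
      ultimately show "dir_deriv v (\<lambda>s. \<epsilon> ^ m * h (s / \<epsilon>)) s = \<epsilon> ^ (m - 1) * dir_deriv v h (s / \<epsilon>)"
        using that frechet_derivative_at[OF D] by (auto simp: fun_eq_iff dest: spec[of _ v])
      show "(\<lambda>s. \<epsilon> ^ m * h (s / \<epsilon>)) differentiable (at s)" using D differentiable_def by blast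
    qed
    have pos: "\<forall>\<^sub>F p in at_right (0::real) \<times>\<^sub>F nhds y. fst p > 0"
      by (rule eventually_fst_prod) (simp add: eventually_at_right_less)
    have "jet_lim (at_right 0) r (\<lambda>\<epsilon>. dir_deriv v (\<lambda>s. \<epsilon> ^ m * h (s / \<epsilon>))) (dir_deriv v (\<lambda>s. 0)) y" for v
    proof (rule jet_lim_cong)
      have "dir_deriv v h s = 0" if "\<bar>s\<bar> > 1" for s
      proof -
        have "\<forall>\<^sub>F w in nhds s. h w = 0"
          unfolding eventually_nhds
          using that Suc.prems(2) by (intro exI[of _ "{w. 1 < \<bar>w\<bar>}"]) (auto intro!: open_Collect_less continuous_intros)
        then show ?thesis using differentiable_cong_eventually(2)[of h "\<lambda>_. 0" s] by simp
      qed
      then show "jet_lim (at_right 0) r (\<lambda>\<epsilon> s. \<epsilon> ^ (m - 1) * dir_deriv v h (s / \<epsilon>)) (\<lambda>s. 0) y"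
        using Suc.prems by (intro Suc.IH smooth_on_dir_deriv) auto
      show "\<forall>\<^sub>F p in at_right 0 \<times>\<^sub>F nhds y. fst p ^ (m - 1) * dir_deriv v h (snd p / fst p) =
           dir_deriv v (\<lambda>s. fst p ^ m * h (s / fst p)) (snd p)"
        using pos by eventually_elim (simp add: eq)
    qed simp
    moreover have "\<forall>\<^sub>F p in at_right 0 \<times>\<^sub>F nhds y. (\<lambda>s. fst p ^ m * h (s / fst p)) differentiable (at (snd p))"
      using pos by eventually_elim (rule d)
    ultimately show ?case using T[OF Suc.prems(1,2)] Suc.prems(3) by simp
  }
qed

section \<open>Functions and forms in charts\<close>

lemma
  assumes "is_chart X c"
  shows chart_subset: "fst c \<subseteq> topspace X"
    and chart_openin: "openin X (fst c)"
    and chart_inj: "inj_on (snd c) (fst c)"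
    and chart_open_image: "openin X W \<Longrightarrow> open (snd c ` (fst c \<inter> W))"
    and chart_open_vimage: "open V \<Longrightarrow> openin X {p \<in> fst c. snd c p \<in> V}"
proof -
  have o: "openin X (fst c)" "open (snd c ` fst c)"
    and h: "homeomorphic_map (subtopology X (fst c)) (top_of_set (snd c ` fst c)) (snd c)"
    using assms by (auto simp: is_chart_def)
  show sub: "fst c \<subseteq> topspace X" using o(1) openin_subset by blast
  then have ts: "topspace (subtopology X (fst c)) = fst c" by auto
  show "openin X (fst c)" by (rule o)
  show "inj_on (snd c) (fst c)" using homeomorphic_imp_injective_map[OF h] ts by simp
  show "open (snd c ` (fst c \<inter> W))" if "openin X W"
  proof -
    have "openin (subtopology X (fst c)) (fst c \<inter> W)" using that
      by (simp add: openin_subtopology_Int2)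
    then have "openin (top_of_set (snd c ` fst c)) (snd c ` (fst c \<inter> W))"
      using homeomorphic_imp_open_map[OF h] by (simp add: open_map_def)
    then show ?thesis using o(2) openin_open_eq by blast
  qed
  show "openin X {p \<in> fst c. snd c p \<in> V}" if "open V"
  proof -
    have "continuous_map (subtopology X (fst c)) (top_of_set (snd c ` fst c)) (snd c)"
      using h homeomorphic_imp_continuous_map by blast
    then have "continuous_map (subtopology X (fst c)) euclidean (snd c)"
      by (rule continuous_map_into_fulltopology)
    then have "openin (subtopology X (fst c)) {p \<in> fst c. snd c p \<in> V}"
      using openin_continuous_map_preimage[of _ euclidean _ V] that ts by force
    then show ?thesis using o(1) openin_trans_full by blast
  qed
qed

lemma local_expr_at: "is_chart X c \<Longrightarrow> p \<in> fst c \<Longrightarrow> local_expr f c (snd c p) = f p"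
  by (simp add: local_expr_def chart_inj inv_into_f_f)

lemma eventually_nhds_chart:
  assumes "is_chart X c" "openin X W" "p \<in> fst c \<inter> W" "\<And>q. q \<in> fst c \<inter> W \<Longrightarrow> P (snd c q)"
  shows "\<forall>\<^sub>F z in nhds (snd c p). P z"
  unfolding eventually_nhds
  using chart_open_image[OF assms(1,2)] assms(3,4) by (intro exI[of _ "snd c ` (fst c \<inter> W)"]) auto

definition field_lim ::
  "'t filter \<Rightarrow> ('a, 'e::euclidean_space) chart \<Rightarrow> nat \<Rightarrow> ('t \<Rightarrow> 'a \<Rightarrow> real) \<Rightarrow> ('a \<Rightarrow> real) \<Rightarrow> 'a \<Rightarrow> bool" where
  "field_lim F c r H h p \<longleftrightarrow> jet_lim F r (\<lambda>t. local_expr (H t) c) (local_expr h c) (snd c p)"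

lemma field_lim_const: "field_lim F c r (\<lambda>t q. a) (\<lambda>q. a) p"
  using jet_lim_const[of F r a] by (simp add: field_lim_def local_expr_def o_def)

lemma field_lim_add:
  "field_lim F c r G g p \<Longrightarrow> field_lim F c r H h p \<Longrightarrow> field_lim F c r (\<lambda>t q. G t q + H t q) (\<lambda>q. g q + h q) p"
  using jet_lim_add by (fastforce simp: field_lim_def local_expr_def o_def)

lemma field_lim_diff:
  "field_lim F c r G g p \<Longrightarrow> field_lim F c r H h p \<Longrightarrow> field_lim F c r (\<lambda>t q. G t q - H t q) (\<lambda>q. g q - h q) p"
  using jet_lim_diff by (fastforce simp: field_lim_def local_expr_def o_def)

lemma field_lim_mult:
  "field_lim F c r G g p \<Longrightarrow> field_lim F c r H h p \<Longrightarrow> field_lim F c r (\<lambda>t q. G t q * H t q) (\<lambda>q. g q * h q) p"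
  using jet_lim_mult by (fastforce simp: field_lim_def local_expr_def o_def)

lemma field_lim_power:
  "field_lim F c r G g p \<Longrightarrow> field_lim F c r (\<lambda>t q. G t q ^ m) (\<lambda>q. g q ^ m) p"
  by (induction m) (auto intro: field_lim_const field_lim_mult)

lemma field_lim_sum:
  assumes "\<And>i. i \<in> I \<Longrightarrow> field_lim F c r (G i) (g i) p"
  shows "field_lim F c r (\<lambda>t q. \<Sum>i\<in>I. G i t q) (\<lambda>q. \<Sum>i\<in>I. g i q) p"
  using assms by (induction I rule: infinite_finite_induct) (auto intro: field_lim_const field_lim_add)

lemma field_lim_cong:
  assumes c: "is_chart X c" "openin X W" "p \<in> fst c \<inter> W" and "field_lim F c r G g p"
    and "\<forall>\<^sub>F t in F. \<forall>q\<in>fst c \<inter> W. G t q = H t q" and eq: "\<And>q. q \<in> fst c \<inter> W \<Longrightarrow> g q = h q"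
  shows "field_lim F c r H h p"
  unfolding field_lim_def
proof (rule jet_lim_cong)
  show "jet_lim F r (\<lambda>t. local_expr (G t) c) (local_expr g c) (snd c p)"
    using assms(4) by (simp add: field_lim_def)
  show "\<forall>\<^sub>F z in nhds (snd c p). local_expr g c z = local_expr h c z"
    by (rule eventually_nhds_chart[OF c]) (use eq in \<open>simp add: local_expr_at[OF c(1)]\<close>)
  have "\<forall>\<^sub>F z in nhds (snd c p). z \<in> snd c ` (fst c \<inter> W)"
    by (rule eventually_nhds_chart[OF c]) auto
  from eventually_fst_prod[OF assms(5)] eventually_snd_prod[OF this]
  show "\<forall>\<^sub>F z in F \<times>\<^sub>F nhds (snd c p). local_expr (G (fst z)) c (snd z) = local_expr (H (fst z)) c (snd z)"
    by eventually_elim (auto simp: local_expr_at[OF c(1)])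
qed

lemma field_lim_pointwise:
  assumes "is_chart X c" "p \<in> fst c" "field_lim F c r H h p"
  shows "((\<lambda>t. H t p) \<longlongrightarrow> h p) F"
  using jet_lim_pointwise[OF assms(3)[unfolded field_lim_def]] by (simp add: local_expr_at[OF assms(1,2)])

lemma smooth_in_iff_field_lim:
  assumes "is_chart X c" "openin X W"
  shows "smooth_in c W h \<longleftrightarrow> (\<forall>p\<in>fst c \<inter> W. \<forall>r. field_lim F c r (\<lambda>t. h) h p)"
  unfolding smooth_in_def field_lim_def smooth_on_iff_jet_lim[OF chart_open_image[OF assms], of _ F] by auto

lemma smooth_in_imp_field_lim:
  "is_chart X c \<Longrightarrow> openin X W \<Longrightarrow> p \<in> fst c \<inter> W \<Longrightarrow> smooth_in c W h \<Longrightarrow> field_lim F c r (\<lambda>t. h) h p"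
  using smooth_in_iff_field_lim by blast

lemma smooth_inI_field_lim:
  assumes "is_chart X c" "openin X W"
    and "\<And>p r. p \<in> fst c \<inter> W \<Longrightarrow> field_lim (at_right (0::real)) c r (\<lambda>t. h) h p"
  shows "smooth_in c W h"
  unfolding smooth_in_iff_field_lim[OF assms(1,2), of _ "at_right (0::real)"] using assms(3) by blast

lemma field_lim_differentiable:
  assumes "field_lim F c 1 H h p"
  shows "local_expr h c differentiable (at (snd c p))"
proof -
  have "\<forall>\<^sub>F z in nhds (snd c p). local_expr h c differentiable (at z)"
    using assms by (simp add: field_lim_def)
  then show ?thesis by (rule eventually_nhds_x_imp_x)
qed

lemma smooth_in_differentiable:
  assumes "smooth_in c W h" "p \<in> fst c \<inter> W"
  shows "local_expr h c differentiable (at (snd c p))"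
  using smooth_on_differentiable assms unfolding smooth_in_def by blast

lemma chart_deriv_cong:
  assumes "is_chart X c" "openin X W" "p \<in> fst c \<inter> W" "\<And>q. q \<in> fst c \<inter> W \<Longrightarrow> g q = h q"
  shows "chart_deriv g c p = chart_deriv h c p"
  unfolding chart_deriv_def
  by (rule differentiable_cong_eventually, rule eventually_nhds_chart[OF assms(1-3)])
    (use assms(4) in \<open>simp add: local_expr_at[OF assms(1)]\<close>)

text \<open>Here \<open>\<Phi>\<close> maps the part of the chart \<open>c\<close> in \<open>W\<close> smoothly into the chart \<open>d\<close>, possibly of
  another manifold. Changes of charts are the case of the identity map.\<close>

lemma field_lim_pullback:
  fixes d :: "('b, 'f::euclidean_space) chart" and c :: "('a, 'e::euclidean_space) chart"
  assumes c: "is_chart X c" "openin X W" "p \<in> fst c \<inter> W" and d: "is_chart Y d"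
    and \<Phi>: "\<And>q. q \<in> fst c \<inter> W \<Longrightarrow> \<Phi> q \<in> fst d"
    and sm: "smooth_in c W (\<lambda>q. snd d (\<Phi> q))"
    and lim: "field_lim F d r H h (\<Phi> p)"
  shows "field_lim F c r (\<lambda>t q. H t (\<Phi> q)) (\<lambda>q. h (\<Phi> q)) p"
proof -
  let ?T = "local_expr (\<lambda>q. snd d (\<Phi> q)) c"
  have T: "?T (snd c q) = snd d (\<Phi> q)" if "q \<in> fst c" for q by (rule local_expr_at[OF c(1) that])
  have "jet_lim F r (\<lambda>t z. local_expr (H t) d (?T z)) (\<lambda>z. local_expr h d (?T z)) (snd c p)"
  proof (rule jet_lim_compose)
    show "open (snd c ` (fst c \<inter> W))" by (rule chart_open_image[OF c(1,2)])
    show "smooth_on (snd c ` (fst c \<inter> W)) ?T" using sm by (simp add: smooth_in_def)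
    show "snd c p \<in> snd c ` (fst c \<inter> W)" using c by auto
    show "jet_lim F r (\<lambda>t. local_expr (H t) d) (local_expr h d) (?T (snd c p))"
      using lim T c(3) by (auto simp: field_lim_def)
  qed
  note jl = this
  have E: "\<forall>\<^sub>F z in nhds (snd c p). \<forall>k::'b \<Rightarrow> real. local_expr k d (?T z) = local_expr (\<lambda>q. k (\<Phi> q)) c z"
    by (rule eventually_nhds_chart[OF c])
      (use T \<Phi> in \<open>auto simp: local_expr_at[OF c(1)] local_expr_at[OF d]\<close>)
  show ?thesis
    unfolding field_lim_def
  proof (rule jet_lim_cong[OF jl])
    show "\<forall>\<^sub>F z in nhds (snd c p). local_expr h d (?T z) = local_expr (\<lambda>q. h (\<Phi> q)) c z"
      using E by eventually_elim simp
    show "\<forall>\<^sub>F z in F \<times>\<^sub>F nhds (snd c p). local_expr (H (fst z)) d (?T (snd z)) =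
        local_expr (\<lambda>q. H (fst z) (\<Phi> q)) c (snd z)"
      using eventually_snd_prod[OF E] by eventually_elim simp
  qed
qed

lemma chart_deriv_chain:
  fixes d :: "('b, 'f::euclidean_space) chart" and c :: "('a, 'e::euclidean_space) chart"
  assumes c: "is_chart X c" "openin X W" "p \<in> fst c \<inter> W" and d: "is_chart Y d"
    and \<Phi>: "\<And>q. q \<in> fst c \<inter> W \<Longrightarrow> \<Phi> q \<in> fst d"
    and sm: "local_expr (\<lambda>q. snd d (\<Phi> q)) c differentiable (at (snd c p))"
    and G: "local_expr G d differentiable (at (snd d (\<Phi> p)))"
  shows "chart_deriv (\<lambda>q. G (\<Phi> q)) c p u = chart_deriv G d (\<Phi> p) (chart_deriv (\<lambda>q. snd d (\<Phi> q)) c p u)"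
proof -
  let ?T = "local_expr (\<lambda>q. snd d (\<Phi> q)) c"
  have T: "?T (snd c q) = snd d (\<Phi> q)" if "q \<in> fst c" for q by (rule local_expr_at[OF c(1) that])
  have E: "\<forall>\<^sub>F z in nhds (snd c p). local_expr (\<lambda>q. G (\<Phi> q)) c z = (local_expr G d \<circ> ?T) z"
    by (rule eventually_nhds_chart[OF c])
      (use T \<Phi> in \<open>auto simp: local_expr_at[OF c(1)] local_expr_at[OF d]\<close>)
  have "p \<in> fst c" using c by simp
  then have "frechet_derivative (local_expr G d \<circ> ?T) (at (snd c p)) =
      frechet_derivative (local_expr G d) (at (snd d (\<Phi> p))) \<circ> frechet_derivative ?T (at (snd c p))"
    using frechet_derivative_compose[OF sm, of "local_expr G d"] G T by simp
  then show ?thesis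
    unfolding chart_deriv_def differentiable_cong_eventually(2)[OF E] by simp
qed

lemma field_lim_chart_deriv:
  assumes c: "is_chart X c" "p \<in> fst c" and "field_lim F c (Suc r) H h p"
  shows "field_lim F c r (\<lambda>t q. chart_deriv (H t) c q u) (\<lambda>q. chart_deriv h c q u) p"
  unfolding field_lim_def
proof (rule jet_lim_cong)
  show "jet_lim F r (\<lambda>t. dir_deriv u (local_expr (H t) c)) (dir_deriv u (local_expr h c)) (snd c p)"
    using assms(3) by (simp add: field_lim_def)
  have E: "\<forall>\<^sub>F z in nhds (snd c p). \<forall>k::'a \<Rightarrow> real. dir_deriv u (local_expr k c) z = local_expr (\<lambda>q. chart_deriv k c q u) c z"
    using c by (intro eventually_nhds_chart[OF c(1) chart_openin[OF c(1)]])
      (auto simp: local_expr_at[OF c(1)] chart_deriv_def)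
  show "\<forall>\<^sub>F z in nhds (snd c p). dir_deriv u (local_expr h c) z = local_expr (\<lambda>q. chart_deriv h c q u) c z"
    using E by eventually_elim simp
  show "\<forall>\<^sub>F z in F \<times>\<^sub>F nhds (snd c p). dir_deriv u (local_expr (H (fst z)) c) (snd z) =
      local_expr (\<lambda>q. chart_deriv (H (fst z)) c q u) c (snd z)"
    using eventually_snd_prod[OF E] by eventually_elim simp
qed

lemma chart_deriv_linear:
  "local_expr h c differentiable (at (snd c p)) \<Longrightarrow> linear (chart_deriv h c p)"
  unfolding chart_deriv_def by (rule linear_frechet_derivative)

lemma smooth_in_cong:
  assumes "is_chart X c" "openin X W" "\<And>q. q \<in> fst c \<inter> W \<Longrightarrow> g q = h q" "smooth_in c W g"
  shows "smooth_in c W h"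
  unfolding smooth_in_def
  by (rule smooth_on_cong[OF chart_open_image[OF assms(1,2)], of "local_expr g c"])
    (use assms(3,4) in \<open>auto simp: local_expr_at[OF assms(1)] smooth_in_def\<close>)

lemma smooth_in_subset: "smooth_in c W g \<Longrightarrow> fst c \<inter> V \<subseteq> W \<Longrightarrow> smooth_in c V g"
  unfolding smooth_in_def by (erule smooth_on_subset) auto

lemma smooth_in_bounded_linear:
  assumes "is_chart X c" "openin X W" "bounded_linear L" "smooth_in c W g"
  shows "smooth_in c W (\<lambda>q. L (g q))"
  using smooth_on_bounded_linear[OF assms(3) chart_open_image[OF assms(1,2)]] assms(4)
  by (simp add: smooth_in_def local_expr_def o_def)

lemma chart_deriv_inner:
  assumes "local_expr g c differentiable (at (snd c p))"
  shows "chart_deriv (\<lambda>q. g q \<bullet> i) c p u = chart_deriv g c p u \<bullet> i"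
  using dir_deriv_inner[OF assms] by (simp add: chart_deriv_def local_expr_def o_def)

lemma
  assumes "is_chart X c" "p \<in> fst c" "local_expr f c differentiable (at (snd c p))"
    "local_expr g c differentiable (at (snd c p))"
  shows chart_deriv_add: "chart_deriv (\<lambda>q. f q + g q) c p u = chart_deriv f c p u + chart_deriv g c p u"
    and chart_deriv_mult: "chart_deriv (\<lambda>q. f q * g q :: real) c p u = f p * chart_deriv g c p u + chart_deriv f c p u * g p"
  using frechet_derivative_at[OF has_derivative_add[OF assms(3,4)[unfolded frechet_derivative_works]], symmetric]
    frechet_derivative_at[OF has_derivative_mult[OF assms(3,4)[unfolded frechet_derivative_works]], symmetric]
    local_expr_at[OF assms(1,2), of f] local_expr_at[OF assms(1,2), of g]
  by (simp_all add: chart_deriv_def local_expr_def o_def)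

lemma chart_deriv_const: "chart_deriv (\<lambda>q. a) c p u = 0"
  by (simp add: chart_deriv_def local_expr_def o_def)

lemma chart_deriv_cmult:
  assumes "is_chart X c" "p \<in> fst c" "local_expr f c differentiable (at (snd c p))"
  shows "chart_deriv (\<lambda>q. a * f q :: real) c p u = a * chart_deriv f c p u"
  using chart_deriv_mult[OF assms(1,2) _ assms(3), of "\<lambda>q. a"]
  by (simp add: chart_deriv_const local_expr_def o_def)

lemma chart_deriv_sum:
  assumes "is_chart X c" "p \<in> fst c" "\<And>i. i \<in> I \<Longrightarrow> local_expr (f i) c differentiable (at (snd c p))"
  shows "chart_deriv (\<lambda>q. \<Sum>i\<in>I. f i q :: real) c p u = (\<Sum>i\<in>I. chart_deriv (f i) c p u)"
proof -
  have "(local_expr (f i) c has_derivative frechet_derivative (local_expr (f i) c) (at (snd c p))) (at (snd c p))"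
    if "i \<in> I" for i
    using assms(3)[OF that] by (simp add: frechet_derivative_works)
  from frechet_derivative_at[OF has_derivative_sum[of I, OF this], symmetric]
  show ?thesis by (simp add: chart_deriv_def local_expr_def o_def)
qed

lemma chart_deriv_real_function:
  fixes h :: "'a \<Rightarrow> real" and \<phi> :: "real \<Rightarrow> real"
  assumes "is_chart X c" "p \<in> fst c" "local_expr h c differentiable (at (snd c p))"
    "(\<phi> has_real_derivative D) (at (h p))"
  shows "chart_deriv (\<lambda>q. \<phi> (h q)) c p u = D * chart_deriv h c p u"
    and "local_expr (\<lambda>q. \<phi> (h q)) c differentiable (at (snd c p))"
proof -
  have "((\<lambda>z. \<phi> (local_expr h c z)) has_derivative (\<lambda>u. D * frechet_derivative (local_expr h c) (at (snd c p)) u)) (at (snd c p))"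
    using has_derivative_compose[OF assms(3)[unfolded frechet_derivative_works], of \<phi> "\<lambda>u. D * u"] assms(4)
    by (simp add: local_expr_at[OF assms(1,2)] has_field_derivative_def)
  then have *: "(local_expr (\<lambda>q. \<phi> (h q)) c has_derivative (\<lambda>u. D * chart_deriv h c p u)) (at (snd c p))"
    by (simp add: local_expr_def o_def chart_deriv_def)
  show "chart_deriv (\<lambda>q. \<phi> (h q)) c p u = D * chart_deriv h c p u"
    using frechet_derivative_at[OF *] by (simp add: chart_deriv_def fun_eq_iff)
  show "local_expr (\<lambda>q. \<phi> (h q)) c differentiable (at (snd c p))"
    using * differentiable_def by blast
qed

lemma eventually_prod_nhds_chart:
  assumes "is_chart X c" "p \<in> fst c" "\<forall>\<^sub>F z in F \<times>\<^sub>F nhds (snd c p). P (fst z) (snd z)"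
  obtains V where "openin X V" "p \<in> V" "V \<subseteq> fst c" "\<forall>\<^sub>F t in F. \<forall>q\<in>V. P t (snd c q)"
proof -
  obtain Q R where QR: "eventually Q F" "eventually R (nhds (snd c p))" "\<And>t z. Q t \<Longrightarrow> R z \<Longrightarrow> P t z"
    using assms(3) unfolding eventually_prod_filter by auto
  obtain S where S: "open S" "snd c p \<in> S" "\<forall>z\<in>S. R z" using QR(2) unfolding eventually_nhds by blast
  show ?thesis
  proof
    show "openin X {q \<in> fst c. snd c q \<in> S}" by (rule chart_open_vimage[OF assms(1) S(1)])
    show "\<forall>\<^sub>F t in F. \<forall>q\<in>{q \<in> fst c. snd c q \<in> S}. P t (snd c q)"
      using QR(1) by eventually_elim (use S QR(3) in auto)
  qed (use S assms(2) in auto)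
qed

lemma field_lim_prod:
  assumes "\<And>i. i \<in> I \<Longrightarrow> field_lim F c r (G i) (g i) p"
  shows "field_lim F c r (\<lambda>t q. \<Prod>i\<in>I. G i t q) (\<lambda>q. \<Prod>i\<in>I. g i q) p"
  using assms by (induction I rule: infinite_finite_induct) (auto intro: field_lim_const field_lim_mult)

lemma field_lim_divide:
  assumes "is_chart X c" "p \<in> fst c"
    "field_lim F c r G g p" "field_lim F c r H h p" "h p \<noteq> 0"
  shows "field_lim F c r (\<lambda>t q. G t q / H t q) (\<lambda>q. g q / h q) p"
  using jet_lim_divide[of F r "\<lambda>t. local_expr (G t) c" "local_expr g c" "snd c p" "\<lambda>t. local_expr (H t) c" "local_expr h c"]
    assms local_expr_at[OF assms(1,2), of h]
  by (simp add: field_lim_def local_expr_def o_def)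

lemma local_expr_restrict:
  assumes "is_chart X c" "z \<in> snd c ` (fst c \<inter> W)"
  shows "local_expr f (fst c \<inter> W, snd c) z = local_expr f c z"
  using assms chart_inj[OF assms(1)]
  by (auto simp: local_expr_def inv_into_f_f inj_on_subset)

locale manifold =
  fixes X :: "'a topology" and A :: "('a, 'e::euclidean_space) chart set"
  assumes smooth_manifold: "smooth_manifold X A"
begin

lemma chart: "c \<in> A \<Longrightarrow> is_chart X c"
  using smooth_manifold by (auto simp: smooth_manifold_def)

lemma obtain_chart:
  assumes "p \<in> topspace X"
  obtains c where "c \<in> A" "p \<in> fst c"
  using smooth_manifold assms unfolding smooth_manifold_def by blast

lemma smooth_transition: "c \<in> A \<Longrightarrow> d \<in> A \<Longrightarrow> smooth_in c (fst d) (snd d)"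
  using smooth_manifold by (auto simp: smooth_manifold_def compatible_def)

text \<open>Restrictions belong to the atlas because it is maximal. They provide charts for an open subset
  such as the tubular neighbourhood of \<open>Z\<close>, on which the projection is known to be smooth.\<close>

lemma restrict_chart:
  assumes c: "c \<in> A" and W: "openin X W"
  shows "(fst c \<inter> W, snd c) \<in> A"
proof -
  let ?c = "(fst c \<inter> W, snd c)"
  have ic: "is_chart X c" using chart c by blast
  have oi: "open (snd c ` (fst c \<inter> W))" by (rule chart_open_image[OF ic W])
  have sub: "fst c \<subseteq> topspace X" using chart_subset[OF ic] .
  have inj: "inj_on (snd c) (fst c)" using chart_inj[OF ic] .
  have "homeomorphic_map (subtopology (subtopology X (fst c)) (fst c \<inter> W))
      (subtopology (top_of_set (snd c ` fst c)) (snd c ` (fst c \<inter> W))) (snd c)"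
    using ic sub by (rule_tac homeomorphic_map_subtopologies) (auto simp: is_chart_def)
  then have "homeomorphic_map (subtopology X (fst c \<inter> W)) (top_of_set (snd c ` (fst c \<inter> W))) (snd c)"
    using image_mono[of "fst c \<inter> W" "fst c" "snd c"]
    by (simp add: subtopology_subtopology Int_absorb1 Int_left_absorb)
  then have ch: "is_chart X ?c"
    using oi W chart_openin[OF ic] by (simp add: is_chart_def openin_Int)
  have "compatible ?c d" if d: "d \<in> A" for d
    unfolding compatible_def
  proof
    have od: "openin X (fst d)" using chart_openin chart d by blast
    show "smooth_in ?c (fst d) (snd d)"
      unfolding smooth_in_def
    proof (rule smooth_on_cong)
      show "smooth_on (snd ?c ` (fst ?c \<inter> fst d)) (local_expr (snd d) c)"
        using smooth_transition[OF c d] unfolding smooth_in_def by (rule smooth_on_subset) auto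
      show "open (snd ?c ` (fst ?c \<inter> fst d))" by (rule chart_open_image[OF ch od])
      show "local_expr (snd d) c z = local_expr (snd d) ?c z" if "z \<in> snd ?c ` (fst ?c \<inter> fst d)" for z
        by (rule local_expr_restrict[OF ic, symmetric]) (use that in auto)
    qed
    show "smooth_in d (fst ?c) (snd ?c)"
      using smooth_in_subset[OF smooth_transition[OF d c], of "fst c \<inter> W"] by auto
  qed
  then show ?thesis using smooth_manifold ch unfolding smooth_manifold_def by blast
qed

lemma field_lim_change_chart:
  assumes "c \<in> A" "d \<in> A" "p \<in> fst c \<inter> fst d" "field_lim F d r H h p"
  shows "field_lim F c r H h p"
  using field_lim_pullback[OF chart[OF assms(1)] chart_openin[OF chart[OF assms(2)]] assms(3) chart[OF assms(2)],
      of "\<lambda>q. q"] smooth_transition[OF assms(1,2)] assms(4) by simp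

lemma chart_deriv_change_chart:
  assumes "c \<in> A" "d \<in> A" "p \<in> fst c \<inter> fst d" "local_expr G d differentiable (at (snd d p))"
  shows "chart_deriv G c p u = chart_deriv G d p (chart_deriv (snd d) c p u)"
  using chart_deriv_chain[OF chart[OF assms(1)] chart_openin[OF chart[OF assms(2)]] assms(3) chart[OF assms(2)],
      of "\<lambda>q. q" G] smooth_in_differentiable[OF smooth_transition[OF assms(1,2)] assms(3)] assms(4)
  by simp

lemma transition_differentiable:
  assumes "c \<in> A" "d \<in> A" "p \<in> fst c \<inter> fst d"
  shows "local_expr (snd d) c differentiable (at (snd c p))"
  using smooth_in_differentiable[OF smooth_transition[OF assms(1,2)] assms(3)] .

lemma transition_linear:
  assumes "c \<in> A" "d \<in> A" "p \<in> fst c \<inter> fst d"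
  shows "linear (chart_deriv (snd d) c p)"
  using chart_deriv_linear[OF transition_differentiable[OF assms]] .

lemma chart_deriv_self:
  assumes "c \<in> A" "p \<in> fst c"
  shows "chart_deriv (snd c) c p u = u"
proof -
  have "\<forall>\<^sub>F z in nhds (snd c p). local_expr (snd c) c z = z"
    using assms by (intro eventually_nhds_chart[OF chart chart_openin[OF chart]])
      (auto simp: local_expr_at[OF chart])
  from differentiable_cong_eventually(2)[OF this] show ?thesis by (simp add: chart_deriv_def)
qed

lemma transition_inverse:
  assumes "c \<in> A" "d \<in> A" "p \<in> fst c \<inter> fst d"
  shows "chart_deriv (snd c) d p (chart_deriv (snd d) c p u) = u"
  using chart_deriv_change_chart[OF assms transition_differentiable[of d c p], of u] assms
    chart_deriv_self[OF assms(1), of p u] by simp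

lemma one_form_differential:
  assumes W: "openin X W" and h: "\<And>c. c \<in> A \<Longrightarrow> smooth_in c W h"
  shows "one_form A W (chart_deriv h)"
  unfolding one_form_def
proof (intro conjI ballI allI)
  fix c p assume c: "c \<in> A" "p \<in> fst c \<inter> W"
  then show "linear (chart_deriv h c p)"
    by (intro chart_deriv_linear smooth_in_differentiable[OF h])
next
  fix c d p u assume *: "c \<in> A" "d \<in> A" "p \<in> fst c \<inter> fst d \<inter> W"
  then show "chart_deriv h c p u = chart_deriv h d p (chart_deriv (snd d) c p u)"
    using smooth_in_differentiable[OF h, of d p] by (intro chart_deriv_change_chart) auto
next
  fix c u assume c: "c \<in> A"
  show "smooth_in c W (\<lambda>p. chart_deriv h c p u)"
    by (intro smooth_inI_field_lim[OF chart[OF c] W] field_lim_chart_deriv[OF chart[OF c]]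
        smooth_in_imp_field_lim[OF chart[OF c] W _ h[OF c]]) auto
qed

lemma two_form_wedge:
  assumes W: "openin X W" and a: "one_form A W \<alpha>" and b: "one_form A W \<beta>"
  shows "two_form A W (wedge \<alpha> \<beta>)"
  unfolding two_form_def
proof (intro conjI ballI allI)
  fix c p assume c: "c \<in> A" "p \<in> fst c \<inter> W"
  then have "linear (\<alpha> c p)" "linear (\<beta> c p)" using a b by (auto simp: one_form_def)
  then show "bilinear (wedge \<alpha> \<beta> c p)"
    unfolding bilinear_def wedge_def
    by (auto intro!: linearI simp: linear_add linear_cmul algebra_simps)
  show "wedge \<alpha> \<beta> c p u u = 0" for u by (simp add: wedge_def)
next
  fix c d p u v assume *: "c \<in> A" "d \<in> A" "p \<in> fst c \<inter> fst d \<inter> W"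
  let ?D = "chart_deriv (snd d) c p"
  have "\<alpha> c p w = \<alpha> d p (?D w)" "\<beta> c p w = \<beta> d p (?D w)" for w
    using a b * unfolding one_form_def by blast+
  then show "wedge \<alpha> \<beta> c p u v = wedge \<alpha> \<beta> d p (?D u) (?D v)" by (simp add: wedge_def)
next
  fix c u v assume c: "c \<in> A"
  have "smooth_in c W (\<lambda>p. \<alpha> c p u)" "smooth_in c W (\<lambda>p. \<beta> c p u)" for u
    using a b c by (auto simp: one_form_def)
  note sm = this[THEN smooth_in_imp_field_lim[OF chart[OF c] W, rotated]]
  show "smooth_in c W (\<lambda>p. wedge \<alpha> \<beta> c p u v)"
    unfolding wedge_def by (intro smooth_inI_field_lim[OF chart[OF c] W] field_lim_diff field_lim_mult sm)
qed

lemma two_form_add: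
  assumes W: "openin X W" and a: "two_form A W \<sigma>" and b: "two_form A W \<tau>"
  shows "two_form A W (\<lambda>c p u v. \<sigma> c p u v + \<tau> c p u v)"
  unfolding two_form_def
proof (intro conjI ballI allI)
  fix c p assume c: "c \<in> A" "p \<in> fst c \<inter> W"
  then have "bilinear (\<sigma> c p)" "bilinear (\<tau> c p)" using a b by (auto simp: two_form_def)
  then show "bilinear (\<lambda>u v. \<sigma> c p u v + \<tau> c p u v)"
    unfolding bilinear_def by (auto intro: linear_compose_add)
  show "\<sigma> c p u u + \<tau> c p u u = 0" for u using a b c by (auto simp: two_form_def)
next
  fix c d p u v assume *: "c \<in> A" "d \<in> A" "p \<in> fst c \<inter> fst d \<inter> W"
  let ?D = "chart_deriv (snd d) c p"
  have "\<sigma> c p u v = \<sigma> d p (?D u) (?D v)" "\<tau> c p u v = \<tau> d p (?D u) (?D v)"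
    using a b * unfolding two_form_def by blast+
  then show "\<sigma> c p u v + \<tau> c p u v = \<sigma> d p (?D u) (?D v) + \<tau> d p (?D u) (?D v)" by simp
next
  fix c u v assume c: "c \<in> A"
  have "smooth_in c W (\<lambda>p. \<sigma> c p u v)" "smooth_in c W (\<lambda>p. \<tau> c p u v)"
    using a b c by (auto simp: two_form_def)
  note sm = this[THEN smooth_in_imp_field_lim[OF chart[OF c] W, rotated]]
  show "smooth_in c W (\<lambda>p. \<sigma> c p u v + \<tau> c p u v)"
    by (intro smooth_inI_field_lim[OF chart[OF c] W] field_lim_add sm)
qed

end

section \<open>The inverse of a nondegenerate form\<close>

definition alternating_form :: "('e::euclidean_space \<Rightarrow> 'e \<Rightarrow> real) \<Rightarrow> bool" where
  "alternating_form w \<longleftrightarrow> bilinear w \<and> (\<forall>u. w u u = 0)"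

lemmas bilinear_simps = bilinear_ladd bilinear_radd bilinear_lmul bilinear_rmul

lemma alternating_form_antisym:
  assumes "alternating_form w"
  shows "w v u = - w u v"
proof -
  have b: "bilinear w" and "w (u + v) (u + v) = 0" "w u u = 0" "w v v = 0"
    using assms by (auto simp: alternating_form_def)
  then show ?thesis by (simp add: bilinear_ladd[OF b] bilinear_radd[OF b])
qed

lemma sharp_eqI:
  assumes "bilinear w" "nondegenerate w" "\<And>v. w u v = a \<bullet> v"
  shows "sharp w a = u"
  unfolding sharp_def
proof (rule the_equality)
  fix u' assume u': "\<forall>v. w u' v = a \<bullet> v"
  have "w (u' - u) v = 0" for v
    using u' assms(3) by (simp add: bilinear_lsub[OF assms(1)])
  then have "u' - u = 0" using assms(2) unfolding nondegenerate_def by blast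
  then show "u' = u" by simp
qed (use assms(3) in simp)

text \<open>In finite dimension, the injective map \<open>u \<mapsto> w u _\<close> is onto the covectors.\<close>

lemma sharp_works:
  fixes w :: "'e::euclidean_space \<Rightarrow> 'e \<Rightarrow> real"
  assumes b: "bilinear w" and nd: "nondegenerate w"
  shows "w (sharp w a) v = a \<bullet> v"
proof -
  let ?f = "\<lambda>u. \<Sum>i\<in>Basis. w u i *\<^sub>R i"
  have f: "?f u \<bullet> v = w u v" for u v
  proof -
    have "w u v = w u (\<Sum>i\<in>Basis. (v \<bullet> i) *\<^sub>R i)" by (simp add: euclidean_representation)
    also have "\<dots> = (\<Sum>i\<in>Basis. (v \<bullet> i) * w u i)"
      using b by (simp add: bilinear_def linear_sum linear_cmul)
    finally show ?thesis by (simp add: inner_sum_left inner_commute[of v] mult.commute)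
  qed
  have lin: "linear ?f"
    by (rule linearI) (simp_all add: bilinear_ladd[OF b] bilinear_lmul[OF b] scaleR_add_left sum.distrib scaleR_sum_right)
  have "inj ?f"
    unfolding linear_injective_0[OF lin]
  proof (intro allI impI)
    fix u assume u: "?f u = 0"
    have "w u v = 0" for v unfolding f[of u v, symmetric] u by simp
    then show "u = 0" using nd by (simp add: nondegenerate_def)
  qed
  then obtain u where u: "a = ?f u" using linear_injective_imp_surjective[OF lin] by (meson surjD)
  have "w u v = a \<bullet> v" for v using f u by simp
  then show ?thesis using sharp_eqI[OF b nd] by metis
qed

definition inv_form :: "('e::euclidean_space \<Rightarrow> 'e \<Rightarrow> real) \<Rightarrow> 'e \<Rightarrow> 'e \<Rightarrow> real" where
  "inv_form w a b = w (sharp w a) (sharp w b)"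

lemma inverse_bivector_eq: "inverse_bivector \<omega> c p = inv_form (\<omega> c p)"
  by (simp add: inverse_bivector_def inv_form_def fun_eq_iff)

lemma inv_form_sharp:
  assumes "alternating_form w" "nondegenerate w"
  shows "inv_form w a b = a \<bullet> sharp w b"
  using assms by (simp add: inv_form_def sharp_works alternating_form_def)

lemma sharp_linear:
  assumes "bilinear w" "nondegenerate w"
  shows "linear (sharp w)"
  by (rule linearI; rule sharp_eqI[OF assms])
    (simp_all add: bilinear_ladd[OF assms(1)] bilinear_lmul[OF assms(1)] sharp_works[OF assms] inner_add_left)

lemma inv_form_alternating:
  assumes "alternating_form w" "nondegenerate w"
  shows "alternating_form (inv_form w)"
proof -
  have b: "bilinear w" using assms by (simp add: alternating_form_def)
  note lin = sharp_linear[OF b assms(2)]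
  have "bilinear (inv_form w)"
    unfolding bilinear_def inv_form_sharp[OF assms]
    by (auto intro!: linearI simp: linear_add[OF lin] linear_cmul[OF lin] inner_add_left inner_add_right)
  then show ?thesis using assms by (auto simp: alternating_form_def inv_form_def)
qed

text \<open>If \<open>D\<close> carries \<open>w1\<close> to \<open>w2\<close>, then it carries the vector dual to the covector \<open>a \<circ> D\<close> with
  respect to \<open>w1\<close> to the vector dual to \<open>a\<close> with respect to \<open>w2\<close>. Changes of charts and rescalings of
  the frame are both of this kind.\<close>

lemma inv_form_transform:
  assumes w: "alternating_form w2" "nondegenerate w2" and D: "linear D"
    and DD: "\<And>u. D' (D u) = u" "\<And>u. D (D' u) = u"
    and eq: "\<And>u v. w1 u v = w2 (D u) (D v)"
  shows "alternating_form w1" "nondegenerate w1"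
    "inv_form w2 a b = inv_form w1 (adjoint D a) (adjoint D b)"
proof -
  have b2: "bilinear w2" using w(1) by (simp add: alternating_form_def)
  have b1: "bilinear w1"
    unfolding bilinear_def eq
    by (auto intro!: linearI simp: linear_add[OF D] linear_cmul[OF D] bilinear_simps[OF b2])
  then show a1: "alternating_form w1" using w(1) eq by (simp add: alternating_form_def)
  show nd1: "nondegenerate w1"
    unfolding nondegenerate_def
  proof (intro allI impI)
    fix u assume "\<forall>v. w1 u v = 0"
    then have "w2 (D u) v = 0" for v using eq[of u "D' v"] DD(2) by simp
    then have "D u = 0" using w(2) by (simp add: nondegenerate_def)
    then show "u = 0" using DD(1)[of u] DD(1)[of 0] linear_0[OF D] by simp
  qed
  have "sharp w2 b = D (sharp w1 (adjoint D b))" for b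
  proof (rule sharp_eqI[OF b2 w(2)])
    fix v
    have "w2 (D (sharp w1 (adjoint D b))) v = w1 (sharp w1 (adjoint D b)) (D' v)" by (simp add: eq DD)
    also have "\<dots> = b \<bullet> v" using D by (simp add: sharp_works[OF b1 nd1] adjoint_clauses DD)
    finally show "w2 (D (sharp w1 (adjoint D b))) v = b \<bullet> v" .
  qed
  then show "inv_form w2 a b = inv_form w1 (adjoint D a) (adjoint D b)"
    using D by (simp add: inv_form_sharp[OF w] inv_form_sharp[OF a1 nd1] adjoint_clauses)
qed

lemma alternating_form_limit:
  assumes "F \<noteq> bot" "\<forall>\<^sub>F t in F. alternating_form (w t)" "\<And>u v. ((\<lambda>t. w t u v) \<longlongrightarrow> w0 u v) F"
  shows "alternating_form w0"
proof -
  have lim_eq: "\<Phi>0 = \<Psi>0"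
    if "(\<Phi> \<longlongrightarrow> \<Phi>0) F" "(\<Psi> \<longlongrightarrow> \<Psi>0) F" "\<And>t. alternating_form (w t) \<Longrightarrow> \<Phi> t = \<Psi> t" for \<Phi> \<Psi> and \<Phi>0 \<Psi>0 :: real
  proof -
    have "\<forall>\<^sub>F t in F. \<Phi> t = \<Psi> t" using assms(2) by eventually_elim (rule that(3))
    then have "(\<Psi> \<longlongrightarrow> \<Phi>0) F" using that(1) Lim_transform_eventually by blast
    then show ?thesis using tendsto_unique assms(1) that(2) by blast
  qed
  have b: "bilinear w" if "alternating_form w" for w :: "'b \<Rightarrow> 'b \<Rightarrow> real" using that by (simp add: alternating_form_def)
  have "w0 (u + u') v = w0 u v + w0 u' v" for u u' v
    by (rule lim_eq[OF assms(3) tendsto_add[OF assms(3) assms(3)]]) (rule bilinear_ladd[OF b])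
  moreover have "w0 u (v + v') = w0 u v + w0 u v'" for u v v'
    by (rule lim_eq[OF assms(3) tendsto_add[OF assms(3) assms(3)]]) (rule bilinear_radd[OF b])
  moreover have "w0 (s *\<^sub>R u) v = s * w0 u v" for s u v
    by (rule lim_eq[OF assms(3) tendsto_mult[OF tendsto_const assms(3)]]) (simp add: bilinear_lmul[OF b])
  moreover have "w0 u (s *\<^sub>R v) = s * w0 u v" for s u v
    by (rule lim_eq[OF assms(3) tendsto_mult[OF tendsto_const assms(3)]]) (simp add: bilinear_rmul[OF b])
  moreover have "w0 u u = 0" for u
    by (rule lim_eq[OF assms(3) tendsto_const]) (simp add: alternating_form_def)
  ultimately show ?thesis
    unfolding alternating_form_def bilinear_def by (auto intro!: linearI)
qed

lemma bilinear_adjoint: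
  fixes D :: "'e::euclidean_space \<Rightarrow> 'e"
  assumes b: "bilinear R" and D: "linear D"
  shows "R (adjoint D a) (adjoint D b) = (\<Sum>i\<in>Basis. \<Sum>j\<in>Basis. (D i \<bullet> a) * ((D j \<bullet> b) * R i j))"
proof -
  have ex: "adjoint D a = (\<Sum>i\<in>Basis. (D i \<bullet> a) *\<^sub>R i)" for a
    using euclidean_representation[of "adjoint D a"] by (simp add: adjoint_clauses[OF D] inner_commute)
  have l: "linear (\<lambda>u. R u v)" "linear (R u)" for u v using b by (auto simp: bilinear_def)
  have "R (adjoint D a) (adjoint D b) = (\<Sum>i\<in>Basis. (D i \<bullet> a) * R i (adjoint D b))"
    unfolding ex[of a] by (simp add: linear_sum[OF l(1)] linear_cmul[OF l(1)])
  also have "\<dots> = (\<Sum>i\<in>Basis. \<Sum>j\<in>Basis. (D i \<bullet> a) * ((D j \<bullet> b) * R i j))"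
    unfolding ex[of b] by (simp add: linear_sum[OF l(2)] linear_cmul[OF l(2)] sum_distrib_left)
  finally show ?thesis .
qed

definition form_matrix :: "(real ^ 'n \<Rightarrow> real ^ 'n \<Rightarrow> real) \<Rightarrow> real ^ 'n ^ 'n" where
  "form_matrix w = (\<chi> i j. w (axis j 1) (axis i 1))"

lemma form_matrix_mult:
  assumes "bilinear w"
  shows "form_matrix w *v u = (\<chi> i. w u (axis i 1))"
proof -
  have "w u (axis i 1) = (\<Sum>j\<in>UNIV. w (axis j 1) (axis i 1) * u $ j)" for i
  proof -
    have "w u (axis i 1) = w (\<Sum>j\<in>UNIV. u $ j *\<^sub>R axis j 1) (axis i 1)"
      using basis_expansion[of u] by (simp add: scalar_mult_eq_scaleR)
    also have "\<dots> = (\<Sum>j\<in>UNIV. w (axis j 1) (axis i 1) * u $ j)"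
      using assms by (simp add: bilinear_def linear_sum[of "\<lambda>x. w x (axis i 1)"] linear_cmul[of "\<lambda>x. w x (axis i 1)"] mult.commute)
    finally show ?thesis .
  qed
  then show ?thesis by (simp add: form_matrix_def matrix_vector_mult_def)
qed

lemma form_eq_iff_axis:
  fixes w :: "real ^ 'n \<Rightarrow> real ^ 'n \<Rightarrow> real"
  assumes "bilinear w"
  shows "(\<forall>v. w u v = a \<bullet> v) \<longleftrightarrow> form_matrix w *v u = a"
proof
  assume "\<forall>v. w u v = a \<bullet> v"
  then show "form_matrix w *v u = a"
    by (simp add: form_matrix_mult[OF assms] vec_eq_iff inner_axis)
next
  assume *: "form_matrix w *v u = a"
  have lin: "linear (w u)" using assms by (simp add: bilinear_def)
  show "\<forall>v. w u v = a \<bullet> v"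
  proof
    fix v
    have "w u v = w u (\<Sum>i\<in>UNIV. v $ i *\<^sub>R axis i 1)"
      using basis_expansion[of v] by (simp add: scalar_mult_eq_scaleR)
    also have "\<dots> = (\<Sum>i\<in>UNIV. v $ i * w u (axis i 1))"
      by (simp add: linear_sum[OF lin] linear_cmul[OF lin])
    also have "\<dots> = (\<Sum>i\<in>UNIV. v $ i * a $ i)"
      using * unfolding form_matrix_mult[OF assms] by (auto simp: vec_eq_iff)
    finally show "w u v = a \<bullet> v" by (simp add: inner_vec_def mult.commute)
  qed
qed

lemma nondegenerate_iff_det:
  assumes "bilinear w"
  shows "nondegenerate w \<longleftrightarrow> det (form_matrix w) \<noteq> 0"
proof -
  have "nondegenerate w \<longleftrightarrow> (\<forall>u. form_matrix w *v u = 0 \<longrightarrow> u = 0)"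
    using form_eq_iff_axis[OF assms, of _ 0] by (simp add: nondegenerate_def)
  also have "\<dots> \<longleftrightarrow> det (form_matrix w) \<noteq> 0"
    using invertible_left_inverse invertible_det_nz matrix_left_invertible_ker by metis
  finally show ?thesis .
qed

lemma sharp_cramer:
  assumes "bilinear w" "nondegenerate w"
  shows "sharp w b = (\<chi> k. det (\<chi> i j. if j = k then b $ i else w (axis j 1) (axis i 1)) / det (form_matrix w))"
proof -
  have "form_matrix w *v sharp w b = b"
    using form_eq_iff_axis[OF assms(1)] sharp_works[OF assms] by blast
  then show ?thesis
    using cramer[OF nondegenerate_iff_det[OF assms(1), THEN iffD1, OF assms(2)], of "sharp w b" b]
    by (simp add: form_matrix_def cong: if_cong)
qed

lemma field_lim_det:
  assumes "\<And>i j. field_lim F c r (\<lambda>t q. M t q $ i $ j) (\<lambda>q. m q $ i $ j) p"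
  shows "field_lim F c r (\<lambda>t q. det (M t q)) (\<lambda>q. det (m q)) p"
  unfolding det_def by (intro field_lim_sum field_lim_mult field_lim_const field_lim_prod assms)

lemma field_lim_nondegenerate:
  fixes W :: "'t \<Rightarrow> 'a \<Rightarrow> real ^ 'n \<Rightarrow> real ^ 'n \<Rightarrow> real"
  assumes c: "is_chart X c" "openin X V" "p \<in> fst c \<inter> V"
    and lim: "\<And>u v. field_lim F c r (\<lambda>t q. W t q u v) (\<lambda>q. w q u v) p"
    and W: "\<forall>\<^sub>F t in F. \<forall>q\<in>fst c \<inter> V. bilinear (W t q)"
    and w: "bilinear (w p)" "nondegenerate (w p)"
  obtains V' where "openin X V'" "p \<in> V'" "V' \<subseteq> fst c \<inter> V" "\<forall>\<^sub>F t in F. \<forall>q\<in>V'. nondegenerate (W t q)"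
proof -
  let ?g = "local_expr (\<lambda>q. det (form_matrix (w q))) c"
  have "field_lim F c r (\<lambda>t q. det (form_matrix (W t q))) (\<lambda>q. det (form_matrix (w q))) p"
    by (rule field_lim_det) (simp add: form_matrix_def lim)
  then have jl: "jet_lim F r (\<lambda>t. local_expr (\<lambda>q. det (form_matrix (W t q))) c) ?g (snd c p)"
    by (simp add: field_lim_def)
  have "?g (snd c p) \<noteq> 0"
    using w(2) c(3) unfolding nondegenerate_iff_det[OF w(1)] by (simp add: local_expr_at[OF c(1)])
  from jet_lim_eventually_nonzero[OF jl this]
  have E: "\<forall>\<^sub>F z in F \<times>\<^sub>F nhds (snd c p). local_expr (\<lambda>q. det (form_matrix (W (fst z) q))) c (snd z) \<noteq> 0" .
  have "p \<in> fst c" using c by simp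
  from eventually_prod_nhds_chart[OF c(1) this, where P="\<lambda>t z. local_expr (\<lambda>q. det (form_matrix (W t q))) c z \<noteq> 0", OF E]
  obtain V1 where V1: "openin X V1" "p \<in> V1" "V1 \<subseteq> fst c"
    "\<forall>\<^sub>F t in F. \<forall>q\<in>V1. local_expr (\<lambda>q. det (form_matrix (W t q))) c (snd c q) \<noteq> 0" by blast
  show ?thesis
  proof
    show "openin X (V1 \<inter> V)" using V1 c by blast
    show "\<forall>\<^sub>F t in F. \<forall>q\<in>V1 \<inter> V. nondegenerate (W t q)"
      using V1(4) W
    proof eventually_elim
      case (elim t)
      show ?case
      proof
        fix q assume q: "q \<in> V1 \<inter> V"
        then have "q \<in> fst c" using V1 by auto
        then have "det (form_matrix (W t q)) \<noteq> 0" using elim(1) q local_expr_at[OF c(1), of q "\<lambda>q. det (form_matrix (W t q))"] by auto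
        moreover have "bilinear (W t q)" using elim(2) q \<open>q \<in> fst c\<close> by blast
        ultimately show "nondegenerate (W t q)" by (simp add: nondegenerate_iff_det)
      qed
    qed
  qed (use V1 c in auto)
qed

text \<open>By Cramer's rule, the inverse is a rational function of the components of the form.\<close>

lemma field_lim_inv_form:
  fixes W :: "'t \<Rightarrow> 'a \<Rightarrow> real ^ 'n \<Rightarrow> real ^ 'n \<Rightarrow> real"
  assumes c: "is_chart X c" "openin X V" "p \<in> fst c \<inter> V"
    and lim: "\<And>u v. field_lim F c r (\<lambda>t q. W t q u v) (\<lambda>q. w q u v) p"
    and sm: "\<And>u v. field_lim F c 0 (\<lambda>t q. w q u v) (\<lambda>q. w q u v) p"
    and F: "F \<noteq> bot"
    and W: "\<forall>\<^sub>F t in F. \<forall>q\<in>fst c \<inter> V. alternating_form (W t q)"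
    and w: "\<And>q. q \<in> fst c \<inter> V \<Longrightarrow> alternating_form (w q)" "nondegenerate (w p)"
  shows "field_lim F c r (\<lambda>t q. inv_form (W t q) a b) (\<lambda>q. inv_form (w q) a b) p"
proof -
  have Wb: "\<forall>\<^sub>F t in F. \<forall>q\<in>fst c \<inter> V. bilinear (W t q)"
    using W by eventually_elim (simp add: alternating_form_def)
  have wb: "bilinear (w q)" if "q \<in> fst c \<inter> V" for q
    using w(1)[OF that] by (simp add: alternating_form_def)
  obtain V1 where V1: "openin X V1" "p \<in> V1" "V1 \<subseteq> fst c \<inter> V" "\<forall>\<^sub>F t in F. \<forall>q\<in>V1. nondegenerate (W t q)"
    by (rule field_lim_nondegenerate[of X c V p F r W w, OF c lim Wb wb[OF c(3)] w(2)])
  have "\<forall>\<^sub>F t in F. \<forall>q\<in>fst c \<inter> V. bilinear (w q)" using wb by simp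
  then obtain V2 where V2: "openin X V2" "p \<in> V2" "V2 \<subseteq> fst c \<inter> V" "\<forall>\<^sub>F t in F. \<forall>q\<in>V2. nondegenerate (w q)"
    by (rule field_lim_nondegenerate[of X c V p F 0 "\<lambda>t. w" w, OF c sm _ wb[OF c(3)] w(2)])
  then have V2n: "nondegenerate (w q)" if "q \<in> V2" for q using F that by simp
  \<comment> \<open>The pairing of \<open>a\<close> with the solution for the right-hand side \<open>b\<close> given by Cramer's rule.\<close>
  let ?C = "\<lambda>w::real^'n \<Rightarrow> real^'n \<Rightarrow> real. \<Sum>k\<in>UNIV. a $ k * (det (\<chi> i j. if j = k then b $ i else w (axis j 1) (axis i 1)) / det (form_matrix w))"
  have C: "inv_form w a b = ?C w" if "alternating_form w" "nondegenerate w" for w :: "real^'n \<Rightarrow> real^'n \<Rightarrow> real"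
    using that by (simp add: inv_form_sharp sharp_cramer alternating_form_def inner_vec_def)
  have cp: "p \<in> fst c" using c by simp
  show ?thesis
  proof (rule field_lim_cong[OF c(1), of "V1 \<inter> V2"])
    show "openin X (V1 \<inter> V2)" "p \<in> fst c \<inter> (V1 \<inter> V2)" using V1 V2 cp by auto
    show "field_lim F c r (\<lambda>t q. ?C (W t q)) (\<lambda>q. ?C (w q)) p"
    proof (intro field_lim_sum field_lim_mult field_lim_const field_lim_divide[OF c(1) cp] field_lim_det)
      show "field_lim F c r (\<lambda>t q. (\<chi> i j. if j = k then b $ i else W t q (axis j 1) (axis i 1)) $ i $ j)
        (\<lambda>q. (\<chi> i j. if j = k then b $ i else w q (axis j 1) (axis i 1)) $ i $ j) p" for i j k
        by (cases "j = k") (auto intro: field_lim_const lim)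
      show "field_lim F c r (\<lambda>t q. form_matrix (W t q) $ i $ j) (\<lambda>q. form_matrix (w q) $ i $ j) p" for i j
        by (simp add: form_matrix_def lim)
      show "det (form_matrix (w p)) \<noteq> 0" using nondegenerate_iff_det w(2) wb c(3) by blast
    qed
    show "\<forall>\<^sub>F t in F. \<forall>q\<in>fst c \<inter> (V1 \<inter> V2). ?C (W t q) = inv_form (W t q) a b"
      using V1(4) W by eventually_elim (use V1 C in auto)
    show "?C (w q) = inv_form (w q) a b" if "q \<in> fst c \<inter> (V1 \<inter> V2)" for q
      using that V2 V2n w(1) C by auto
  qed
qed

lemma inverse_bivector_field_lim:
  fixes \<tau> :: "('a, real ^ 'm) two_field" and c :: "('a, real ^ 'm) chart"
  assumes "is_chart X c" "openin X W" "p \<in> fst c \<inter> W" "F \<noteq> bot"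
    and sm: "\<And>u v. smooth_in c W (\<lambda>q. \<tau> c q u v)"
    and alt: "\<And>q. q \<in> fst c \<inter> W \<Longrightarrow> alternating_form (\<tau> c q)"
    and nd: "nondegenerate (\<tau> c p)"
  shows "field_lim F c r (\<lambda>t q. inverse_bivector \<tau> c q a b) (\<lambda>q. inverse_bivector \<tau> c q a b) p"
proof -
  have lim: "field_lim F c r (\<lambda>t q. \<tau> c q u v) (\<lambda>q. \<tau> c q u v) p" for r u v
    by (rule smooth_in_imp_field_lim[OF assms(1-3) sm])
  show ?thesis
    unfolding inverse_bivector_eq
    by (rule field_lim_inv_form[of X c W p F r "\<lambda>t. \<tau> c" "\<tau> c", OF assms(1-3) lim lim assms(4) _ alt nd])
      (use alt in auto)
qed

section \<open>The exterior derivative in a chart\<close>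

definition ext_deriv :: "('a, 'e::euclidean_space) two_field \<Rightarrow> ('a, 'e) chart \<Rightarrow> 'a \<Rightarrow> 'e \<Rightarrow> 'e \<Rightarrow> 'e \<Rightarrow> real" where
  "ext_deriv \<tau> c p u v w = chart_deriv (\<lambda>q. \<tau> c q v w) c p u + chart_deriv (\<lambda>q. \<tau> c q w u) c p v
     + chart_deriv (\<lambda>q. \<tau> c q u v) c p w"

lemma closed_two_form_ext_deriv:
  "closed_two_form A W \<omega> \<longleftrightarrow> two_form A W \<omega> \<and> (\<forall>c\<in>A. \<forall>p\<in>fst c \<inter> W. \<forall>u v w. ext_deriv \<omega> c p u v w = 0)"
  by (simp add: closed_two_form_def ext_deriv_def)

lemma ext_deriv_cong:
  assumes "is_chart X c" "openin X W" "p \<in> fst c \<inter> W" "\<And>q u v. q \<in> fst c \<inter> W \<Longrightarrow> \<sigma> c q u v = \<tau> c q u v"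
  shows "ext_deriv \<sigma> c p u v w = ext_deriv \<tau> c p u v w"
proof -
  have "chart_deriv (\<lambda>q. \<sigma> c q u v) c p = chart_deriv (\<lambda>q. \<tau> c q u v) c p" for u v
    by (rule chart_deriv_cong[OF assms(1-3)]) (rule assms(4))
  then show ?thesis by (simp add: ext_deriv_def)
qed

lemma ext_deriv_add:
  assumes "is_chart X c" "p \<in> fst c" "\<And>u v. local_expr (\<lambda>q. \<sigma> c q u v) c differentiable (at (snd c p))"
    "\<And>u v. local_expr (\<lambda>q. \<tau> c q u v) c differentiable (at (snd c p))"
  shows "ext_deriv (\<lambda>c q u v. \<sigma> c q u v + \<tau> c q u v) c p u v w = ext_deriv \<sigma> c p u v w + ext_deriv \<tau> c p u v w"
  unfolding ext_deriv_def by (simp add: chart_deriv_add[OF assms(1,2,3,4)])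

text \<open>The factor \<open>\<psi>(h)\<close> contributes \<open>\<psi>'(h) dh \<and> \<eta>\<close>, which vanishes when \<open>\<eta>\<close> is divisible by
  \<open>dh\<close>.\<close>

lemma ext_deriv_wedge_scaled:
  fixes h :: "'a \<Rightarrow> real" and \<psi> :: "real \<Rightarrow> real"
  assumes c: "is_chart X c" "p \<in> fst c"
    and h: "local_expr h c differentiable (at (snd c p))"
    and \<psi>: "(\<psi> has_real_derivative D) (at (h p))"
    and \<eta>: "\<And>u v. local_expr (\<lambda>q. wedge (chart_deriv h) \<mu> c q u v) c differentiable (at (snd c p))"
  shows "ext_deriv (\<lambda>c q u v. \<psi> (h q) * wedge (chart_deriv h) \<mu> c q u v) c p u v w
      = \<psi> (h p) * ext_deriv (wedge (chart_deriv h) \<mu>) c p u v w"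
proof -
  note ch = chart_deriv_real_function[OF c h \<psi>]
  show ?thesis
    unfolding ext_deriv_def
    by (simp add: chart_deriv_mult[OF c ch(2) \<eta>] ch(1)) (simp add: wedge_def algebra_simps)
qed

lemma chart_deriv_bilinear_expand:
  assumes c: "is_chart X c" "openin X V" "p \<in> fst c \<inter> V"
    and R: "\<And>q. q \<in> fst c \<inter> V \<Longrightarrow> bilinear (R c q)"
    and d: "\<And>v w. local_expr (\<lambda>q. R c q v w) c differentiable (at (snd c p))"
  shows "chart_deriv (\<lambda>q. R c q v w) c p u = (\<Sum>i\<in>Basis. (v \<bullet> i) * chart_deriv (\<lambda>q. R c q i w) c p u)"
proof -
  have cp: "p \<in> fst c" using c by simp
  have "chart_deriv (\<lambda>q. R c q v w) c p u = chart_deriv (\<lambda>q. \<Sum>i\<in>Basis. (v \<bullet> i) * R c q i w) c p u"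
  proof (rule chart_deriv_cong[OF c, THEN fun_cong])
    fix q assume q: "q \<in> fst c \<inter> V"
    have lin: "linear (\<lambda>v. R c q v w)" using R[OF q] by (simp add: bilinear_def)
    have "R c q v w = R c q (\<Sum>i\<in>Basis. (v \<bullet> i) *\<^sub>R i) w" by (simp add: euclidean_representation)
    then show "R c q v w = (\<Sum>i\<in>Basis. (v \<bullet> i) * R c q i w)"
      by (simp add: linear_sum[OF lin] linear_cmul[OF lin])
  qed
  also have "\<dots> = (\<Sum>i\<in>Basis. (v \<bullet> i) * chart_deriv (\<lambda>q. R c q i w) c p u)"
  proof (subst chart_deriv_sum[OF c(1) cp])
    show "local_expr (\<lambda>q. v \<bullet> i * R c q i w) c differentiable at (snd c p)" for i
      using differentiable_mult[OF differentiable_const[of "v \<bullet> i"] d[of i w]]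
      by (simp add: local_expr_def o_def)
  qed (simp add: chart_deriv_cmult[OF c(1) cp d])
  finally show ?thesis .
qed

text \<open>Differentiating \<open>\<omega>(\<omega>\<^sup>-\<^sup>1(d), v) = d(v)\<close> expresses the derivatives of the inverse
  through those of \<open>\<omega>\<close>. The Schouten bracket then becomes \<open>d\<omega>\<close> evaluated on the
  vectors corresponding to the three covectors.\<close>

lemma inverse_bivector_jacobi:
  fixes c :: "('a, real ^ 'n) chart"
  assumes c: "is_chart X c" "openin X V" "p \<in> fst c \<inter> V"
    and sm: "\<And>u v. smooth_in c V (\<lambda>q. \<tau> c q u v)"
    and alt: "\<And>q. q \<in> fst c \<inter> V \<Longrightarrow> alternating_form (\<tau> c q)"
    and nd: "\<And>q. q \<in> fst c \<inter> V \<Longrightarrow> nondegenerate (\<tau> c q)"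
    and closed: "\<And>u v w. ext_deriv \<tau> c p u v w = 0"
  defines "P \<equiv> inverse_bivector \<tau>"
  shows "chart_deriv (\<lambda>q. P c q b d) c p (hamvec P c p a)
        + chart_deriv (\<lambda>q. P c q d a) c p (hamvec P c p b)
        + chart_deriv (\<lambda>q. P c q a b) c p (hamvec P c p d) = 0"
proof -
  have cp: "p \<in> fst c" using c by simp
  have P: "P c q = inv_form (\<tau> c q)" for q by (simp add: P_def inverse_bivector_eq)
  let ?F = "at_right (0::real)"
  have "field_lim ?F c 1 (\<lambda>t q. P c q u v) (\<lambda>q. P c q u v) p" for u v
    unfolding P_def
    by (rule inverse_bivector_field_lim[where \<tau>=\<tau>, OF c _ sm alt nd[OF c(3)]]) simp_all
  then have Pd: "local_expr (\<lambda>q. P c q u v) c differentiable (at (snd c p))" for u v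
    by (rule field_lim_differentiable)
  have \<tau>d: "local_expr (\<lambda>q. \<tau> c q u v) c differentiable (at (snd c p))" for u v
    using smooth_in_differentiable[OF sm c(3)] .
  define S where "S = sharp (\<tau> c p)"
  define Q where "Q u v w = chart_deriv (\<lambda>q. \<tau> c q v w) c p u" for u v w
  have bil: "bilinear (\<tau> c q)" if "q \<in> fst c \<inter> V" for q using alt[OF that] by (simp add: alternating_form_def)
  have Pbil: "bilinear (P c q)" if "q \<in> fst c \<inter> V" for q
    using inv_form_alternating[OF alt[OF that] nd[OF that]] by (simp add: P alternating_form_def)
  have Q_sum: "Q u v w = (\<Sum>i\<in>Basis. (v \<bullet> i) * Q u i w)" for u v w
    unfolding Q_def by (rule chart_deriv_bilinear_expand[where R=\<tau>, OF c bil \<tau>d])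
  have Q_anti: "Q u v w = - Q u w v" for u v w
  proof -
    have "Q u v w = chart_deriv (\<lambda>q. (-1) * \<tau> c q w v) c p u"
      unfolding Q_def by (rule chart_deriv_cong[OF c, THEN fun_cong]) (simp add: alternating_form_antisym[OF alt, of _ v w])
    then show ?thesis using chart_deriv_cmult[OF c(1) cp \<tau>d, of "-1"] by (simp add: Q_def)
  qed
  have P_S: "P c p u v = u \<bullet> S v" for u v
    using inv_form_sharp[OF alt nd] c(3) by (simp add: P S_def)
  have DP_sum: "chart_deriv (\<lambda>q. P c q b d) c p u = (\<Sum>i\<in>Basis. (b \<bullet> i) * chart_deriv (\<lambda>q. P c q i d) c p u)" for u b d
    by (rule chart_deriv_bilinear_expand[where R=P, OF c Pbil Pd])
  \<comment> \<open>Differentiate \<open>\<tau>(\<tau>\<^sup>-\<^sup>1(d), v) = d(v)\<close> with the vector \<open>v = S b\<close> frozen at \<open>p\<close>.\<close>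
  have DP: "chart_deriv (\<lambda>q. P c q b d) c p u = - Q u (S b) (S d)" for u b d
  proof -
    have *: "chart_deriv (\<lambda>q. \<Sum>i\<in>Basis. P c q i d * \<tau> c q i (S b)) c p u = chart_deriv (\<lambda>q. d \<bullet> S b) c p u"
    proof (rule chart_deriv_cong[OF c, THEN fun_cong])
      fix q assume q: "q \<in> fst c \<inter> V"
      have lin: "linear (\<lambda>v. \<tau> c q v (S b))" using bil[OF q] by (simp add: bilinear_def)
      have "(\<Sum>i\<in>Basis. P c q i d * \<tau> c q i (S b)) = \<tau> c q (\<Sum>i\<in>Basis. (sharp (\<tau> c q) d \<bullet> i) *\<^sub>R i) (S b)"
        by (simp add: P inv_form_sharp[OF alt[OF q] nd[OF q]] linear_sum[OF lin] linear_cmul[OF lin] inner_commute)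
      also have "\<dots> = d \<bullet> S b" by (simp add: euclidean_representation sharp_works[OF bil[OF q] nd[OF q]])
      finally show "(\<Sum>i\<in>Basis. P c q i d * \<tau> c q i (S b)) = d \<bullet> S b" .
    qed
    have \<tau>S: "\<tau> c p i (S b) = - (b \<bullet> i)" for i
      using alternating_form_antisym[OF alt[OF c(3)], of i "S b"] sharp_works[OF bil[OF c(3)] nd[OF c(3)], of b i]
      by (simp add: S_def)
    from * have "0 = chart_deriv (\<lambda>q. \<Sum>i\<in>Basis. P c q i d * \<tau> c q i (S b)) c p u"
      by (simp add: chart_deriv_const)
    also have "\<dots> = (\<Sum>i\<in>Basis. chart_deriv (\<lambda>q. P c q i d * \<tau> c q i (S b)) c p u)"
    proof (rule chart_deriv_sum[OF c(1) cp])
      show "local_expr (\<lambda>q. P c q i d * \<tau> c q i (S b)) c differentiable at (snd c p)" for i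
        using differentiable_mult[OF Pd[of i d] \<tau>d[of i "S b"]] by (simp add: local_expr_def o_def)
    qed
    also have "\<dots> = (\<Sum>i\<in>Basis. P c p i d * Q u i (S b)) + (\<Sum>i\<in>Basis. chart_deriv (\<lambda>q. P c q i d) c p u * \<tau> c p i (S b))"
      by (simp add: chart_deriv_mult[OF c(1) cp Pd \<tau>d] Q_def sum.distrib)
    also have "(\<Sum>i\<in>Basis. P c p i d * Q u i (S b)) = Q u (S d) (S b)"
      by (simp add: Q_sum[of u "S d" "S b"] P_S inner_commute)
    finally show ?thesis
      using Q_anti[of u "S d" "S b"]
      by (simp add: DP_sum[of b d u] \<tau>S sum_negf mult.commute)
  qed
  have ham: "hamvec P c p a = - S a" for a
  proof -
    have anti: "P c p a i = - (S a \<bullet> i)" for i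
      using alternating_form_antisym[OF inv_form_alternating[OF alt[OF c(3)] nd[OF c(3)]], of a i] P_S[of i a]
      by (simp add: P inner_commute)
    have "hamvec P c p a = - (\<Sum>i\<in>Basis. (S a \<bullet> i) *\<^sub>R i)"
      by (simp add: hamvec_def anti sum_negf)
    then show ?thesis by (simp add: euclidean_representation)
  qed
  have "Q (- u) v w = - Q u v w" for u v w
    unfolding Q_def using linear_neg[OF chart_deriv_linear[OF \<tau>d]] .
  then show ?thesis
    using closed[of "S a" "S b" "S d"] by (simp add: DP ham ext_deriv_def Q_def)
qed

section \<open>Forms and bivector fields on a manifold\<close>

lemma smooth_in_unrestrict:
  assumes "is_chart X c" "openin X W" "W \<subseteq> V" "smooth_in (fst c \<inter> V, snd c) W g"
  shows "smooth_in c W g"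
  unfolding smooth_in_def
proof (rule smooth_on_cong[OF chart_open_image[OF assms(1,2)], of "local_expr g (fst c \<inter> V, snd c)"])
  have "fst c \<inter> V \<inter> W = fst c \<inter> W" using assms(3) by auto
  then show "smooth_on (snd c ` (fst c \<inter> W)) (local_expr g (fst c \<inter> V, snd c))"
    using assms(4) by (simp add: smooth_in_def)
  show "local_expr g (fst c \<inter> V, snd c) z = local_expr g c z" if "z \<in> snd c ` (fst c \<inter> W)" for z
    by (rule local_expr_restrict[OF assms(1)]) (use that assms(3) in auto)
qed

lemma smooth_in_Un: "smooth_in c V g \<Longrightarrow> smooth_in c W g \<Longrightarrow> smooth_in c (V \<union> W) g"
  by (auto simp: smooth_in_def smooth_on_def)

lemma
  assumes "two_form A W \<omega>"
  shows two_form_alternating: "c \<in> A \<Longrightarrow> p \<in> fst c \<inter> W \<Longrightarrow> alternating_form (\<omega> c p)"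
    and two_form_change_chart: "c \<in> A \<Longrightarrow> d \<in> A \<Longrightarrow> p \<in> fst c \<inter> fst d \<inter> W \<Longrightarrow>
      \<omega> c p u v = \<omega> d p (chart_deriv (snd d) c p u) (chart_deriv (snd d) c p v)"
    and two_form_smooth: "c \<in> A \<Longrightarrow> smooth_in c W (\<lambda>p. \<omega> c p u v)"
  using assms unfolding two_form_def alternating_form_def by blast+

lemma two_formI:
  assumes "\<And>c p. c \<in> A \<Longrightarrow> p \<in> fst c \<inter> W \<Longrightarrow> alternating_form (\<omega> c p)"
    and "\<And>c d p u v. c \<in> A \<Longrightarrow> d \<in> A \<Longrightarrow> p \<in> fst c \<inter> fst d \<inter> W \<Longrightarrow>
      \<omega> c p u v = \<omega> d p (chart_deriv (snd d) c p u) (chart_deriv (snd d) c p v)"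
    and "\<And>c u v. c \<in> A \<Longrightarrow> smooth_in c W (\<lambda>p. \<omega> c p u v)"
  shows "two_form A W \<omega>"
  unfolding two_form_def
proof (intro conjI ballI allI)
  fix c p assume "c \<in> A" "p \<in> fst c \<inter> W"
  from assms(1)[OF this] show "bilinear (\<omega> c p)" "\<omega> c p u u = 0" for u
    by (simp_all add: alternating_form_def)
qed (use assms(2,3) in blast)+

context manifold begin

lemma closed_two_form_cong:
  assumes W: "openin X W" and eq: "\<And>c p u v. c \<in> A \<Longrightarrow> p \<in> fst c \<inter> W \<Longrightarrow> \<sigma> c p u v = \<tau> c p u v"
    and cl: "closed_two_form A W \<sigma>"
  shows "closed_two_form A W \<tau>"
proof -
  have eq': "\<sigma> c p = \<tau> c p" if "c \<in> A" "p \<in> fst c" "p \<in> W" for c p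
    by (intro ext eq) (use that in auto)
  have tf: "two_form A W \<sigma>" using cl by (simp add: closed_two_form_def)
  have "two_form A W \<tau>"
  proof (rule two_formI)
    show "alternating_form (\<tau> c p)" if c: "c \<in> A" "p \<in> fst c \<inter> W" for c p
      using two_form_alternating[OF tf c] eq'[of c p] c by simp
    show "\<tau> c p u v = \<tau> d p (chart_deriv (snd d) c p u) (chart_deriv (snd d) c p v)"
      if c: "c \<in> A" "d \<in> A" "p \<in> fst c \<inter> fst d \<inter> W" for c d p u v
      using two_form_change_chart[OF tf c, of u v] eq'[of c p] eq'[of d p] c by simp
    show "smooth_in c W (\<lambda>p. \<tau> c p u v)" if c: "c \<in> A" for c u v
      by (rule smooth_in_cong[OF chart[OF c] W _ two_form_smooth[OF tf c]]) (rule eq[OF c])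
  qed
  moreover have "ext_deriv \<tau> c p u v w = 0" if "c \<in> A" "p \<in> fst c \<inter> W" for c p u v w
    using ext_deriv_cong[OF chart[OF that(1)] W that(2), of \<sigma> \<tau> u v w] eq that cl
    by (simp add: closed_two_form_ext_deriv)
  ultimately show ?thesis by (simp add: closed_two_form_ext_deriv)
qed

lemma closed_two_form_Un:
  assumes "closed_two_form A V \<omega>" "closed_two_form A W \<omega>"
  shows "closed_two_form A (V \<union> W) \<omega>"
proof -
  have tf: "two_form A V \<omega>" "two_form A W \<omega>" using assms by (simp_all add: closed_two_form_def)
  have "two_form A (V \<union> W) \<omega>"
  proof (rule two_formI)
    show "alternating_form (\<omega> c p)" if "c \<in> A" "p \<in> fst c \<inter> (V \<union> W)" for c p
      using that two_form_alternating[OF tf(1), of c p] two_form_alternating[OF tf(2), of c p] by blast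
    show "\<omega> c p u v = \<omega> d p (chart_deriv (snd d) c p u) (chart_deriv (snd d) c p v)"
      if "c \<in> A" "d \<in> A" "p \<in> fst c \<inter> fst d \<inter> (V \<union> W)" for c d p u v
      using that two_form_change_chart[OF tf(1), of c d p u v] two_form_change_chart[OF tf(2), of c d p u v] by blast
    show "smooth_in c (V \<union> W) (\<lambda>p. \<omega> c p u v)" if "c \<in> A" for c u v
      using two_form_smooth[OF tf(1) that] two_form_smooth[OF tf(2) that] by (rule smooth_in_Un)
  qed
  then show ?thesis using assms unfolding closed_two_form_ext_deriv Int_Un_distrib ball_Un by blast
qed

lemma closed_two_form_subset:
  assumes "closed_two_form A W \<omega>" "V \<subseteq> W"
  shows "closed_two_form A V \<omega>"
proof -
  have tf: "two_form A W \<omega>" using assms by (auto simp: closed_two_form_def)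
  have "two_form A V \<omega>"
  proof (rule two_formI)
    show "alternating_form (\<omega> c p)" if "c \<in> A" "p \<in> fst c \<inter> V" for c p
      using that assms(2) two_form_alternating[OF tf, of c p] by blast
    show "\<omega> c p u v = \<omega> d p (chart_deriv (snd d) c p u) (chart_deriv (snd d) c p v)"
      if "c \<in> A" "d \<in> A" "p \<in> fst c \<inter> fst d \<inter> V" for c d p u v
      using that assms(2) two_form_change_chart[OF tf, of c d p u v] by blast
    show "smooth_in c V (\<lambda>p. \<omega> c p u v)" if "c \<in> A" for c u v
      by (rule smooth_in_subset[OF two_form_smooth[OF tf that]]) (use assms(2) in auto)
  qed
  then show ?thesis using assms unfolding closed_two_form_ext_deriv by blast
qed

lemma two_form_field_lim:
  assumes "openin X W" "two_form A W \<omega>" "c \<in> A" "p \<in> fst c \<inter> W"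
  shows "field_lim F c r (\<lambda>t q. \<omega> c q u v) (\<lambda>q. \<omega> c q u v) p"
  by (rule smooth_in_imp_field_lim[OF chart[OF assms(3)] assms(1,4) two_form_smooth[OF assms(2,3)]])

lemma two_form_nondegenerate_change_chart:
  assumes "two_form A W \<omega>" "c \<in> A" "d \<in> A" "p \<in> fst c \<inter> fst d \<inter> W" "nondegenerate (\<omega> d p)"
  shows "nondegenerate (\<omega> c p)"
    and "inverse_bivector \<omega> d p a b = inverse_bivector \<omega> c p (adjoint (chart_deriv (snd d) c p) a) (adjoint (chart_deriv (snd d) c p) b)"
proof -
  have alt: "alternating_form (\<omega> d p)" using two_form_alternating[OF assms(1,3), of p] assms(4) by simp
  have lin: "linear (chart_deriv (snd d) c p)" using transition_linear assms by blast
  have inv: "chart_deriv (snd c) d p (chart_deriv (snd d) c p u) = u"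
    "chart_deriv (snd d) c p (chart_deriv (snd c) d p u) = u" for u
    using transition_inverse[of c d p] transition_inverse[of d c p] assms by auto
  have eq: "\<omega> c p u v = \<omega> d p (chart_deriv (snd d) c p u) (chart_deriv (snd d) c p v)" for u v
    by (rule two_form_change_chart[OF assms(1-4)])
  from inv_form_transform[OF alt assms(5) lin inv eq]
  show "nondegenerate (\<omega> c p)"
    "inverse_bivector \<omega> d p a b = inverse_bivector \<omega> c p (adjoint (chart_deriv (snd d) c p) a) (adjoint (chart_deriv (snd d) c p) b)"
    by (simp_all add: inverse_bivector_eq)
qed

lemma continuous_map_of_smooth:
  fixes h :: "'a \<Rightarrow> real"
  assumes "\<And>c. c \<in> A \<Longrightarrow> smooth_in c (topspace X) h"
  shows "continuous_map X euclidean h"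
  unfolding continuous_map_def
proof (intro conjI allI impI)
  fix V :: "real set" assume "openin euclidean V"
  then have V: "open V" by simp
  show "openin X {p \<in> topspace X. h p \<in> V}"
  proof (subst openin_subopen, intro ballI)
    fix p assume p: "p \<in> {p \<in> topspace X. h p \<in> V}"
    then obtain c where c: "c \<in> A" "p \<in> fst c" using obtain_chart by blast
    have le: "local_expr h c (snd c q) = h q" if "q \<in> fst c" for q
      using local_expr_at[OF chart[OF c(1)] that] .
    have "isCont (local_expr h c) (snd c p)"
      using smooth_in_differentiable[OF assms[OF c(1)], of p] c p differentiable_imp_continuous_within by blast
    then have "(local_expr h c \<longlongrightarrow> local_expr h c (snd c p)) (nhds (snd c p))"
      using tendsto_at_iff_tendsto_nhds isContD by blast
    then have "\<forall>\<^sub>F z in nhds (snd c p). local_expr h c z \<in> V"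
      by (rule topological_tendstoD[OF _ V]) (use p le c in auto)
    then obtain S where S: "open S" "snd c p \<in> S" "\<forall>z\<in>S. local_expr h c z \<in> V"
      unfolding eventually_nhds by blast
    have "{q \<in> fst c. snd c q \<in> S} \<subseteq> {p \<in> topspace X. h p \<in> V}"
      using S(3) le chart_subset[OF chart[OF c(1)]] by auto
    then show "\<exists>T. openin X T \<and> p \<in> T \<and> T \<subseteq> {p \<in> topspace X. h p \<in> V}"
      using chart_open_vimage[OF chart[OF c(1)] S(1)] c(2) S(2) by blast
  qed
qed auto

end

context manifold begin

text \<open>The components in the new chart are linear combinations of the old ones. The coefficients are
  products of first derivatives of the change of charts, which are smooth.\<close>

lemma bivector_field_lim_change_chart:
  assumes c: "c \<in> A" "d \<in> A" "p \<in> fst c \<inter> fst d"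
    and lim: "\<And>a b. field_lim F c r (\<lambda>t q. R t c q a b) (\<lambda>q. R0 c q a b) p"
    and R: "\<forall>\<^sub>F t in F. \<forall>q\<in>fst c \<inter> fst d. bilinear (R t c q) \<and>
      (\<forall>a b. R t d q a b = R t c q (adjoint (chart_deriv (snd d) c q) a) (adjoint (chart_deriv (snd d) c q) b))"
    and R0: "\<forall>q\<in>fst c \<inter> fst d. bilinear (R0 c q) \<and>
      (\<forall>a b. R0 d q a b = R0 c q (adjoint (chart_deriv (snd d) c q) a) (adjoint (chart_deriv (snd d) c q) b))"
  shows "field_lim F d r (\<lambda>t q. R t d q a b) (\<lambda>q. R0 d q a b) p"
proof (rule field_lim_change_chart[of d c])
  let ?D = "\<lambda>q i a. chart_deriv (\<lambda>q. snd d q \<bullet> a) c q i"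
  let ?S = "\<lambda>R q. \<Sum>i\<in>Basis. \<Sum>j\<in>Basis. ?D q i a * (?D q j b * R c q i j)"
  have od: "openin X (fst d)" by (rule chart_openin[OF chart[OF c(2)]])
  have cp: "p \<in> fst c" using c by simp
  have D: "field_lim F c r (\<lambda>t q. ?D q i a) (\<lambda>q. ?D q i a) p" for i a
    by (intro field_lim_chart_deriv[OF chart[OF c(1)] cp] smooth_in_imp_field_lim[OF chart[OF c(1)] od c(3)]
        smooth_in_bounded_linear[OF chart[OF c(1)] od bounded_linear_inner_left] smooth_transition c(1,2))
  have eq: "?S R q = R d q a b"
    if q: "q \<in> fst c \<inter> fst d" and b: "bilinear (R c q)"
      and e: "R d q a b = R c q (adjoint (chart_deriv (snd d) c q) a) (adjoint (chart_deriv (snd d) c q) b)"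
    for q and R :: "('a, 'e) two_field"
    unfolding e bilinear_adjoint[OF b transition_linear[OF c(1,2) q]]
    by (simp add: chart_deriv_inner[OF transition_differentiable[OF c(1,2) q]])
  have "field_lim F c r (\<lambda>t q. ?S (R t) q) (\<lambda>q. ?S R0 q) p"
    by (intro field_lim_sum field_lim_mult D lim)
  then show "field_lim F c r (\<lambda>t q. R t d q a b) (\<lambda>q. R0 d q a b) p"
  proof (rule field_lim_cong[OF chart[OF c(1)] od c(3)])
    show "\<forall>\<^sub>F t in F. \<forall>q\<in>fst c \<inter> fst d. ?S (R t) q = R t d q a b"
      using R by eventually_elim (use eq in blast)
    show "?S R0 q = R0 d q a b" if "q \<in> fst c \<inter> fst d" for q
      using eq[OF that, of R0] R0 that by blast
  qed
qed (use c in auto)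

end

section \<open>The Laurent decomposition\<close>

locale laurent_desingularization = manifold X A
  for X :: "'a topology" and A :: "('a, real ^ 'n) chart set" +
  fixes B :: "('a, 'f::euclidean_space) chart set"
    and x :: "'a \<Rightarrow> real"
    and \<omega> \<beta> :: "('a, real ^ 'n) two_field"
    and \<alpha> :: "nat \<Rightarrow> ('a, 'f) one_field"
    and U :: "'a set" and \<pi> :: "'a \<Rightarrow> 'a"
    and f :: "real \<Rightarrow> real" and k :: nat
  assumes k_pos: "k \<ge> 1"
    and compact: "compact_space X"
    and x_smooth: "\<And>c. c \<in> A \<Longrightarrow> smooth_in c (topspace X) x"
    and x_regular: "\<And>c p. c \<in> A \<Longrightarrow> p \<in> fst c \<inter> zero_set X x \<Longrightarrow> \<exists>u. chart_deriv x c p u \<noteq> 0"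
    and Z_manifold: "smooth_manifold (subtopology X (zero_set X x)) B"
    and \<omega>_symplectic: "bm_symplectic (2 * k) X A x \<omega>"
    and laurent: "laurent_decomposition (2 * k) X A x B U \<pi> \<alpha> \<beta> \<omega>"
    and desing: "desing_function k f"
begin

abbreviation Z :: "'a set" where "Z \<equiv> zero_set X x"
abbreviation \<Lambda> :: "('a, real ^ 'n) one_field" where "\<Lambda> \<equiv> laurent_sum (2 * k) x B \<pi> \<alpha>"
abbreviation \<eta> :: "('a, real ^ 'n) two_field" where "\<eta> \<equiv> wedge (chart_deriv x) \<Lambda>"
abbreviation \<omega>\<epsilon> :: "real \<Rightarrow> ('a, real ^ 'n) two_field" where
  "\<omega>\<epsilon> \<equiv> desingularization k f x B U \<pi> \<alpha> \<beta> \<omega>"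

sublocale Z: manifold "subtopology X Z" B
  by unfold_locales (rule Z_manifold)

abbreviation P\<epsilon> :: "real \<Rightarrow> ('a, real ^ 'n) two_field" where
  "P\<epsilon> \<epsilon> \<equiv> inverse_bivector (\<omega>\<epsilon> \<epsilon>)"

lemma x_continuous: "continuous_map X euclidean x"
  by (rule continuous_map_of_smooth) (rule x_smooth)

lemma openin_x: "open V \<Longrightarrow> openin X {p \<in> topspace X. x p \<in> V}"
  using openin_continuous_map_preimage[OF x_continuous] by simp

lemma Z_subset: "Z \<subseteq> topspace X"
  by (auto simp: zero_set_def)

lemma openin_minus_Z: "openin X (topspace X - Z)"
proof -
  have "topspace X - Z = {p \<in> topspace X. x p \<in> - {0}}" by (auto simp: zero_set_def)
  then show ?thesis using openin_x[of "- {0}"] by auto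
qed

lemma U: "openin X U" "Z \<subseteq> U" "U \<subseteq> topspace X"
  using laurent openin_subset by (auto simp: laurent_decomposition_def tubular_neighborhood_def)

lemma x_differentiable: "c \<in> A \<Longrightarrow> p \<in> fst c \<Longrightarrow> local_expr x c differentiable (at (snd c p))"
  using smooth_in_differentiable[OF x_smooth, of c p] chart_subset[OF chart] by blast

lemma x_field_lim: "c \<in> A \<Longrightarrow> p \<in> fst c \<Longrightarrow> field_lim F c r (\<lambda>t. x) x p"
  by (rule smooth_in_imp_field_lim[OF chart openin_topspace _ x_smooth]) (use chart_subset[OF chart, of c] in auto)

lemma obtain_tube:
  obtains l r where "continuous_map (subtopology X U) (subtopology X Z) \<pi>"
    "x ` U \<subseteq> {l<..<r}"
    "smooth_map (subtopology X U) (open_atlas U A)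
       (prod_topology (subtopology X Z) (top_of_set {l<..<r}))
       (prod_atlas B {({l<..<r}, \<lambda>t. t)}) (\<lambda>p. (\<pi> p, x p))"
proof -
  obtain l r where "diffeomorphism (subtopology X U) (open_atlas U A)
          (prod_topology (subtopology X Z) (top_of_set {l<..<r}))
          (prod_atlas B {({l<..<r}, \<lambda>t. t)}) (\<lambda>p. (\<pi> p, x p))"
    using laurent unfolding laurent_decomposition_def tubular_neighborhood_def by blast
  then have sm: "smooth_map (subtopology X U) (open_atlas U A)
          (prod_topology (subtopology X Z) (top_of_set {l<..<r}))
          (prod_atlas B {({l<..<r}, \<lambda>t. t)}) (\<lambda>p. (\<pi> p, x p))"
    unfolding diffeomorphism_def by blast
  then have "continuous_map (subtopology X U) (prod_topology (subtopology X Z) (top_of_set {l<..<r})) (\<lambda>p. (\<pi> p, x p))"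
    unfolding smooth_map_def by (rule conjunct1)
  then have "continuous_map (subtopology X U) (subtopology X Z) \<pi>"
    and cx: "continuous_map (subtopology X U) (top_of_set {l<..<r}) x"
    unfolding continuous_map_pairwise o_def by simp_all
  moreover have "x ` U \<subseteq> {l<..<r}"
    using continuous_map_image_subset_topspace[OF cx] U(3) by (auto simp: Int_absorb1)
  ultimately show ?thesis using that sm by blast
qed

lemma Z_topspace: "topspace (subtopology X Z) = Z"
  using Z_subset by auto

lemma projection_in_Z: "p \<in> U \<Longrightarrow> \<pi> p \<in> Z"
proof -
  assume p: "p \<in> U"
  obtain l r where "continuous_map (subtopology X U) (subtopology X Z) \<pi>" by (rule obtain_tube)
  from continuous_map_image_subset_topspace[OF this] show "\<pi> p \<in> Z"
    using p U(3) by (auto simp: Z_topspace)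
qed

lemma obtain_Z_chart:
  assumes "p \<in> U"
  obtains d where "d \<in> B" "\<pi> p \<in> fst d"
  using Z.obtain_chart[of "\<pi> p"] projection_in_Z[OF assms] unfolding Z_topspace by blast

lemma openin_projection:
  assumes "d \<in> B"
  shows "openin X {p \<in> U. \<pi> p \<in> fst d}"
proof -
  obtain l r where "continuous_map (subtopology X U) (subtopology X Z) \<pi>" by (rule obtain_tube)
  from openin_continuous_map_preimage[OF this chart_openin[OF Z.chart[OF assms]]]
  have "openin (subtopology X U) {p \<in> U. \<pi> p \<in> fst d}" using U(3) by (simp add: Int_absorb1)
  then show ?thesis using U(1) openin_trans_full by blast
qed

lemma projection_smooth:
  assumes d: "d \<in> B" and c: "c \<in> A"
  shows "smooth_in c {p \<in> U. \<pi> p \<in> fst d} (\<lambda>p. snd d (\<pi> p))"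
proof -
  obtain l r where "continuous_map (subtopology X U) (subtopology X Z) \<pi>"
    and xr: "x ` U \<subseteq> {l<..<r}"
    and sm: "smooth_map (subtopology X U) (open_atlas U A)
     (prod_topology (subtopology X Z) (top_of_set {l<..<r}))
     (prod_atlas B {({l<..<r}, \<lambda>t. t)}) (\<lambda>p. (\<pi> p, x p))"
    by (rule obtain_tube)
  let ?F = "\<lambda>p. (\<pi> p, x p)"
  have oW: "openin X {p \<in> U. \<pi> p \<in> fst d}" by (rule openin_projection[OF d])
  let ?W = "{p \<in> U. \<pi> p \<in> fst d}"
  let ?c = "(fst c \<inter> U, snd c)"
  let ?d = "(fst d \<times> {l<..<r}, map_prod (snd d) (\<lambda>t. t))"
  have cA: "?c \<in> A" by (rule restrict_chart[OF c U(1)])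
  then have cU: "?c \<in> open_atlas U A" by (simp add: open_atlas_def)
  have dU: "?d \<in> prod_atlas B {({l<..<r}, \<lambda>t. t)}" using d by (force simp: prod_atlas_def)
  have "smooth_in ?c (?F -` fst ?d) (snd ?d \<circ> ?F)"
    using sm[unfolded smooth_map_def, THEN conjunct2, THEN bspec, OF cU, THEN bspec, OF dU] by simp
  then have "smooth_in ?c ?W (snd ?d \<circ> ?F)"
    by (rule smooth_in_subset) (use xr in auto)
  then have "smooth_in ?c ?W (\<lambda>p. fst ((snd ?d \<circ> ?F) p))"
    by (rule smooth_in_bounded_linear[OF chart[OF cA] \<open>openin X ?W\<close> bounded_linear_fst])
  then have "smooth_in ?c ?W (\<lambda>p. snd d (\<pi> p))" by (simp add: o_def)
  then show ?thesis by (rule smooth_in_unrestrict[OF chart[OF c] oW, rotated]) auto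
qed

text \<open>The choice of the chart of \<open>Z\<close> in \<open>pullback\<close> is immaterial: the transformation law of \<open>a\<close> is
  compensated by the chain rule. Hence a single chart can be used on a neighbourhood.\<close>

lemma pullback_eq:
  assumes a: "one_form B Z a" and c: "c \<in> A" "p \<in> fst c" "p \<in> U" and d: "d \<in> B" "\<pi> p \<in> fst d"
  shows "pullback B \<pi> a c p u = a d (\<pi> p) (chart_deriv (\<lambda>q. snd d (\<pi> q)) c p u)"
proof -
  define d0 where "d0 = (SOME d. d \<in> B \<and> \<pi> p \<in> fst d)"
  have d0: "d0 \<in> B" "\<pi> p \<in> fst d0"
    unfolding atomize_conj d0_def by (rule someI_ex) (use d in blast)
  let ?W = "{p \<in> U. \<pi> p \<in> fst d0}"
  have pW: "p \<in> fst c \<inter> ?W" using c d0 by simp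
  have "chart_deriv (\<lambda>q. snd d (\<pi> q)) c p u
      = chart_deriv (snd d) d0 (\<pi> p) (chart_deriv (\<lambda>q. snd d0 (\<pi> q)) c p u)"
  proof (rule chart_deriv_chain[OF chart[OF c(1)] openin_projection[OF d0(1)] pW Z.chart[OF d0(1)]])
    show "local_expr (\<lambda>q. snd d0 (\<pi> q)) c differentiable at (snd c p)"
      by (rule smooth_in_differentiable[OF projection_smooth[OF d0(1) c(1)] pW])
    show "local_expr (snd d) d0 differentiable at (snd d0 (\<pi> p))"
      by (rule Z.transition_differentiable) (use d d0 in auto)
  qed simp
  moreover have "a d0 (\<pi> p) v = a d (\<pi> p) (chart_deriv (snd d) d0 (\<pi> p) v)" for v
    using a d d0 projection_in_Z[OF c(3)] unfolding one_form_def by blast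
  ultimately show ?thesis
    by (simp add: pullback_def Let_def d0_def[symmetric] o_def)
qed

lemma pullback_one_form:
  assumes a: "one_form B Z a"
  shows "one_form A U (pullback B \<pi> a)"
  unfolding one_form_def
proof (intro conjI ballI allI)
  fix c p assume c: "c \<in> A" "p \<in> fst c \<inter> U"
  obtain d where d: "d \<in> B" "\<pi> p \<in> fst d" using obtain_Z_chart c(2) by blast
  have "linear (a d (\<pi> p))" using a d projection_in_Z c(2) unfolding one_form_def by blast
  moreover have "linear (chart_deriv (\<lambda>q. snd d (\<pi> q)) c p)"
    by (rule chart_deriv_linear[OF smooth_in_differentiable[OF projection_smooth[OF d(1) c(1)]]]) (use c d in auto)
  moreover have "pullback B \<pi> a c p = a d (\<pi> p) \<circ> chart_deriv (\<lambda>q. snd d (\<pi> q)) c p"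
    using pullback_eq[OF a c(1) _ _ d] c(2) by (auto simp: fun_eq_iff)
  ultimately show "linear (pullback B \<pi> a c p)" using linear_compose by metis
next
  fix c c' p u assume c: "c \<in> A" "c' \<in> A" "p \<in> fst c \<inter> fst c' \<inter> U"
  obtain d where d: "d \<in> B" "\<pi> p \<in> fst d" using obtain_Z_chart c(3) by blast
  have "local_expr (\<lambda>q. snd d (\<pi> q)) c' differentiable (at (snd c' p))"
    by (rule smooth_in_differentiable[OF projection_smooth[OF d(1) c(2)]]) (use c d in auto)
  from chart_deriv_change_chart[OF c(1,2) _ this, of u]
  show "pullback B \<pi> a c p u = pullback B \<pi> a c' p (chart_deriv (snd c') c p u)"
    using pullback_eq[OF a c(1) _ _ d] pullback_eq[OF a c(2) _ _ d] c(3) by simp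
next
  fix c u assume c: "c \<in> A"
  let ?F = "at_right (0::real)"
  show "smooth_in c U (\<lambda>p. pullback B \<pi> a c p u)"
  proof (rule smooth_inI_field_lim[OF chart[OF c] U(1)])
    fix p r assume p: "p \<in> fst c \<inter> U"
    obtain d where d: "d \<in> B" "\<pi> p \<in> fst d" using obtain_Z_chart p by blast
    let ?W = "{p \<in> U. \<pi> p \<in> fst d}"
    note oW = openin_projection[OF d(1)] and sm = projection_smooth[OF d(1) c]
    have pW: "p \<in> fst c \<inter> ?W" using p d by simp
    have cp: "p \<in> fst c" using p by simp
    have dZ: "fst d \<subseteq> Z" using chart_subset[OF Z.chart[OF d(1)]] Z_topspace by simp
    have 1: "field_lim ?F c r (\<lambda>t q. chart_deriv (\<lambda>q. snd d (\<pi> q) \<bullet> j) c q u)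
        (\<lambda>q. chart_deriv (\<lambda>q. snd d (\<pi> q) \<bullet> j) c q u) p" for j
      by (intro field_lim_chart_deriv[OF chart[OF c] cp] smooth_in_imp_field_lim[OF chart[OF c] oW pW]
          smooth_in_bounded_linear[OF chart[OF c] oW bounded_linear_inner_left sm])
    have "smooth_in d Z (\<lambda>z. a d z j)" for j using a d(1) by (simp add: one_form_def)
    then have "field_lim ?F d r (\<lambda>t z. a d z j) (\<lambda>z. a d z j) (\<pi> p)" for j
      using d dZ smooth_in_iff_field_lim[OF Z.chart[OF d(1)] openin_topspace, of "\<lambda>z. a d z j" ?F]
      unfolding Z_topspace by blast
    then have 2: "field_lim ?F c r (\<lambda>t q. a d (\<pi> q) j) (\<lambda>q. a d (\<pi> q) j) p" for j
      by (rule field_lim_pullback[where H="\<lambda>t z. a d z j" and h="\<lambda>z. a d z j" for j, OF chart[OF c] oW pW Z.chart[OF d(1)] _ sm, rotated]) auto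
    let ?S = "\<lambda>q. \<Sum>j\<in>Basis. chart_deriv (\<lambda>q. snd d (\<pi> q) \<bullet> j) c q u * a d (\<pi> q) j"
    have eq: "?S q = pullback B \<pi> a c q u" if q: "q \<in> fst c \<inter> ?W" for q
    proof -
      have lin: "linear (a d (\<pi> q))" using a d q projection_in_Z[of q] unfolding one_form_def by blast
      let ?v = "chart_deriv (\<lambda>q. snd d (\<pi> q)) c q u"
      have "pullback B \<pi> a c q u = a d (\<pi> q) (\<Sum>j\<in>Basis. (?v \<bullet> j) *\<^sub>R j)"
        using pullback_eq[OF a c _ _ d(1)] q by (simp add: euclidean_representation)
      also have "\<dots> = (\<Sum>j\<in>Basis. (?v \<bullet> j) * a d (\<pi> q) j)"
        by (simp add: linear_sum[OF lin] linear_cmul[OF lin])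
      finally show ?thesis
        by (simp add: chart_deriv_inner[OF smooth_in_differentiable[OF sm q]])
    qed
    have "field_lim ?F c r (\<lambda>t. ?S) ?S p" by (intro field_lim_sum field_lim_mult 1 2)
    then show "field_lim ?F c r (\<lambda>t q. pullback B \<pi> a c q u) (\<lambda>q. pullback B \<pi> a c q u) p"
      by (rule field_lim_cong[OF chart[OF c] oW pW]) (use eq in auto)
  qed
qed

lemma laurent_sum_one_form: "one_form A U \<Lambda>"
proof -
  have pb: "one_form A U (pullback B \<pi> (\<alpha> i))" if "i < 2 * k" for i
    using laurent that by (intro pullback_one_form) (auto simp: laurent_decomposition_def closed_one_form_def)
  show ?thesis
    unfolding one_form_def
  proof (intro conjI ballI allI)
    fix c p assume c: "c \<in> A" "p \<in> fst c \<inter> U"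
    have lin: "linear (pullback B \<pi> (\<alpha> i) c p)" if "i < 2 * k" for i
      using pb[OF that] c by (auto simp: one_form_def)
    show "linear (\<Lambda> c p)"
      unfolding laurent_sum_def
      by (rule linearI) (auto simp: linear_add[OF lin] linear_cmul[OF lin] sum.distrib sum_distrib_left algebra_simps)
  next
    fix c c' p u assume c: "c \<in> A" "c' \<in> A" "p \<in> fst c \<inter> fst c' \<inter> U"
    have "pullback B \<pi> (\<alpha> i) c p u = pullback B \<pi> (\<alpha> i) c' p (chart_deriv (snd c') c p u)" if "i < 2 * k" for i
      using pb[OF that] c unfolding one_form_def by blast
    then show "\<Lambda> c p u = \<Lambda> c' p (chart_deriv (snd c') c p u)" by (simp add: laurent_sum_def)
  next
    fix c u assume c: "c \<in> A"
    let ?F = "at_right (0::real)"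
    show "smooth_in c U (\<lambda>p. \<Lambda> c p u)"
      unfolding smooth_in_iff_field_lim[OF chart[OF c] U(1), of _ ?F] laurent_sum_def
    proof (intro ballI allI field_lim_sum field_lim_mult field_lim_power x_field_lim c)
      fix p r i assume *: "p \<in> fst c \<inter> U" "i \<in> {..<2 * k}"
      then show "p \<in> fst c" by simp
      have "smooth_in c U (\<lambda>p. pullback B \<pi> (\<alpha> i) c p u)" using pb[of i] c * by (simp add: one_form_def)
      then show "field_lim ?F c r (\<lambda>t q. pullback B \<pi> (\<alpha> i) c q u) (\<lambda>q. pullback B \<pi> (\<alpha> i) c q u) p"
        using * unfolding smooth_in_iff_field_lim[OF chart[OF c] U(1), of _ ?F] by blast
    qed
  qed
qed

lemma x_smooth_subset: "W \<subseteq> topspace X \<Longrightarrow> c \<in> A \<Longrightarrow> smooth_in c W x"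
  using smooth_in_subset[OF x_smooth, of c W] by blast

lemma \<eta>_two_form: "two_form A U \<eta>"
  by (intro two_form_wedge[OF U(1) _ laurent_sum_one_form] one_form_differential[OF U(1)] x_smooth_subset[OF U(3)])

lemma \<beta>_closed: "closed_two_form A U \<beta>"
  using laurent by (simp add: laurent_decomposition_def)

lemma \<beta>_two_form: "two_form A U \<beta>"
  using \<beta>_closed by (simp add: closed_two_form_def)

lemma \<omega>_closed: "closed_two_form A (topspace X - Z) \<omega>"
  using \<omega>_symplectic by (simp add: bm_symplectic_def)

lemma \<omega>_two_form: "two_form A (topspace X - Z) \<omega>"
  using \<omega>_closed by (simp add: closed_two_form_def)

lemma \<omega>_nondegenerate: "c \<in> A \<Longrightarrow> p \<in> fst c - Z \<Longrightarrow> nondegenerate (\<omega> c p)"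
  using \<omega>_symplectic by (auto simp: bm_symplectic_def)

lemma \<omega>_eq:
  assumes "c \<in> A" "p \<in> fst c \<inter> (U - Z)"
  shows "\<omega> c p u v = inverse (x p ^ (2 * k)) * \<eta> c p u v + \<beta> c p u v"
proof -
  have "\<omega> c p u v = wedge (\<lambda>c p u. chart_deriv x c p u / x p ^ (2 * k)) \<Lambda> c p u v + \<beta> c p u v"
    using laurent assms unfolding laurent_decomposition_def by blast
  then show ?thesis by (simp add: wedge_def divide_inverse algebra_simps)
qed

text \<open>The set where \<open>h\<close> does not vanish is open and contained in \<open>Z\<close>, but \<open>dx\<close> would
  vanish in the interior of \<open>Z\<close>.\<close>

lemma zero_off_Z_imp_zero:
  assumes c: "c \<in> A" "openin X W" "p \<in> fst c \<inter> W"
    and d: "local_expr h c differentiable (at (snd c p))"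
    and h: "\<And>q. q \<in> fst c \<inter> W - Z \<Longrightarrow> h q = (0::real)"
  shows "h p = 0"
proof (rule ccontr)
  assume ne: "h p \<noteq> 0"
  have ic: "is_chart X c" using chart c(1) by blast
  have pZ: "p \<in> Z" using ne h c(3) by blast
  have "(local_expr h c \<longlongrightarrow> local_expr h c (snd c p)) (nhds (snd c p))"
    using differentiable_imp_continuous_within[OF d] tendsto_at_iff_tendsto_nhds isContD by blast
  then have "\<forall>\<^sub>F z in nhds (snd c p). local_expr h c z \<noteq> 0"
    by (rule tendsto_imp_eventually_ne) (use ne c(3) in \<open>simp add: local_expr_at[OF ic]\<close>)
  moreover have "\<forall>\<^sub>F z in nhds (snd c p). local_expr h c z \<noteq> 0 \<longrightarrow> local_expr x c z = 0"
  proof (rule eventually_nhds_chart[OF ic c(2,3)])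
    fix q assume q: "q \<in> fst c \<inter> W"
    have "q \<notin> Z \<Longrightarrow> h q = 0" using q h by blast
    moreover have "q \<in> Z \<Longrightarrow> x q = 0" by (simp add: zero_set_def)
    ultimately show "local_expr h c (snd c q) \<noteq> 0 \<longrightarrow> local_expr x c (snd c q) = 0"
      using q by (auto simp: local_expr_at[OF ic])
  qed
  ultimately have "\<forall>\<^sub>F z in nhds (snd c p). local_expr x c z = 0" by eventually_elim simp
  from differentiable_cong_eventually(2)[OF this]
  have "chart_deriv x c p u = 0" for u by (simp add: chart_deriv_def)
  then show False using x_regular[OF c(1)] c(3) pZ by blast
qed

lemma two_form_differentiable:
  assumes "two_form A W \<tau>" "c \<in> A" "p \<in> fst c \<inter> W"
  shows "local_expr (\<lambda>q. \<tau> c q u v) c differentiable (at (snd c p))"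
proof -
  have "smooth_in c W (\<lambda>q. \<tau> c q u v)" using assms(1,2) by (simp add: two_form_def)
  then show ?thesis using assms(3) by (rule smooth_in_differentiable)
qed

lemma ext_deriv_scaled_\<eta>:
  assumes c: "c \<in> A" "p \<in> fst c \<inter> U" and \<psi>: "(\<psi> has_real_derivative D) (at (x p))"
  shows "ext_deriv (\<lambda>c q u v. \<psi> (x q) * \<eta> c q u v + \<beta> c q u v) c p u v w = \<psi> (x p) * ext_deriv \<eta> c p u v w"
proof -
  have ic: "is_chart X c" and cp: "p \<in> fst c" using chart c by auto
  note xd = x_differentiable[OF c(1) cp]
  have \<eta>d: "local_expr (\<lambda>q. \<eta> c q u v) c differentiable at (snd c p)"
    and \<beta>d: "local_expr (\<lambda>q. \<beta> c q u v) c differentiable at (snd c p)" for u v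
    by (rule two_form_differentiable[OF \<eta>_two_form c] two_form_differentiable[OF \<beta>_two_form c])+
  have dif: "local_expr (\<lambda>q. \<psi> (x q) * \<eta> c q u v) c differentiable at (snd c p)" for u v
    using differentiable_mult[OF chart_deriv_real_function(2)[OF ic cp xd \<psi>] \<eta>d[of u v]]
    by (simp add: local_expr_def o_def)
  have "ext_deriv \<beta> c p u v w = 0"
    using \<beta>_closed c unfolding closed_two_form_ext_deriv by blast
  then show ?thesis
    using ext_deriv_add[of X c p "\<lambda>c q u v. \<psi> (x q) * \<eta> c q u v" \<beta>, OF ic cp dif \<beta>d]
      ext_deriv_wedge_scaled[OF ic cp xd \<psi> \<eta>d] by simp
qed

text \<open>Off \<open>Z\<close>, both \<open>\<omega>\<close> and \<open>\<beta>\<close> are closed and \<open>\<omega> - \<beta> = x\<^sup>-\<^sup>2\<^sup>k \<eta>\<close>, so that \<open>d\<eta> = 0\<close>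
  there; it extends by continuity.\<close>

lemma \<eta>_closed: "closed_two_form A U \<eta>"
  unfolding closed_two_form_ext_deriv
proof (intro conjI ballI allI)
  show "two_form A U \<eta>" by (rule \<eta>_two_form)
  fix c p u v w assume c: "c \<in> A" "p \<in> fst c \<inter> U"
  have ic: "is_chart X c" using chart c(1) by blast
  have cp: "p \<in> fst c" using c by simp
  have off: "ext_deriv \<eta> c q u v w = 0" if q: "q \<in> fst c \<inter> U - Z" for q
  proof -
    have oW: "openin X (U \<inter> (topspace X - Z))" using U(1) openin_minus_Z by (rule openin_Int)
    have qW: "q \<in> fst c \<inter> (U \<inter> (topspace X - Z))" using q U(3) by auto
    have qU: "q \<in> fst c \<inter> U" using q by simp
    have xq: "x q \<noteq> 0" using q U(3) by (auto simp: zero_set_def)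
    let ?\<psi> = "\<lambda>s::real. inverse (s ^ (2 * k))"
    have "(?\<psi> has_real_derivative deriv ?\<psi> (x q)) (at (x q))"
      using xq by (intro DERIV_deriv_iff_real_differentiable[THEN iffD2]) (auto intro!: derivative_intros)
    note \<psi> = this
    have "0 = ext_deriv \<omega> c q u v w"
      using \<omega>_closed c(1) qW unfolding closed_two_form_ext_deriv by auto
    also have "\<dots> = ext_deriv (\<lambda>c q u v. ?\<psi> (x q) * \<eta> c q u v + \<beta> c q u v) c q u v w"
      by (rule ext_deriv_cong[OF ic oW qW], rule \<omega>_eq[OF c(1)]) auto
    also have "\<dots> = ?\<psi> (x q) * ext_deriv \<eta> c q u v w"
      by (rule ext_deriv_scaled_\<eta>[OF c(1) qU \<psi>])
    finally show ?thesis using xq by simp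
  qed
  show "ext_deriv \<eta> c p u v w = 0"
  proof (rule zero_off_Z_imp_zero[OF c(1) U(1) c(2) _ off])
    let ?F = "at_right (0::real)"
    have "field_lim ?F c 1 (\<lambda>t q. ext_deriv \<eta> c q u v w) (\<lambda>q. ext_deriv \<eta> c q u v w) p"
      unfolding ext_deriv_def
      by (intro field_lim_add field_lim_chart_deriv[OF ic cp] two_form_field_lim[OF U(1) \<eta>_two_form c])
    then show "local_expr (\<lambda>q. ext_deriv \<eta> c q u v w) c differentiable at (snd c p)"
      by (rule field_lim_differentiable)
  qed
qed

end

section \<open>The desingularized forms are closed\<close>

lemma jet_lim_ident: "jet_lim F r (\<lambda>t z. z) (\<lambda>z. z) (y::real)"
  by (cases r) (auto intro: filterlim_snd jet_lim_const)

lemma field_lim_compose_real: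
  fixes h :: "'a \<Rightarrow> real" and \<phi> :: "'t \<Rightarrow> real \<Rightarrow> real"
  assumes c: "is_chart X c" "openin X W" "p \<in> fst c \<inter> W" and h: "smooth_in c W h"
    and \<phi>: "jet_lim F r \<phi> \<phi>0 (h p)"
  shows "field_lim F c r (\<lambda>t q. \<phi> t (h q)) (\<lambda>q. \<phi>0 (h q)) p"
proof -
  have "jet_lim F r (\<lambda>t z. \<phi> t (local_expr h c z)) (\<lambda>z. \<phi>0 (local_expr h c z)) (snd c p)"
  proof (rule jet_lim_compose)
    show "open (snd c ` (fst c \<inter> W))" by (rule chart_open_image[OF c(1,2)])
    show "smooth_on (snd c ` (fst c \<inter> W)) (local_expr h c)" using h by (simp add: smooth_in_def)
    show "jet_lim F r \<phi> \<phi>0 (local_expr h c (snd c p))"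
      using \<phi> c(3) by (simp add: local_expr_at[OF c(1)])
  qed (use c in auto)
  then show ?thesis by (simp add: field_lim_def local_expr_def o_def)
qed

lemma DERIV_negative_power_antiderivative:
  fixes s C :: real
  assumes "s \<noteq> 0" "m > 0"
  shows "((\<lambda>s. - 1 / (real m * s ^ m) + C) has_real_derivative 1 / s ^ Suc m) (at s)"
proof -
  obtain j where m: "m = Suc j" using assms(2) gr0_conv_Suc by blast
  have "((\<lambda>s. s ^ Suc j) has_real_derivative real (Suc j) * s ^ j) (at s)"
    using DERIV_pow[of "Suc j" s UNIV] by simp
  from DERIV_add[OF DERIV_cmult[OF DERIV_inverse'[OF this], of "- 1 / real (Suc j)"] DERIV_const[of C]]
  have "((\<lambda>s. - 1 / real (Suc j) * inverse (s ^ Suc j) + C) has_real_derivative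
      - 1 / real (Suc j) * - (inverse (s ^ Suc j) * (real (Suc j) * s ^ j) * inverse (s ^ Suc j)) + 0) (at s)"
    using assms(1) by simp
  then show ?thesis
    unfolding m
    by (rule back_subst[of "\<lambda>D. (_ has_real_derivative D) (at s)", OF back_subst[of "\<lambda>h. (h has_real_derivative _) (at s)"]])
      (use assms(1) in \<open>simp_all add: field_simps del: of_nat_Suc\<close>)
qed

context laurent_desingularization begin

lemma f_smooth: "smooth_on UNIV f"
  using desing by (simp add: desing_function_def)

lemma f_has_deriv: "(f has_real_derivative deriv f s) (at s)"
  using smooth_on_differentiable[OF f_smooth, of s] DERIV_deriv_iff_real_differentiable by blast

lemma deriv_f_smooth: "smooth_on UNIV (deriv f)"
proof -
  have "dir_deriv 1 f = deriv f"
    using frechet_derivative_at[OF f_has_deriv[unfolded has_field_derivative_def], symmetric] by (simp add: fun_eq_iff)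
  then show ?thesis using smooth_on_dir_deriv[OF f_smooth, of 1] by simp
qed

lemma deriv_f_far:
  assumes "\<bar>s\<bar> > 1"
  shows "deriv f s = 1 / s ^ (2 * k)"
proof -
  let ?m = "2 * k - 1"
  have m: "?m > 0" "Suc ?m = 2 * k" using k_pos by auto
  have far: "f s = - 1 / (real ?m * s ^ ?m) - 2" if "s < - 1" for s
    using desing that by (simp add: desing_function_def)
  have far': "f s = - 1 / (real ?m * s ^ ?m) + 2" if "s > 1" for s
    using desing that by (simp add: desing_function_def)
  obtain C S where CS: "open S" "s \<in> S" "\<And>z. z \<in> S \<Longrightarrow> - 1 / (real ?m * z ^ ?m) + C = f z"
  proof (cases "s < -1")
    case True
    show ?thesis by (rule that[of "{..<-1}" "-2"]) (use True far in auto)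
  next
    case False
    show ?thesis by (rule that[of "{1<..}" "2"]) (use False assms far' in auto)
  qed
  have "((\<lambda>s. - 1 / (real ?m * s ^ ?m) + C) has_real_derivative 1 / s ^ Suc ?m) (at s)"
    by (rule DERIV_negative_power_antiderivative) (use assms m in auto)
  from has_field_derivative_transform_within_open[OF this CS]
  show ?thesis unfolding m(2) by (rule DERIV_imp_deriv)
qed

lemma deriv_f_pos: "deriv f s > 0"
proof (cases "\<bar>s\<bar> > 1")
  case True
  then have "s ^ (2 * k) > 0" by (auto simp: zero_less_power_eq)
  then show ?thesis using deriv_f_far[OF True] by simp
next
  case False
  then have "s \<in> {-1..1}" by auto
  then show ?thesis using desing unfolding desing_function_def by blast
qed

text \<open>This is \<open>1/f\<^sub>\<epsilon>'\<close>. It differs from \<open>s\<^sup>2\<^sup>k\<close> by a bump of width \<open>\<epsilon>\<close> and of height of the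
  order \<open>\<epsilon>\<^sup>2\<^sup>k\<close>.\<close>

definition \<gamma> :: "real \<Rightarrow> real \<Rightarrow> real" where
  "\<gamma> \<epsilon> s = \<epsilon> ^ (2 * k) / deriv f (s / \<epsilon>)"

lemma \<gamma>_pos: "\<epsilon> > 0 \<Longrightarrow> \<gamma> \<epsilon> s > 0"
  by (simp add: \<gamma>_def deriv_f_pos)

lemma \<gamma>_far:
  assumes "\<epsilon> > 0" "\<bar>s\<bar> > \<epsilon>"
  shows "\<gamma> \<epsilon> s = s ^ (2 * k)"
proof -
  have "\<bar>s / \<epsilon>\<bar> > 1" using assms by (simp add: abs_divide)
  from deriv_f_far[OF this] show ?thesis using assms by (simp add: \<gamma>_def power_divide)
qed

lemma f_eps_has_deriv:
  assumes "\<epsilon> > 0"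
  shows "(f_eps k f \<epsilon> has_real_derivative inverse (\<gamma> \<epsilon> s)) (at s)"
proof -
  have "((\<lambda>s. f (s / \<epsilon>)) has_real_derivative deriv f (s / \<epsilon>) * (1 / \<epsilon>)) (at s)"
    by (rule DERIV_chain2[OF f_has_deriv]) (use assms in \<open>auto intro!: derivative_eq_intros\<close>)
  from DERIV_cdivide[OF this, of "\<epsilon> ^ (2 * k - 1)"]
  have "(f_eps k f \<epsilon> has_real_derivative deriv f (s / \<epsilon>) * (1 / \<epsilon>) / \<epsilon> ^ (2 * k - 1)) (at s)"
    by (simp add: f_eps_def[abs_def])
  moreover have "\<epsilon> ^ (2 * k) = \<epsilon> * \<epsilon> ^ (2 * k - 1)" using k_pos by (cases k) auto
  ultimately show ?thesis by (simp add: \<gamma>_def field_simps)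
qed

lemma smooth_on_iff: "smooth_on UNIV (h :: real \<Rightarrow> real) \<longleftrightarrow> (\<forall>y r. jet_lim (at_right (0::real)) r (\<lambda>t. h) h y)"
  using smooth_on_iff_jet_lim[of UNIV h "at_right (0::real)"] by auto

lemma smooth_scaled:
  assumes "smooth_on UNIV (h :: real \<Rightarrow> real)"
  shows "smooth_on UNIV (\<lambda>s. h (s / \<epsilon>) / a)"
proof -
  have "smooth_on UNIV (\<lambda>s. s / \<epsilon>)"
    unfolding smooth_on_iff divide_inverse by (intro allI jet_lim_mult jet_lim_ident jet_lim_const)
  from jet_lim_compose[OF open_UNIV this UNIV_I, where G="\<lambda>t. h" and g=h] assms
  have "jet_lim (at_right (0::real)) r (\<lambda>t s. h (s / \<epsilon>)) (\<lambda>s. h (s / \<epsilon>)) y" for r y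
    unfolding smooth_on_iff[of h] by blast
  then show ?thesis unfolding smooth_on_iff divide_inverse[of _ a] by (intro allI jet_lim_mult jet_lim_const)
qed

lemma f_eps_smooth: "smooth_on UNIV (f_eps k f \<epsilon>)"
  using smooth_scaled[OF f_smooth, of \<epsilon> "\<epsilon> ^ (2 * k - 1)"] by (simp add: f_eps_def[abs_def])

lemma inverse_\<gamma>_has_deriv: "((\<lambda>s. inverse (\<gamma> \<epsilon> s)) has_real_derivative deriv (\<lambda>s. inverse (\<gamma> \<epsilon> s)) s) (at s)"
proof -
  have "(\<lambda>s. inverse (\<gamma> \<epsilon> s)) = (\<lambda>s. deriv f (s / \<epsilon>) / \<epsilon> ^ (2 * k))" by (simp add: \<gamma>_def fun_eq_iff)
  then have "(\<lambda>s. inverse (\<gamma> \<epsilon> s)) differentiable (at s)"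
    using smooth_on_differentiable[OF smooth_scaled[OF deriv_f_smooth, of \<epsilon> "\<epsilon> ^ (2 * k)"], of s] by simp
  then show ?thesis using DERIV_deriv_iff_real_differentiable by blast
qed

lemma \<gamma>_jet_lim:
  assumes "r < 2 * k"
  shows "jet_lim (at_right 0) r \<gamma> (\<lambda>s. s ^ (2 * k)) y"
proof -
  define h where "h s = 1 / deriv f s - s ^ (2 * k)" for s
  have ne: "deriv f s \<noteq> 0" for s using deriv_f_pos[of s] by simp
  have "smooth_on UNIV h"
    unfolding smooth_on_iff h_def[abs_def]
    using deriv_f_smooth[unfolded smooth_on_iff] ne
    by (intro allI jet_lim_diff jet_lim_divide jet_lim_power jet_lim_ident jet_lim_const) blast+
  moreover have "h s = 0" if "\<bar>s\<bar> > 1" for s by (simp add: h_def deriv_f_far[OF that])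
  ultimately have "jet_lim (at_right 0) r (\<lambda>\<epsilon> s. \<epsilon> ^ (2 * k) * h (s / \<epsilon>)) (\<lambda>s. 0) y"
    using assms by (rule jet_lim_scaled_bump)
  from jet_lim_add[OF this jet_lim_power[OF jet_lim_ident]]
  have "jet_lim (at_right 0) r (\<lambda>\<epsilon> s. \<epsilon> ^ (2 * k) * h (s / \<epsilon>) + s ^ (2 * k)) (\<lambda>s. 0 + s ^ (2 * k)) y" .
  then show ?thesis
  proof (rule jet_lim_cong)
    have "\<forall>\<^sub>F p in at_right (0::real) \<times>\<^sub>F nhds y. fst p > 0"
      by (rule eventually_fst_prod) (simp add: eventually_at_right_less)
    then show "\<forall>\<^sub>F p in at_right 0 \<times>\<^sub>F nhds y. fst p ^ (2 * k) * h (snd p / fst p) + snd p ^ (2 * k) = \<gamma> (fst p) (snd p)"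
      by eventually_elim (simp add: h_def \<gamma>_def power_divide right_diff_distrib)
  qed simp
qed

lemma \<gamma>_field_lim:
  assumes "c \<in> A" "p \<in> fst c" "r < 2 * k"
  shows "field_lim (at_right 0) c r (\<lambda>\<epsilon> q. \<gamma> \<epsilon> (x q)) (\<lambda>q. x q ^ (2 * k)) p"
proof -
  have "p \<in> fst c \<inter> topspace X" using chart_subset[OF chart[OF assms(1)]] assms(2) by auto
  from field_lim_compose_real[OF chart[OF assms(1)] openin_topspace this x_smooth[OF assms(1)] \<gamma>_jet_lim[OF assms(3)]]
  show ?thesis .
qed

lemma \<omega>\<epsilon>_eq:
  assumes "\<epsilon> > 0" "c \<in> A" "p \<in> fst c \<inter> U"
  shows "\<omega>\<epsilon> \<epsilon> c p u v = inverse (\<gamma> \<epsilon> (x p)) * \<eta> c p u v + \<beta> c p u v"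
proof -
  have "chart_deriv (\<lambda>q. f_eps k f \<epsilon> (x q)) c p u = inverse (\<gamma> \<epsilon> (x p)) * chart_deriv x c p u" for u
    using assms chart_deriv_real_function(1)[OF chart[OF assms(2)] _ x_differentiable f_eps_has_deriv, of p] by simp
  then show ?thesis using assms(3) by (simp add: desingularization_def wedge_def algebra_simps)
qed

lemma \<omega>\<epsilon>_far:
  assumes "\<epsilon> > 0" "c \<in> A" "p \<in> fst c" "\<bar>x p\<bar> > \<epsilon>"
  shows "\<omega>\<epsilon> \<epsilon> c p = \<omega> c p"
proof (cases "p \<in> U")
  case True
  have "p \<notin> Z" using assms by (auto simp: zero_set_def)
  then show ?thesis
    using True assms by (intro ext) (simp add: \<omega>\<epsilon>_eq \<omega>_eq \<gamma>_far)
next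
  case False
  then show ?thesis by (simp add: desingularization_def fun_eq_iff)
qed

lemma openin_far: "openin X {p \<in> topspace X. \<bar>x p\<bar> > \<epsilon>}"
proof -
  have "open {s::real. \<bar>s\<bar> > \<epsilon>}" by (intro open_Collect_less continuous_intros)
  from openin_x[OF this] show ?thesis by simp
qed

text \<open>On \<open>U\<close> the form is \<open>f\<^sub>\<epsilon>'(x) \<eta> + \<beta>\<close> with \<open>d\<eta> = 0\<close> and \<open>dx \<and> \<eta> = 0\<close>, and the rest of the
  manifold is covered by the set \<open>\<bar>x\<bar> > \<epsilon>\<close>, where the form is \<open>\<omega>\<close>.\<close>

lemma \<omega>\<epsilon>_closed:
  assumes \<epsilon>: "\<epsilon> > 0" and sub: "{p \<in> topspace X. \<bar>x p\<bar> \<le> \<epsilon>} \<subseteq> U"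
  shows "closed_two_form A (topspace X) (\<omega>\<epsilon> \<epsilon>)"
proof -
  let ?V = "{p \<in> topspace X. \<bar>x p\<bar> > \<epsilon>}"
  let ?\<psi> = "\<lambda>s. inverse (\<gamma> \<epsilon> s)"
  let ?h = "\<lambda>q. f_eps k f \<epsilon> (x q)"
  let ?\<sigma> = "\<lambda>c p u v. wedge (chart_deriv ?h) \<Lambda> c p u v + \<beta> c p u v"
  have "smooth_in c U ?h" if c: "c \<in> A" for c
  proof (rule smooth_inI_field_lim[OF chart[OF c] U(1)])
    fix p r assume p: "p \<in> fst c \<inter> U"
    show "field_lim (at_right (0::real)) c r (\<lambda>t. ?h) ?h p"
      using field_lim_compose_real[OF chart[OF c] U(1) p x_smooth_subset[OF U(3) c], of "at_right (0::real)" r "\<lambda>t. f_eps k f \<epsilon>" "f_eps k f \<epsilon>"]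
        f_eps_smooth[of \<epsilon>] unfolding smooth_on_iff by blast
  qed
  then have tf: "two_form A U ?\<sigma>"
    by (intro two_form_add[OF U(1) _ \<beta>_two_form] two_form_wedge[OF U(1) _ laurent_sum_one_form] one_form_differential[OF U(1)])
  have eq: "?\<psi> (x p) * \<eta> c p u v + \<beta> c p u v = ?\<sigma> c p u v" if "c \<in> A" "p \<in> fst c \<inter> U" for c p u v
    using \<omega>\<epsilon>_eq[OF \<epsilon> that, of u v] that(2) by (simp add: desingularization_def)
  have "ext_deriv ?\<sigma> c p u v w = 0" if c: "c \<in> A" and p: "p \<in> fst c \<inter> U" for c p u v w
  proof -
    have "ext_deriv ?\<sigma> c p u v w = ext_deriv (\<lambda>c q u v. ?\<psi> (x q) * \<eta> c q u v + \<beta> c q u v) c p u v w"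
      by (rule ext_deriv_cong[OF chart[OF c] U(1) p], rule eq[OF c, symmetric])
    also have "\<dots> = ?\<psi> (x p) * ext_deriv \<eta> c p u v w"
      by (rule ext_deriv_scaled_\<eta>[OF c p inverse_\<gamma>_has_deriv])
    also have "ext_deriv \<eta> c p u v w = 0"
      using \<eta>_closed c p unfolding closed_two_form_ext_deriv by auto
    finally show ?thesis by simp
  qed
  with tf have "closed_two_form A U ?\<sigma>" by (simp add: closed_two_form_ext_deriv)
  then have "closed_two_form A U (\<omega>\<epsilon> \<epsilon>)"
    by (rule closed_two_form_cong[OF U(1), rotated]) (simp add: desingularization_def)
  moreover have "closed_two_form A ?V (\<omega>\<epsilon> \<epsilon>)"
  proof (rule closed_two_form_cong[OF openin_far])
    show "closed_two_form A ?V \<omega>"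
      by (rule closed_two_form_subset[OF \<omega>_closed]) (use \<epsilon> in \<open>auto simp: zero_set_def\<close>)
    show "\<omega> c p u v = \<omega>\<epsilon> \<epsilon> c p u v" if "c \<in> A" "p \<in> fst c \<inter> ?V" for c p u v
      using \<omega>\<epsilon>_far[OF \<epsilon> that(1), of p] that(2) by simp
  qed
  moreover have "U \<union> ?V = topspace X" using sub U(3) by force
  ultimately show ?thesis using closed_two_form_Un[of U "\<omega>\<epsilon> \<epsilon>" ?V] by simp
qed

end

section \<open>Rescaled frames\<close>

text \<open>This map multiplies the component along the unit vector \<open>e\<close> by \<open>g\<close> and fixes the orthogonal
  complement of \<open>e\<close>. Written in this way it is visibly polynomial in \<open>g\<close>, and \<open>g = x\<^sup>m\<close> gives the
  frame of the \<open>b\<^sup>m\<close>-tangent bundle.\<close>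

definition rescale :: "'e::euclidean_space \<Rightarrow> real \<Rightarrow> 'e \<Rightarrow> 'e" where
  "rescale e g u = u + ((g - 1) * (u \<bullet> e)) *\<^sub>R e"

lemma bm_frame_eq_rescale: "bm_frame m x e q u = rescale e (x q ^ m) u"
  by (simp add: bm_frame_def rescale_def algebra_simps)

lemma rescale_linear: "linear (rescale e g)"
  unfolding rescale_def by (rule linearI) (simp_all add: inner_add_left algebra_simps)

lemma rescale_inner: "e \<in> Basis \<Longrightarrow> rescale e g u \<bullet> e = g * (u \<bullet> e)"
  by (simp add: rescale_def inner_add_left algebra_simps)

lemma rescale_rescale: "e \<in> Basis \<Longrightarrow> rescale e g (rescale e h u) = rescale e (g * h) u"
  by (simp add: rescale_inner rescale_def[of e g "rescale e h u"]) (simp add: rescale_def algebra_simps flip: scaleR_add_left)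

lemma rescale_inverse: "e \<in> Basis \<Longrightarrow> g * h = 1 \<Longrightarrow> rescale e g (rescale e h u) = u"
  by (subst rescale_rescale) (simp_all add: rescale_def)

lemma adjoint_rescale: "adjoint (rescale e g) = rescale e g"
  by (rule adjoint_unique) (simp add: rescale_def inner_add_left inner_add_right inner_commute algebra_simps)

text \<open>With \<open>T = rescale e g\<close>, this is the expansion of \<open>inv_form w (T a) (T b)\<close> for an alternating
  inverse; the term quadratic in \<open>g - 1\<close> is a multiple of \<open>inv_form w e e = 0\<close>. It recovers the inverse of
  a form from that of its matrix \<open>w\<close> in the rescaled frame.\<close>

definition frame_inverse :: "'e::euclidean_space \<Rightarrow> real \<Rightarrow> ('e \<Rightarrow> 'e \<Rightarrow> real) \<Rightarrow> 'e \<Rightarrow> 'e \<Rightarrow> real" where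
  "frame_inverse e g w a b
     = inv_form w a b + (g - 1) * ((a \<bullet> e) * inv_form w e b + (b \<bullet> e) * inv_form w a e)"

lemma frame_inverse:
  assumes w: "alternating_form w" and e: "e \<in> Basis" and g: "g \<noteq> 0"
    and N: "\<And>u v. N u v = w (rescale e g u) (rescale e g v)"
  shows "nondegenerate N \<longleftrightarrow> nondegenerate w"
    and "nondegenerate w \<Longrightarrow> inv_form w a b = frame_inverse e g N a b"
    and "alternating_form N"
proof -
  have inv: "rescale e g (rescale e (inverse g) u) = u" "rescale e (inverse g) (rescale e g u) = u" for u
    using g by (simp_all add: rescale_inverse[OF e])
  show N_alt: "alternating_form N"
  proof -
    have b: "bilinear w" using w by (simp add: alternating_form_def)
    note lin = rescale_linear[of e g]
    have "bilinear N"
      unfolding bilinear_def N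
      by (auto intro!: linearI simp: linear_add[OF lin] linear_cmul[OF lin] bilinear_simps[OF b])
    then show ?thesis using w by (simp add: alternating_form_def N)
  qed
  have w_N: "w u v = N (rescale e (inverse g) u) (rescale e (inverse g) v)" for u v
    by (simp add: N inv)
  note tr = inv_form_transform[OF w _ rescale_linear inv(2) inv(1) N]
  show "nondegenerate N \<longleftrightarrow> nondegenerate w"
    using tr(2) inv_form_transform(2)[OF N_alt _ rescale_linear inv(1) inv(2) w_N] by blast
  assume nd: "nondegenerate w"
  have b: "bilinear (inv_form N)" and z: "inv_form N e e = 0"
    using inv_form_alternating[OF N_alt tr(2)[OF nd]] by (auto simp: alternating_form_def)
  have "inv_form w a b = inv_form N (rescale e g a) (rescale e g b)"
    using tr(3)[OF nd] by (simp add: adjoint_rescale)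
  also have "\<dots> = frame_inverse e g N a b"
    by (simp only: rescale_def frame_inverse_def bilinear_simps[OF b] z) (simp add: algebra_simps)
  finally show "inv_form w a b = frame_inverse e g N a b" .
qed

section \<open>Nondegeneracy and convergence of the desingularization\<close>

context laurent_desingularization begin

text \<open>In a chart with \<open>x\<close> as the coordinate along \<open>e\<close>, this is \<open>g\<^sup>-\<^sup>1 \<eta> + \<beta>\<close> in the rescaled frame.
  The scaling of \<open>\<eta> = dx \<and> \<Lambda>\<close> by \<open>g\<close> cancels the denominator, so that the formula makes sense for
  \<open>g = 0\<close> too.\<close>

definition frame_form :: "real ^ 'n \<Rightarrow> real \<Rightarrow> ('a, real ^ 'n) two_field" where
  "frame_form e g c q u v
     = \<eta> c q u v + \<beta> c q u v + (g - 1) * ((u \<bullet> e) * \<beta> c q e v + (v \<bullet> e) * \<beta> c q u e)"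

definition coordinate_chart :: "('a, real ^ 'n) chart \<Rightarrow> real ^ 'n \<Rightarrow> bool" where
  "coordinate_chart c e \<longleftrightarrow> c \<in> A \<and> e \<in> Basis \<and> (\<forall>q\<in>fst c. x q = snd c q \<bullet> e)"

lemma frame_form_eq:
  assumes c: "coordinate_chart c e" and q: "q \<in> fst c \<inter> U" and sg: "s * g = 1"
  shows "frame_form e g c q u v
    = s * \<eta> c q (rescale e g u) (rescale e g v) + \<beta> c q (rescale e g u) (rescale e g v)"
proof -
  have cA: "c \<in> A" and e: "e \<in> Basis" and xe: "\<And>q. q \<in> fst c \<Longrightarrow> x q = snd c q \<bullet> e"
    using c by (auto simp: coordinate_chart_def)
  have cq: "q \<in> fst c" using q by simp
  have "chart_deriv x c q = chart_deriv (\<lambda>q. snd c q \<bullet> e) c q"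
    by (rule chart_deriv_cong[OF chart[OF cA] chart_openin[OF chart[OF cA]]]) (use cq xe in auto)
  then have dx: "chart_deriv x c q u = u \<bullet> e" for u
    using chart_deriv_inner[OF transition_differentiable[OF cA cA], of q e u] cq
    by (simp add: chart_deriv_self[OF cA cq])
  define l where "l = \<Lambda> c q"
  have lin: "linear l" unfolding l_def using laurent_sum_one_form cA q by (auto simp: one_form_def)
  have l: "l (rescale e g w) = l w + (g - 1) * (w \<bullet> e) * l e" for w
    by (simp add: rescale_def linear_add[OF lin] linear_cmul[OF lin])
  have \<eta>: "\<eta> c q u v = (u \<bullet> e) * l v - (v \<bullet> e) * l u" for u v
    by (simp add: wedge_def dx l_def)
  have "s * \<eta> c q (rescale e g u) (rescale e g v) = (s * g) * \<eta> c q u v"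
    unfolding \<eta> l rescale_inner[OF e] by (simp add: algebra_simps)
  then have 1: "s * \<eta> c q (rescale e g u) (rescale e g v) = \<eta> c q u v" using sg by simp
  have b: "bilinear (\<beta> c q)" and z: "\<beta> c q e e = 0"
    using two_form_alternating[OF \<beta>_two_form cA q] by (auto simp: alternating_form_def)
  have "\<beta> c q (rescale e g u) (rescale e g v)
      = \<beta> c q u v + (g - 1) * ((u \<bullet> e) * \<beta> c q e v + (v \<bullet> e) * \<beta> c q u e)"
    by (simp only: rescale_def bilinear_simps[OF b] z)
      (simp add: algebra_simps)
  then show ?thesis by (simp add: frame_form_def 1)
qed

lemma frame_form_field_lim:
  assumes "c \<in> A" "p \<in> fst c \<inter> U" "field_lim F c r G g p"
  shows "field_lim F c r (\<lambda>t q. frame_form e (G t q) c q u v) (\<lambda>q. frame_form e (g q) c q u v) p"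
  unfolding frame_form_def
  by (intro field_lim_add field_lim_mult field_lim_diff field_lim_const assms(3)
      two_form_field_lim[OF U(1) \<eta>_two_form assms(1,2)] two_form_field_lim[OF U(1) \<beta>_two_form assms(1,2)])

lemma frame_form_alternating:
  assumes "c \<in> A" "q \<in> fst c \<inter> U"
  shows "alternating_form (frame_form e g c q)"
proof -
  have "alternating_form (\<eta> c q)" "alternating_form (\<beta> c q)"
    using two_form_alternating[OF \<eta>_two_form assms] two_form_alternating[OF \<beta>_two_form assms] by auto
  then have b: "bilinear (\<eta> c q)" "bilinear (\<beta> c q)" and z: "\<eta> c q u u = 0" "\<beta> c q u u = 0" for u
    by (auto simp: alternating_form_def)
  have anti: "\<beta> c q u e = - \<beta> c q e u" for u
    using alternating_form_antisym[OF \<open>alternating_form (\<beta> c q)\<close>] .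
  have "bilinear (frame_form e g c q)"
    unfolding bilinear_def frame_form_def
    by (auto intro!: linearI simp: bilinear_simps[OF b(1)]
        bilinear_simps[OF b(2)] inner_add_left)
      (simp_all add: algebra_simps)
  moreover have "frame_form e g c q u u = 0" for u
    by (simp add: frame_form_def z anti)
  ultimately show ?thesis by (simp add: alternating_form_def)
qed

abbreviation frame_bivector :: "real ^ 'n \<Rightarrow> real \<Rightarrow> ('a, real ^ 'n) two_field" where
  "frame_bivector e g c q \<equiv> frame_inverse e g (frame_form e g c q)"

lemma x_power_field_lim: "c \<in> A \<Longrightarrow> p \<in> fst c \<Longrightarrow> field_lim F c r (\<lambda>t q. x q ^ m) (\<lambda>q. x q ^ m) p"
  by (intro field_lim_power x_field_lim)

text \<open>The second condition says that \<open>\<omega>\<close> is nondegenerate along \<open>Z\<close> as a section of the second exterior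
  power of the \<open>b\<^sup>2\<^sup>k\<close>-cotangent bundle.\<close>

definition adapted_chart :: "('a, real ^ 'n) chart \<Rightarrow> real ^ 'n \<Rightarrow> bool" where
  "adapted_chart c e \<longleftrightarrow> coordinate_chart c e \<and> (\<forall>p\<in>fst c \<inter> Z. nondegenerate (frame_form e 0 c p))"

text \<open>Off \<open>Z\<close> the components of \<open>\<omega>\<close> in the frame of the \<open>b\<^sup>2\<^sup>k\<close>-tangent bundle are those of
  \<open>frame_form\<close> with \<open>g = x\<^sup>2\<^sup>k\<close>. Both extend smoothly across \<open>Z\<close>, hence agree there.\<close>

lemma obtain_adapted_chart:
  assumes "p \<in> Z"
  obtains c e where "adapted_chart c e" "p \<in> fst c"
proof -
  obtain c e b where c: "p \<in> fst c" and comp: "bm_components (2 * k) X A x \<omega> c e b"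
    using \<omega>_symplectic assms unfolding bm_symplectic_def bm_two_form_def by blast
  have cA: "c \<in> A" and cc: "coordinate_chart c e" and e: "e \<in> Basis"
    and b_smooth: "\<And>u v. smooth_in c (topspace X) (\<lambda>q. b q u v)"
    and b_eq: "\<And>q u v. q \<in> fst c - Z \<Longrightarrow> b q u v = \<omega> c q (rescale e (x q ^ (2 * k)) u) (rescale e (x q ^ (2 * k)) v)"
    using comp unfolding bm_components_def coordinate_chart_def bm_frame_eq_rescale by blast+
  have "nondegenerate (frame_form e 0 c p)" if p: "p \<in> fst c \<inter> Z" for p
  proof -
    have pU: "p \<in> fst c \<inter> U" using p U(2) by auto
    have x0: "x p ^ (2 * k) = 0" using p k_pos by (simp add: zero_set_def)
    have "b p u v - frame_form e (x p ^ (2 * k)) c p u v = 0" for u v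
    proof (rule zero_off_Z_imp_zero[OF cA U(1) pU])
      show "b q u v - frame_form e (x q ^ (2 * k)) c q u v = 0" if q: "q \<in> fst c \<inter> U - Z" for q
      proof -
        have xq: "x q \<noteq> 0" using q U(3) by (auto simp: zero_set_def)
        have "\<omega> c q u v = inverse (x q ^ (2 * k)) * \<eta> c q u v + \<beta> c q u v" for u v
          using \<omega>_eq[OF cA] q by auto
        then show ?thesis
          using b_eq[of q u v] frame_form_eq[OF cc, of q "inverse (x q ^ (2 * k))" "x q ^ (2 * k)" u v] q xq by simp
      qed
      have "field_lim (at_right (0::real)) c 1 (\<lambda>t q. b q u v) (\<lambda>q. b q u v) p"
        by (rule smooth_in_imp_field_lim[OF chart[OF cA] openin_topspace _ b_smooth]) (use pU U(3) in auto)
      from field_lim_diff[OF this frame_form_field_lim[OF cA pU x_power_field_lim[OF cA]]]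
      show "local_expr (\<lambda>q. b q u v - frame_form e (x q ^ (2 * k)) c q u v) c differentiable at (snd c p)"
        by (intro field_lim_differentiable) (use pU in auto)
    qed
    then have "b p = frame_form e 0 c p" using x0 by (simp add: fun_eq_iff)
    moreover have "nondegenerate (b p)"
      using \<omega>_symplectic p comp unfolding bm_symplectic_def by blast
    ultimately show ?thesis by simp
  qed
  then show ?thesis using that cc c unfolding adapted_chart_def by blast
qed

lemma \<omega>\<epsilon>_alternating:
  assumes "\<epsilon> > 0" "c \<in> A" "q \<in> fst c \<inter> U"
  shows "alternating_form (\<omega>\<epsilon> \<epsilon> c q)"
proof -
  define E where "E = \<eta> c q"
  have b: "bilinear E" "bilinear (\<beta> c q)" and z: "E u u = 0" "\<beta> c q u u = 0" for u
    unfolding E_def using two_form_alternating[OF \<eta>_two_form assms(2,3)] two_form_alternating[OF \<beta>_two_form assms(2,3)]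
    by (auto simp: alternating_form_def)
  show ?thesis
    unfolding alternating_form_def bilinear_def \<omega>\<epsilon>_eq[OF assms] E_def[symmetric]
    by (auto intro!: linearI simp: z bilinear_simps[OF b(1)]
        bilinear_simps[OF b(2)] algebra_simps)
qed

lemma \<omega>\<epsilon>_frame:
  assumes \<epsilon>: "\<epsilon> > 0" and c: "coordinate_chart c e" and q: "q \<in> fst c \<inter> U"
  defines "N \<equiv> frame_form e (\<gamma> \<epsilon> (x q)) c q"
  shows "nondegenerate N \<longleftrightarrow> nondegenerate (\<omega>\<epsilon> \<epsilon> c q)"
    and "nondegenerate (\<omega>\<epsilon> \<epsilon> c q) \<Longrightarrow> P\<epsilon> \<epsilon> c q a b = frame_inverse e (\<gamma> \<epsilon> (x q)) N a b"
proof -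
  have cA: "c \<in> A" and e: "e \<in> Basis" using c by (auto simp: coordinate_chart_def)
  have g: "\<gamma> \<epsilon> (x q) \<noteq> 0" using \<gamma>_pos[OF \<epsilon>, of "x q"] by simp
  have "N u v = \<omega>\<epsilon> \<epsilon> c q (rescale e (\<gamma> \<epsilon> (x q)) u) (rescale e (\<gamma> \<epsilon> (x q)) v)" for u v
    unfolding N_def \<omega>\<epsilon>_eq[OF \<epsilon> cA q] by (rule frame_form_eq[OF c q]) (use g in simp)
  note fr = frame_inverse[OF \<omega>\<epsilon>_alternating[OF \<epsilon> cA q] e g this]
  show "nondegenerate N \<longleftrightarrow> nondegenerate (\<omega>\<epsilon> \<epsilon> c q)" by (rule fr(1))
  show "P\<epsilon> \<epsilon> c q a b = frame_inverse e (\<gamma> \<epsilon> (x q)) N a b"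
    if "nondegenerate (\<omega>\<epsilon> \<epsilon> c q)"
    unfolding inverse_bivector_eq by (rule fr(2)[OF that])
qed

lemma \<omega>_frame:
  assumes c: "coordinate_chart c e" and q: "q \<in> fst c \<inter> (U - Z)"
  shows "inverse_bivector \<omega> c q a b = frame_bivector e (x q ^ (2 * k)) c q a b"
proof -
  have cA: "c \<in> A" and e: "e \<in> Basis" using c by (auto simp: coordinate_chart_def)
  have g: "x q ^ (2 * k) \<noteq> 0" using q U(3) by (auto simp: zero_set_def)
  have qc: "q \<in> fst c - Z" "q \<in> fst c \<inter> U" "q \<in> fst c \<inter> (topspace X - Z)" using q U(3) by auto
  have N: "frame_form e (x q ^ (2 * k)) c q u v = \<omega> c q (rescale e (x q ^ (2 * k)) u) (rescale e (x q ^ (2 * k)) v)" for u v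
    unfolding \<omega>_eq[OF cA q] by (rule frame_form_eq[OF c qc(2)]) (use g in simp)
  show ?thesis
    unfolding inverse_bivector_eq
    by (rule frame_inverse(2)[OF two_form_alternating[OF \<omega>_two_form cA qc(3)] e g N \<omega>_nondegenerate[OF cA qc(1)]])
qed

text \<open>The dependence on \<open>g\<close> is rational without pole near \<open>g = 0\<close>, so that the inverse converges in
  \<open>C\<^sup>r\<close> as soon as the factors \<open>g\<close> do. Taking them to be \<open>\<gamma>\<^sub>\<epsilon>(x)\<close> gives the convergence of
  \<open>\<omega>\<^sub>\<epsilon>\<^sup>-\<^sup>1\<close>, and the constant family \<open>x\<^sup>2\<^sup>k\<close> gives the smoothness of the limit.\<close>

lemma frame_inverse_field_lim:
  assumes c: "adapted_chart c e" and p: "p \<in> fst c \<inter> Z" and F: "F \<noteq> bot"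
    and G: "field_lim F c r G (\<lambda>q. x q ^ (2 * k)) p"
  shows "field_lim F c r (\<lambda>t q. frame_bivector e (G t q) c q a b)
    (\<lambda>q. frame_bivector e (x q ^ (2 * k)) c q a b) p"
proof -
  have cA: "c \<in> A" using c by (simp add: adapted_chart_def coordinate_chart_def)
  have pU: "p \<in> fst c \<inter> U" and cp: "p \<in> fst c" using p U(2) by auto
  have x0: "x p ^ (2 * k) = 0" using p k_pos by (simp add: zero_set_def)
  have nd: "nondegenerate (frame_form e (x p ^ (2 * k)) c p)"
    using c p unfolding adapted_chart_def x0 by blast
  have inv: "field_lim F c r (\<lambda>t q. inv_form (frame_form e (G t q) c q) a b)
      (\<lambda>q. inv_form (frame_form e (x q ^ (2 * k)) c q) a b) p" for a b
    by (rule field_lim_inv_form[of X c U p F r "\<lambda>t q. frame_form e (G t q) c q" "\<lambda>q. frame_form e (x q ^ (2 * k)) c q",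
          OF chart[OF cA] U(1) pU frame_form_field_lim[OF cA pU G] frame_form_field_lim[OF cA pU x_power_field_lim[OF cA cp]] F
            _ frame_form_alternating[OF cA] nd])
      (use frame_form_alternating[OF cA] in auto)
  show ?thesis
    unfolding frame_inverse_def
    by (intro field_lim_add field_lim_mult field_lim_diff field_lim_const inv G)
qed

text \<open>The function \<open>\<bar>x\<bar>\<close> has a positive lower bound on the compact complement of \<open>W\<close>.\<close>

lemma eventually_strip_subset:
  assumes "openin X W" "Z \<subseteq> W"
  shows "\<forall>\<^sub>F \<epsilon> in at_right 0. {p \<in> topspace X. \<bar>x p\<bar> \<le> \<epsilon>} \<subseteq> W"
proof -
  have "closedin X (topspace X - W)" using assms(1) by (simp add: closedin_def openin_subset Diff_Diff_Int Int_absorb1)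
  then have "compactin X (topspace X - W)" using compact closedin_compact_space by blast
  then have "compactin euclidean (x ` (topspace X - W))" using image_compactin x_continuous by blast
  then have "compact (x ` (topspace X - W))" by simp
  then have "open (- x ` (topspace X - W))" using compact_imp_closed open_Compl by blast
  moreover have "0 \<notin> x ` (topspace X - W)" using assms(2) by (auto simp: zero_set_def)
  ultimately obtain d where d: "d > 0" "ball 0 d \<subseteq> - x ` (topspace X - W)"
    using open_contains_ball by (metis ComplI)
  have "\<forall>\<^sub>F \<epsilon> in at_right 0. \<epsilon> < d" using d(1) eventually_at_right_field by blast
  then show ?thesis
  proof eventually_elim
    case (elim \<epsilon>)
    show ?case
    proof
      fix p assume p: "p \<in> {p \<in> topspace X. \<bar>x p\<bar> \<le> \<epsilon>}"
      then have "x p \<in> ball 0 d" using elim by (simp add: dist_real_def)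
      then show "p \<in> W" using d(2) p by blast
    qed
  qed
qed

text \<open>The determinant of \<open>frame_form\<close> is continuous in \<open>g\<close> and in the point, and nonzero at \<open>g = 0\<close> and
  \<open>p\<close>, while \<open>\<gamma>\<^sub>\<epsilon>(x)\<close> tends to zero when \<open>\<epsilon>\<close> tends to zero and the point to \<open>p\<close>.\<close>

lemma eventually_nondegenerate_near:
  assumes "p \<in> Z"
  obtains V where "openin X V" "p \<in> V"
    "\<forall>\<^sub>F \<epsilon> in at_right 0. \<forall>q\<in>V. \<exists>c\<in>A. q \<in> fst c \<and> nondegenerate (\<omega>\<epsilon> \<epsilon> c q)"
proof -
  obtain c e where c: "adapted_chart c e" "p \<in> fst c" using obtain_adapted_chart[OF assms] .
  have cc: "coordinate_chart c e" and cA: "c \<in> A" using c by (auto simp: adapted_chart_def coordinate_chart_def)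
  have pU: "p \<in> fst c \<inter> U" using c assms U(2) by auto
  have x0: "x p ^ (2 * k) = 0" using assms k_pos by (simp add: zero_set_def)
  have nd: "nondegenerate (frame_form e (x p ^ (2 * k)) c p)"
    using c assms unfolding adapted_chart_def x0 by blast
  have alt: "bilinear (frame_form e g c q)" if "q \<in> fst c \<inter> U" for g q
    using frame_form_alternating[OF cA that] by (simp add: alternating_form_def)
  have "field_lim (at_right 0) c 0 (\<lambda>\<epsilon> q. \<gamma> \<epsilon> (x q)) (\<lambda>q. x q ^ (2 * k)) p"
    using \<gamma>_field_lim[OF cA c(2)] k_pos by simp
  note lim = frame_form_field_lim[OF cA pU this]
  obtain V where V: "openin X V" "p \<in> V" "V \<subseteq> fst c \<inter> U"
    "\<forall>\<^sub>F \<epsilon> in at_right 0. \<forall>q\<in>V. nondegenerate (frame_form e (\<gamma> \<epsilon> (x q)) c q)"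
    by (rule field_lim_nondegenerate[of X c U p "at_right 0" 0 "\<lambda>\<epsilon> q. frame_form e (\<gamma> \<epsilon> (x q)) c q"
          "\<lambda>q. frame_form e (x q ^ (2 * k)) c q", OF chart[OF cA] U(1) pU lim _ alt[OF pU] nd])
      (use alt in auto)
  have "\<forall>\<^sub>F \<epsilon> in at_right 0. \<epsilon> > (0::real)" by (simp add: eventually_at_right_less)
  with V(4) have "\<forall>\<^sub>F \<epsilon> in at_right 0. \<forall>q\<in>V. \<exists>c\<in>A. q \<in> fst c \<and> nondegenerate (\<omega>\<epsilon> \<epsilon> c q)"
  proof eventually_elim
    case (elim \<epsilon>)
    show ?case
    proof
      fix q assume q: "q \<in> V"
      then have "q \<in> fst c \<inter> U" using V(3) by auto
      then show "\<exists>c\<in>A. q \<in> fst c \<and> nondegenerate (\<omega>\<epsilon> \<epsilon> c q)"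
        using \<omega>\<epsilon>_frame(1)[OF elim(2) cc] elim(1) q cA by blast
    qed
  qed
  then show ?thesis using that V(1,2) by blast
qed

lemma eventually_symplectic:
  "\<forall>\<^sub>F \<epsilon> in at_right 0. \<epsilon> > 0 \<and> {p \<in> topspace X. \<bar>x p\<bar> \<le> \<epsilon>} \<subseteq> U \<and> symplectic A (topspace X) (\<omega>\<epsilon> \<epsilon>)"
proof -
  let ?N = "\<lambda>\<epsilon> q. \<exists>c\<in>A. q \<in> fst c \<and> nondegenerate (\<omega>\<epsilon> \<epsilon> c q)"
  have "\<forall>p\<in>Z. \<exists>V. openin X V \<and> p \<in> V \<and> (\<forall>\<^sub>F \<epsilon> in at_right 0. \<forall>q\<in>V. ?N \<epsilon> q)"
  proof
    fix p assume "p \<in> Z"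
    then obtain V where "openin X V" "p \<in> V" "\<forall>\<^sub>F \<epsilon> in at_right 0. \<forall>q\<in>V. ?N \<epsilon> q"
      by (rule eventually_nondegenerate_near)
    then show "\<exists>V. openin X V \<and> p \<in> V \<and> (\<forall>\<^sub>F \<epsilon> in at_right 0. \<forall>q\<in>V. ?N \<epsilon> q)" by (intro exI conjI)
  qed
  from bchoice[OF this] obtain V where
    "\<forall>p\<in>Z. openin X (V p) \<and> p \<in> V p \<and> (\<forall>\<^sub>F \<epsilon> in at_right 0. \<forall>q\<in>V p. ?N \<epsilon> q)"
    by (rule exE)
  then have V: "openin X (V p)" "p \<in> V p" "\<forall>\<^sub>F \<epsilon> in at_right 0. \<forall>q\<in>V p. ?N \<epsilon> q" if "p \<in> Z" for p
    using that by simp_all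
  have "closedin X Z"
    using openin_minus_Z Z_subset by (simp add: closedin_def)
  then have "compactin X Z" using compact closedin_compact_space by blast
  then obtain \<F> where \<F>: "finite \<F>" "\<F> \<subseteq> V ` Z" "Z \<subseteq> \<Union>\<F>"
    using compactinD[of X Z "V ` Z"] V(1,2) by blast
  then obtain C where C: "C \<subseteq> Z" "finite C" "Z \<subseteq> (\<Union>p\<in>C. V p)"
    using finite_subset_image[OF \<F>(1,2)] by blast
  have "openin X (\<Union>p\<in>C. V p)" using C V(1) by blast
  from eventually_strip_subset[OF this C(3)] eventually_strip_subset[OF U(1,2)]
  have strip: "\<forall>\<^sub>F \<epsilon> in at_right 0. {p \<in> topspace X. \<bar>x p\<bar> \<le> \<epsilon>} \<subseteq> (\<Union>p\<in>C. V p)"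
    "\<forall>\<^sub>F \<epsilon> in at_right 0. {p \<in> topspace X. \<bar>x p\<bar> \<le> \<epsilon>} \<subseteq> U" .
  have nd: "\<forall>\<^sub>F \<epsilon> in at_right 0. \<forall>p\<in>C. \<forall>q\<in>V p. ?N \<epsilon> q"
    using C(1,2) V(3) by (intro eventually_ball_finite) auto
  have pos: "\<forall>\<^sub>F \<epsilon> in at_right 0. \<epsilon> > (0::real)" by (simp add: eventually_at_right_less)
  show ?thesis
    using strip nd pos
  proof eventually_elim
    case (elim \<epsilon>)
    have cl: "closed_two_form A (topspace X) (\<omega>\<epsilon> \<epsilon>)" by (rule \<omega>\<epsilon>_closed[OF elim(4,2)])
    then have tf: "two_form A (topspace X) (\<omega>\<epsilon> \<epsilon>)" by (simp add: closed_two_form_def)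
    have "nondegenerate (\<omega>\<epsilon> \<epsilon> c q)" if c: "c \<in> A" "q \<in> fst c \<inter> topspace X" for c q
    proof (cases "\<bar>x q\<bar> \<le> \<epsilon>")
      case True
      then have "q \<in> (\<Union>p\<in>C. V p)" using elim(1) c by blast
      then obtain d where d: "d \<in> A" "q \<in> fst d" "nondegenerate (\<omega>\<epsilon> \<epsilon> d q)" using elim(3) by blast
      show ?thesis by (rule two_form_nondegenerate_change_chart(1)[OF tf c(1) d(1) _ d(3)]) (use c d in auto)
    next
      case False
      then have "q \<notin> Z" using elim(4) by (auto simp: zero_set_def)
      then show ?thesis using \<omega>\<epsilon>_far[OF elim(4) c(1), of q] False \<omega>_nondegenerate[OF c(1), of q] c(2) by simp
    qed
    then show ?case using elim cl by (simp add: symplectic_def)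
  qed
qed

text \<open>The pointwise limit serves as the extension of \<open>\<omega>\<^sup>-\<^sup>1\<close> across \<open>Z\<close>: it inherits all
  algebraic properties and transformation laws from the inverses of the forms \<open>\<omega>\<^sub>\<epsilon>\<close>.\<close>

definition limit_bivector :: "('a, real ^ 'n) two_field" where
  "limit_bivector c p a b = Lim (at_right 0) (\<lambda>\<epsilon>. P\<epsilon> \<epsilon> c p a b)"

lemma limit_bivectorI:
  "((\<lambda>\<epsilon>. P\<epsilon> \<epsilon> c p a b) \<longlongrightarrow> l) (at_right 0) \<Longrightarrow> limit_bivector c p a b = l"
  unfolding limit_bivector_def by (rule tendsto_Lim) simp_all

lemma eventually_far:
  assumes "c \<in> A" "p \<in> fst c - Z"
  shows "\<forall>\<^sub>F \<epsilon> in at_right 0. \<forall>q\<in>fst c \<inter> {q \<in> topspace X. \<bar>x q\<bar> > \<bar>x p\<bar> / 2}. \<omega>\<epsilon> \<epsilon> c q = \<omega> c q"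
proof -
  have "x p \<noteq> 0" using assms chart_subset[OF chart[OF assms(1)]] by (auto simp: zero_set_def)
  then have "\<forall>\<^sub>F \<epsilon> in at_right 0. \<epsilon> < \<bar>x p\<bar> / 2"
    using eventually_at_right_field[of _ "0::real"] by (meson half_gt_zero zero_less_abs_iff)
  moreover have "\<forall>\<^sub>F \<epsilon> in at_right 0. \<epsilon> > (0::real)" by (simp add: eventually_at_right_less)
  ultimately show ?thesis
    by eventually_elim (use \<omega>\<epsilon>_far[OF _ assms(1)] in auto)
qed

lemma limit_bivector_off_Z:
  assumes "c \<in> A" "p \<in> fst c - Z"
  shows "limit_bivector c p = inverse_bivector \<omega> c p"
    and "((\<lambda>\<epsilon>. P\<epsilon> \<epsilon> c p a b) \<longlongrightarrow> inverse_bivector \<omega> c p a b) (at_right 0)"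
proof -
  have px: "p \<in> fst c \<inter> {q \<in> topspace X. \<bar>x q\<bar> > \<bar>x p\<bar> / 2}"
    using assms chart_subset[OF chart[OF assms(1)]] by (auto simp: zero_set_def)
  have lim: "((\<lambda>\<epsilon>. P\<epsilon> \<epsilon> c p a b) \<longlongrightarrow> inverse_bivector \<omega> c p a b) (at_right 0)" for a b
  proof (rule tendsto_eventually)
    show "\<forall>\<^sub>F \<epsilon> in at_right 0. P\<epsilon> \<epsilon> c p a b = inverse_bivector \<omega> c p a b"
      using eventually_far[OF assms] by eventually_elim (use px in \<open>simp add: inverse_bivector_eq\<close>)
  qed
  then show "((\<lambda>\<epsilon>. P\<epsilon> \<epsilon> c p a b) \<longlongrightarrow> inverse_bivector \<omega> c p a b) (at_right 0)" .
  show "limit_bivector c p = inverse_bivector \<omega> c p"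
    by (intro ext limit_bivectorI lim)
qed

lemma symplectic_two_form: "symplectic A W \<tau> \<Longrightarrow> two_form A W \<tau>"
  by (simp add: symplectic_def closed_two_form_def)

lemma adapted_chart_inverse_field_lim:
  assumes c: "adapted_chart c e" and p: "p \<in> fst c \<inter> Z" and r: "r < 2 * k"
  shows "field_lim (at_right 0) c r (\<lambda>\<epsilon> q. P\<epsilon> \<epsilon> c q a b)
    (\<lambda>q. frame_bivector e (x q ^ (2 * k)) c q a b) p"
proof -
  have cc: "coordinate_chart c e" and cA: "c \<in> A" using c by (auto simp: adapted_chart_def coordinate_chart_def)
  have pU: "p \<in> fst c \<inter> U" and cp: "p \<in> fst c" using p U(2) by auto
  have "field_lim (at_right 0) c r (\<lambda>\<epsilon> q. frame_bivector e (\<gamma> \<epsilon> (x q)) c q a b)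
    (\<lambda>q. frame_bivector e (x q ^ (2 * k)) c q a b) p"
    by (rule frame_inverse_field_lim[OF c p _ \<gamma>_field_lim[OF cA cp r]]) simp
  then show ?thesis
  proof (rule field_lim_cong[OF chart[OF cA] U(1) pU])
    show "\<forall>\<^sub>F \<epsilon> in at_right 0. \<forall>q\<in>fst c \<inter> U. frame_bivector e (\<gamma> \<epsilon> (x q)) c q a b
        = P\<epsilon> \<epsilon> c q a b"
      using eventually_symplectic
    proof eventually_elim
      case (elim \<epsilon>)
      then have "\<epsilon> > 0" by simp
      have "nondegenerate (\<omega>\<epsilon> \<epsilon> c q)" if "q \<in> fst c \<inter> U" for q
        using elim that cA U(3) unfolding symplectic_def by blast
      then show ?case using \<omega>\<epsilon>_frame(2)[OF \<open>\<epsilon> > 0\<close> cc] by auto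
    qed
  qed simp
qed

lemma limit_bivector_adapted:
  assumes c: "adapted_chart c e" and q: "q \<in> fst c \<inter> U"
  shows "limit_bivector c q a b = frame_bivector e (x q ^ (2 * k)) c q a b"
proof -
  have cc: "coordinate_chart c e" and cA: "c \<in> A" using c by (auto simp: adapted_chart_def coordinate_chart_def)
  show ?thesis
  proof (cases "q \<in> Z")
    case True
    have "field_lim (at_right 0) c 0 (\<lambda>\<epsilon> q. P\<epsilon> \<epsilon> c q a b)
      (\<lambda>q. frame_bivector e (x q ^ (2 * k)) c q a b) q"
      using True q k_pos by (intro adapted_chart_inverse_field_lim[OF c]) auto
    from field_lim_pointwise[OF chart[OF cA] _ this] show ?thesis using q by (intro limit_bivectorI) simp
  next
    case False
    then show ?thesis using limit_bivector_off_Z(1)[OF cA, of q] \<omega>_frame[OF cc, of q] q by simp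
  qed
qed

lemma inverse_bivector_change_chart:
  assumes "symplectic A (topspace X) \<tau>" "c \<in> A" "d \<in> A" "p \<in> fst c \<inter> fst d"
  shows "inverse_bivector \<tau> d p a b
    = inverse_bivector \<tau> c p (adjoint (chart_deriv (snd d) c p) a) (adjoint (chart_deriv (snd d) c p) b)"
proof (rule two_form_nondegenerate_change_chart(2)[OF symplectic_two_form[OF assms(1)] assms(2,3)])
  show "p \<in> fst c \<inter> fst d \<inter> topspace X" using assms(4) chart_subset[OF chart[OF assms(2)]] by auto
  then show "nondegenerate (\<tau> d p)" using assms unfolding symplectic_def by blast
qed

lemma inverse_bivector_alternating:
  assumes "symplectic A (topspace X) \<tau>" "c \<in> A" "p \<in> fst c"
  shows "alternating_form (inverse_bivector \<tau> c p)"
proof -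
  have p: "p \<in> fst c \<inter> topspace X" using assms(3) chart_subset[OF chart[OF assms(2)]] by auto
  have "nondegenerate (\<tau> c p)" using assms p unfolding symplectic_def by blast
  then show ?thesis
    unfolding inverse_bivector_eq
    by (rule inv_form_alternating[OF two_form_alternating[OF symplectic_two_form[OF assms(1)] assms(2) p]])
qed

lemma limit_bivector_tendsto:
  assumes c: "c \<in> A" "p \<in> fst c"
  shows "((\<lambda>\<epsilon>. P\<epsilon> \<epsilon> c p a b) \<longlongrightarrow> limit_bivector c p a b) (at_right 0)"
proof (cases "p \<in> Z")
  case True
  obtain d e where d: "adapted_chart d e" "p \<in> fst d" using obtain_adapted_chart[OF True] .
  have dA: "d \<in> A" using d by (simp add: adapted_chart_def coordinate_chart_def)
  let ?D = "adjoint (chart_deriv (snd c) d p)"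
  have "field_lim (at_right 0) d 0 (\<lambda>\<epsilon> q. P\<epsilon> \<epsilon> d q (?D a) (?D b))
      (\<lambda>q. frame_bivector e (x q ^ (2 * k)) d q (?D a) (?D b)) p"
    using d True k_pos by (intro adapted_chart_inverse_field_lim) auto
  from field_lim_pointwise[OF chart[OF dA] d(2) this]
  obtain l where l: "((\<lambda>\<epsilon>. P\<epsilon> \<epsilon> d p (?D a) (?D b)) \<longlongrightarrow> l) (at_right 0)" by blast
  have "\<forall>\<^sub>F \<epsilon> in at_right 0. P\<epsilon> \<epsilon> d p (?D a) (?D b) = P\<epsilon> \<epsilon> c p a b"
    using eventually_symplectic
  proof eventually_elim
    case (elim \<epsilon>)
    then have s: "symplectic A (topspace X) (\<omega>\<epsilon> \<epsilon>)" by simp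
    have "p \<in> fst d \<inter> fst c" using c d by simp
    from inverse_bivector_change_chart[OF s dA c(1) this] show ?case by simp
  qed
  note t = Lim_transform_eventually[OF l this]
  show ?thesis using t unfolding limit_bivectorI[OF t] .
next
  case False
  then show ?thesis using limit_bivector_off_Z[OF c(1), of p] c(2) by simp
qed

lemma limit_bivector_alternating:
  assumes "c \<in> A" "p \<in> fst c"
  shows "alternating_form (limit_bivector c p)"
proof (rule alternating_form_limit[OF _ _ limit_bivector_tendsto[OF assms]])
  show "\<forall>\<^sub>F \<epsilon> in at_right 0. alternating_form (P\<epsilon> \<epsilon> c p)"
    using eventually_symplectic by eventually_elim (use inverse_bivector_alternating assms in blast)
qed simp

lemma limit_bivector_change_chart:
  assumes "c \<in> A" "d \<in> A" "p \<in> fst c \<inter> fst d"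
  shows "limit_bivector d p a b
    = limit_bivector c p (adjoint (chart_deriv (snd d) c p) a) (adjoint (chart_deriv (snd d) c p) b)"
proof (rule limit_bivectorI)
  let ?D = "adjoint (chart_deriv (snd d) c p)"
  have cp: "p \<in> fst c" using assms by simp
  show "((\<lambda>\<epsilon>. P\<epsilon> \<epsilon> d p a b) \<longlongrightarrow> limit_bivector c p (?D a) (?D b)) (at_right 0)"
  proof (rule Lim_transform_eventually[OF limit_bivector_tendsto[OF assms(1) cp]])
    show "\<forall>\<^sub>F \<epsilon> in at_right 0. P\<epsilon> \<epsilon> c p (?D a) (?D b) = P\<epsilon> \<epsilon> d p a b"
      using eventually_symplectic by eventually_elim (use inverse_bivector_change_chart[OF _ assms] in simp)
  qed
qed

text \<open>At a point of \<open>Z\<close> both claims hold in an adapted chart and are transported to \<open>c\<close>. Near any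
  other point the family is equal to \<open>\<omega>\<^sup>-\<^sup>1\<close> for all small \<open>\<epsilon>\<close>.\<close>

lemma limit_bivector_field_lim:
  assumes c: "c \<in> A" "p \<in> fst c"
  shows "r < 2 * k \<Longrightarrow> field_lim (at_right 0) c r (\<lambda>\<epsilon> q. P\<epsilon> \<epsilon> c q a b) (\<lambda>q. limit_bivector c q a b) p"
    and "field_lim (at_right (0::real)) c r (\<lambda>t q. limit_bivector c q a b) (\<lambda>q. limit_bivector c q a b) p"
proof -
  let ?F = "at_right (0::real)"
  have "(r < 2 * k \<longrightarrow> field_lim ?F c r (\<lambda>\<epsilon> q. P\<epsilon> \<epsilon> c q a b) (\<lambda>q. limit_bivector c q a b) p)
    \<and> field_lim ?F c r (\<lambda>t q. limit_bivector c q a b) (\<lambda>q. limit_bivector c q a b) p"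
  proof (cases "p \<in> Z")
    case True
    obtain d e where d: "adapted_chart d e" "p \<in> fst d" using obtain_adapted_chart[OF True] .
    have dA: "d \<in> A" using d by (simp add: adapted_chart_def coordinate_chart_def)
    have pd: "p \<in> fst d \<inter> Z" "p \<in> fst d \<inter> U" "p \<in> fst d \<inter> fst c" using d True c U(2) by auto
    let ?L = "\<lambda>a b q. frame_bivector e (x q ^ (2 * k)) d q a b"
    have L: "?L a b q = limit_bivector d q a b" if "q \<in> fst d \<inter> U" for a b q
      using limit_bivector_adapted[OF d(1) that] by simp
    have "field_lim ?F d r (\<lambda>\<epsilon> q. P\<epsilon> \<epsilon> d q a b) (\<lambda>q. limit_bivector d q a b) p"
      if "r < 2 * k" for a b
      by (rule field_lim_cong[OF chart[OF dA] U(1) pd(2) adapted_chart_inverse_field_lim[OF d(1) pd(1) that]]) (use L in auto)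
    moreover have "field_lim ?F d r (\<lambda>t q. limit_bivector d q a b) (\<lambda>q. limit_bivector d q a b) p" for a b
    proof (rule field_lim_cong[OF chart[OF dA] U(1) pd(2)])
      show "field_lim ?F d r (\<lambda>t. ?L a b) (?L a b) p"
        by (rule frame_inverse_field_lim[OF d(1) pd(1) _ x_power_field_lim[OF dA d(2)]]) simp
    qed (use L in auto)
    moreover have law: "\<forall>q\<in>fst d \<inter> fst c. bilinear (limit_bivector d q) \<and> (\<forall>a b. limit_bivector c q a b
        = limit_bivector d q (adjoint (chart_deriv (snd c) d q) a) (adjoint (chart_deriv (snd c) d q) b))"
      using limit_bivector_alternating[OF dA] limit_bivector_change_chart[OF dA c(1)]
      unfolding alternating_form_def by blast
    moreover have "\<forall>\<^sub>F \<epsilon> in ?F. \<forall>q\<in>fst d \<inter> fst c. bilinear (P\<epsilon> \<epsilon> d q) \<and>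
       (\<forall>a b. P\<epsilon> \<epsilon> c q a b = P\<epsilon> \<epsilon> d q
          (adjoint (chart_deriv (snd c) d q) a) (adjoint (chart_deriv (snd c) d q) b))"
      using eventually_symplectic
    proof eventually_elim
      case (elim \<epsilon>)
      then have s: "symplectic A (topspace X) (\<omega>\<epsilon> \<epsilon>)" by simp
      show ?case
        using inverse_bivector_alternating[OF s dA] inverse_bivector_change_chart[OF s dA c(1)]
        unfolding alternating_form_def by blast
    qed
    ultimately show ?thesis
      using bivector_field_lim_change_chart[OF dA c(1) pd(3), of ?F r P\<epsilon> limit_bivector]
        bivector_field_lim_change_chart[OF dA c(1) pd(3), of ?F r "\<lambda>t. limit_bivector" limit_bivector]
      by simp
  next
    case False
    let ?W = "{q \<in> topspace X. \<bar>x q\<bar> > \<bar>x p\<bar> / 2}"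
    have ic: "is_chart X c" by (rule chart[OF c(1)])
    have pZ: "p \<in> fst c - Z" "p \<in> fst c \<inter> (topspace X - Z)" and px: "x p \<noteq> 0"
      using False c chart_subset[OF ic] by (auto simp: zero_set_def)
    have pW: "p \<in> fst c \<inter> ?W" using c px chart_subset[OF ic] by auto
    have \<omega>lim: "field_lim ?F c r (\<lambda>t q. inverse_bivector \<omega> c q a b) (\<lambda>q. inverse_bivector \<omega> c q a b) p"
      by (rule inverse_bivector_field_lim[where \<tau>=\<omega>, OF ic openin_minus_Z pZ(2) _ two_form_smooth[OF \<omega>_two_form c(1)]
            two_form_alternating[OF \<omega>_two_form c(1)] \<omega>_nondegenerate[OF c(1) pZ(1)]]) simp_all
    have eq: "inverse_bivector \<omega> c q a b = limit_bivector c q a b" if "q \<in> fst c \<inter> ?W" for q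
      using limit_bivector_off_Z(1)[OF c(1), of q] that by (auto simp: zero_set_def)
    have "field_lim ?F c r (\<lambda>\<epsilon> q. P\<epsilon> \<epsilon> c q a b) (\<lambda>q. limit_bivector c q a b) p"
    proof (rule field_lim_cong[OF ic openin_far pW \<omega>lim])
      show "\<forall>\<^sub>F \<epsilon> in ?F. \<forall>q\<in>fst c \<inter> ?W. inverse_bivector \<omega> c q a b = P\<epsilon> \<epsilon> c q a b"
        using eventually_far[OF c(1) pZ(1)] by eventually_elim (simp add: inverse_bivector_eq)
    qed (rule eq)
    moreover have "field_lim ?F c r (\<lambda>t q. limit_bivector c q a b) (\<lambda>q. limit_bivector c q a b) p"
      by (rule field_lim_cong[OF ic openin_far pW \<omega>lim]) (use eq in auto)
    ultimately show ?thesis by simp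
  qed
  then show "r < 2 * k \<Longrightarrow> field_lim ?F c r (\<lambda>\<epsilon> q. P\<epsilon> \<epsilon> c q a b) (\<lambda>q. limit_bivector c q a b) p"
    and "field_lim ?F c r (\<lambda>t q. limit_bivector c q a b) (\<lambda>q. limit_bivector c q a b) p"
    by auto
qed

lemma limit_bivector_bivector_field: "bivector_field A (topspace X) limit_bivector"
  unfolding bivector_field_def
proof (intro conjI ballI allI)
  fix c p assume "c \<in> A" "p \<in> fst c \<inter> topspace X"
  then have "alternating_form (limit_bivector c p)" by (intro limit_bivector_alternating) auto
  then show "bilinear (limit_bivector c p)" "limit_bivector c p a a = 0" for a
    by (auto simp: alternating_form_def)
next
  fix c d p a b assume "c \<in> A" "d \<in> A" "p \<in> fst c \<inter> fst d \<inter> topspace X"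
  then show "limit_bivector d p a b
    = limit_bivector c p (adjoint (chart_deriv (snd d) c p) a) (adjoint (chart_deriv (snd d) c p) b)"
    by (intro limit_bivector_change_chart) auto
next
  fix c a b assume c: "c \<in> A"
  show "smooth_in c (topspace X) (\<lambda>p. limit_bivector c p a b)"
    by (intro smooth_inI_field_lim[OF chart[OF c] openin_topspace] limit_bivector_field_lim(2)[OF c]) simp
qed

lemma chart_deriv_hamvec:
  assumes "local_expr h c differentiable (at (snd c p))"
  shows "chart_deriv h c p (hamvec P c p a) = (\<Sum>i\<in>Basis. P c p a i * chart_deriv h c p i)"
proof -
  note lin = chart_deriv_linear[OF assms]
  show ?thesis unfolding hamvec_def by (simp add: linear_sum[OF lin] linear_cmul[OF lin])
qed

text \<open>Each \<open>\<omega>\<^sub>\<epsilon>\<^sup>-\<^sup>1\<close> satisfies the Jacobi identity, which involves the first derivatives only and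
  thus passes to the \<open>C\<^sup>1\<close>-limit.\<close>

lemma limit_bivector_poisson: "poisson A (topspace X) limit_bivector"
  unfolding poisson_def
proof (intro conjI ballI allI)
  show "bivector_field A (topspace X) limit_bivector" by (rule limit_bivector_bivector_field)
  fix c p a b d assume c: "c \<in> A" and pX: "p \<in> fst c \<inter> topspace X"
  have p: "p \<in> fst c" using pX by simp
  have ic: "is_chart X c" by (rule chart[OF c])
  let ?F = "at_right (0::real)"
  define T where "T P a b d = (\<Sum>i\<in>Basis. P c p a i * chart_deriv (\<lambda>q. P c q b d) c p i)"
    for P :: "('a, real ^ 'n) two_field" and a b d
  have k1: "1 < 2 * k" using k_pos by simp
  have T_lim: "((\<lambda>\<epsilon>. T (P\<epsilon> \<epsilon>) a b d) \<longlongrightarrow> T limit_bivector a b d) ?F" for a b d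
    unfolding T_def
  proof (intro tendsto_sum tendsto_mult limit_bivector_tendsto[OF c p])
    fix i :: "real ^ 'n"
    have "field_lim ?F c (Suc 0) (\<lambda>\<epsilon> q. P\<epsilon> \<epsilon> c q b d) (\<lambda>q. limit_bivector c q b d) p"
      using limit_bivector_field_lim(1)[OF c p k1] by simp
    from field_lim_pointwise[OF ic p field_lim_chart_deriv[OF ic p this]]
    show "((\<lambda>\<epsilon>. chart_deriv (\<lambda>q. P\<epsilon> \<epsilon> c q b d) c p i) \<longlongrightarrow> chart_deriv (\<lambda>q. limit_bivector c q b d) c p i) ?F" .
  qed
  have T_eq: "chart_deriv (\<lambda>q. limit_bivector c q b d) c p (hamvec limit_bivector c p a) = T limit_bivector a b d" for a b d
    unfolding T_def
    by (rule chart_deriv_hamvec[OF field_lim_differentiable[OF limit_bivector_field_lim(2)[OF c p]]])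
  have "\<forall>\<^sub>F \<epsilon> in ?F. T (P\<epsilon> \<epsilon>) a b d + T (P\<epsilon> \<epsilon>) b d a + T (P\<epsilon> \<epsilon>) d a b = 0"
    using eventually_symplectic
  proof eventually_elim
    case (elim \<epsilon>)
    then have s: "symplectic A (topspace X) (\<omega>\<epsilon> \<epsilon>)" by simp
    note tf = symplectic_two_form[OF s]
    have nd: "nondegenerate (\<omega>\<epsilon> \<epsilon> c q)" if "q \<in> fst c \<inter> topspace X" for q
      using s c that unfolding symplectic_def by blast
    have ext: "ext_deriv (\<omega>\<epsilon> \<epsilon>) c p u v w = 0" for u v w
      using s c pX unfolding symplectic_def closed_two_form_ext_deriv by blast
    have Pd: "local_expr (\<lambda>q. P\<epsilon> \<epsilon> c q a b) c differentiable (at (snd c p))" for a b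
      by (rule field_lim_differentiable[OF inverse_bivector_field_lim[where F="?F" and \<tau>="\<omega>\<epsilon> \<epsilon>", OF ic openin_topspace pX _
              two_form_smooth[OF tf c] two_form_alternating[OF tf c] nd[OF pX]]]) simp_all
    show ?case
      using inverse_bivector_jacobi[OF ic openin_topspace pX two_form_smooth[OF tf c] two_form_alternating[OF tf c] nd ext, of b d a]
      by (simp add: chart_deriv_hamvec[OF Pd] T_def)
  qed
  from tendsto_unique[OF _ tendsto_add[OF tendsto_add[OF T_lim T_lim] T_lim] tendsto_eventually[OF this]]
  show "chart_deriv (\<lambda>q. limit_bivector c q b d) c p (hamvec limit_bivector c p a)
     + chart_deriv (\<lambda>q. limit_bivector c q d a) c p (hamvec limit_bivector c p b)
     + chart_deriv (\<lambda>q. limit_bivector c q a b) c p (hamvec limit_bivector c p d) = 0"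
    unfolding T_eq by simp
qed

lemma limit_bivector_converges:
  "converges_C (2 * k - 1) A P\<epsilon> limit_bivector (at_right 0)"
  unfolding converges_C_def
proof (intro ballI allI impI)
  fix c K and vs :: "(real ^ 'n) list" and a b
  assume c: "c \<in> A" and K: "compact K \<and> K \<subseteq> snd c ` fst c" and vs: "length vs \<le> 2 * k - 1"
  have r: "2 * k - 1 < 2 * k" using k_pos by simp
  show "uniform_limit K (\<lambda>\<epsilon>. iter_deriv vs (local_expr (\<lambda>p. P\<epsilon> \<epsilon> c p a b) c))
      (iter_deriv vs (local_expr (\<lambda>p. limit_bivector c p a b) c)) (at_right 0)"
  proof (rule jet_lim_uniform_limit[OF _ vs])
    fix y assume "y \<in> K"
    then obtain p where p: "p \<in> fst c" "y = snd c p" using K by blast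
    show "jet_lim (at_right 0) (2 * k - 1) (\<lambda>\<epsilon>. local_expr (\<lambda>p. P\<epsilon> \<epsilon> c p a b) c)
        (local_expr (\<lambda>p. limit_bivector c p a b) c) y"
      using limit_bivector_field_lim(1)[OF c p(1) r] by (simp add: field_lim_def p(2))
    show "jet_lim (at_right (0::real)) (2 * k - 1) (\<lambda>\<epsilon>. local_expr (\<lambda>p. limit_bivector c p a b) c)
        (local_expr (\<lambda>p. limit_bivector c p a b) c) y"
      using limit_bivector_field_lim(2)[OF c p(1)] by (simp add: field_lim_def p(2))
  qed (use K in blast)
qed

end

theorem theorem3p1:
  fixes X :: "'a topology"
    and A Ori :: "('a, real ^ 'n) chart set"
    and B :: "('a, 'f::euclidean_space) chart set"
    and x :: "'a \<Rightarrow> real"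
    and \<omega> \<beta> :: "('a, real ^ 'n) two_field"
    and \<alpha> :: "nat \<Rightarrow> ('a, 'f) one_field"
    and U :: "'a set" and \<pi> :: "'a \<Rightarrow> 'a"
    and f :: "real \<Rightarrow> real" and k n :: nat
  assumes "k \<ge> 1"
    and "CARD('n) = 2 * n"
    and "DIM('f) = 2 * n - 1"
    and "bm_manifold X A Ori x"
    and "embedded_submanifold X A (zero_set X x) B"
    and "bm_symplectic (2 * k) X A x \<omega>"
    and "laurent_decomposition (2 * k) X A x B U \<pi> \<alpha> \<beta> \<omega>"
    and "desing_function k f"
  defines "\<omega>\<epsilon> \<equiv> desingularization k f x B U \<pi> \<alpha> \<beta> \<omega>"
  shows "(\<forall>\<^sub>F \<epsilon> in at_right 0.
            {p \<in> topspace X. \<bar>x p\<bar> \<le> \<epsilon>} \<subseteq> U \<and> symplectic A (topspace X) (\<omega>\<epsilon> \<epsilon>)) \<and>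
         (\<forall>\<epsilon>>0. {p \<in> topspace X. \<bar>x p\<bar> \<le> \<epsilon>} \<subseteq> U \<longrightarrow>
            (\<forall>c\<in>A. \<forall>p\<in>fst c. \<bar>x p\<bar> > \<epsilon> \<longrightarrow> \<omega>\<epsilon> \<epsilon> c p = \<omega> c p)) \<and>
         (\<exists>P. poisson A (topspace X) P \<and>
            (\<forall>c\<in>A. \<forall>p\<in>fst c - zero_set X x. P c p = inverse_bivector \<omega> c p) \<and>
            converges_C (2 * k - 1) A (\<lambda>\<epsilon>. inverse_bivector (\<omega>\<epsilon> \<epsilon>)) P (at_right 0))"
proof -
  interpret laurent_desingularization X A B x \<omega> \<beta> \<alpha> U \<pi> f k
    using assms(1,4-8) unfolding bm_manifold_def embedded_submanifold_def
    by unfold_locales (auto)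
  have 1: "\<forall>\<^sub>F \<epsilon> in at_right 0. {p \<in> topspace X. \<bar>x p\<bar> \<le> \<epsilon>} \<subseteq> U \<and> symplectic A (topspace X) (\<omega>\<epsilon> \<epsilon>)"
    unfolding \<omega>\<epsilon>_def using eventually_symplectic by eventually_elim simp
  have 2: "\<forall>c\<in>A. \<forall>p\<in>fst c. \<bar>x p\<bar> > \<epsilon> \<longrightarrow> \<omega>\<epsilon> \<epsilon> c p = \<omega> c p" if "\<epsilon> > 0" for \<epsilon>
    unfolding \<omega>\<epsilon>_def using \<omega>\<epsilon>_far[OF that] by blast
  show ?thesis
    using 1 2 limit_bivector_poisson limit_bivector_off_Z(1) limit_bivector_converges
    unfolding \<omega>\<epsilon>_def by blast
qed

end
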